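(* Let $Y$ be an ICCSS$(p,q)$ process with $p>q>0$. Then, for all $t\in\mathbb R$, $$X^q(t)=\int_{-\infty}^te^{\mathbf\Lambda(t-u)}\mathbf\Theta Y(u)\,du\qquad\mathbb P\text{-a.s.}$$
   Context: Setting. Let $k\ge1$ and let $p>q>0$ be integers. $L=(L(t))_{t\in\mathbb R}$ is a two-sided $\mathbb R^k$-valued Lévy process with $\mathbb E L(1)=0$, $\mathbb E\|L(1)\|^2<\infty$. Let $P(z)=I_kz^p+A_1z^{p-1}+\dots+A_p$ and $Q(z)=C_0+C_1z+\dots+C_qz^q$ with $A_i,C_j\in M_k(\mathbb R)$ be right coprime (the stacked $2k\times k$ matrix $\begin{pmatrix} P(z) \\ Q(z) \end{pmatrix}$ has rank $k$ for all $z\in\mathbb C$), with $\operatorname{rank}(C_q)=k$ and such that all zeros of $\det P(z)$ and of $\det Q(z)$ have strictly negative real part. Put $$\mathbf A=\begin{pmatrix} 0_k & I_k & 0_k & \cdots & 0_k \\ \vdots & & \ddots & \ddots & \vdots \\ 0_k & \cdots & \cdots & 0_k & I_k \\ -A_p & -A_{p-1} & \cdots & \cdots & -A_1 \end{pmatrix}\in M_{kp}(\mathbb R),\quad \mathbf B=\begin{pmatrix} 0_k \\ \vdots \\ 0_k \\ I_k \end{pmatrix}\in M_{kp\times k}(\mathbb R),\quad \mathbf C=(C_0,\dots,C_q,0_k,\dots,0_k)\in M_{k\times kp}(\mathbb R).$$ The stationary processes $X(t)=\int_{-\infty}^te^{\mathbf A(t-u)}\mathbf B\,dL(u)$ and $Y(t)=\mathbf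 CX(t)$, $t\in\mathbb R$, are the input process and the ICCSS$(p,q)$ process (causal invertible controller canonical state space process), respectively. $X^{(j)}(t)=(X_{(j-1)k+1}(t),\dots,X_{jk}(t))^\top$ is the $j$-th $k$-block of $X(t)$ and $X^q(t)=(X^{(1)}(t)^\top,\dots,X^{(q)}(t)^\top)^\top\in\mathbb R^{kq}$. Further $$\mathbf\Lambda=\begin{pmatrix} 0_k & I_k & 0_k & \cdots & 0_k \\ \vdots & & \ddots & \ddots & \vdots \\ 0_k & \cdots & \cdots & 0_k & I_k \\ -C_q^{-1}C_0 & -C_q^{-1}C_1 & \cdots & \cdots & -C_q^{-1}C_{q-1} \end{pmatrix}\in M_{kq}(\mathbb R),\qquad \mathbf\Theta=\begin{pmatrix} 0_k \\ \vdots \\ 0_k \\ C_q^{-1} \end{pmatrix}\in M_{kq\times k}(\mathbb R).$$ The integral over $(-\infty,t]$ is the almost sure limit of the pathwise integrals over $[s,t]$ as $s\to-\infty$. *)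

theory Defs
  imports "HOL-Probability.Probability"
begin

text \<open>
  The dimension \<open>k \<ge> 1\<close> is \<open>CARD('k)\<close>. Elements of \<open>M\<^bsub>kn\<^esub>(\<real>)\<close>, \<open>M\<^bsub>kn \<times> k\<^esub>(\<real>)\<close> and \<open>\<real>\<^bsup>kn\<^esup>\<close> are
  represented by their \<open>k\<close>-blocks, with block indices \<open>0, \<dots>, n - 1\<close>; so block \<open>j\<close> is the
  \<open>(j+1)\<close>-st block in one-based counting. Values at indices \<open>\<ge> n\<close> are irrelevant.
\<close>

type_synonym 'k blocks = "nat \<Rightarrow> nat \<Rightarrow> real^'k^'k"

definition block_mult :: "nat \<Rightarrow> 'k::finite blocks \<Rightarrow> 'k blocks \<Rightarrow> 'k blocks" where
  "block_mult n M N = (\<lambda>i j. \<Sum>l<n. M i l ** N l j)"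

definition block_one :: "'k::finite blocks" where
  "block_one = (\<lambda>i j. if i = j then mat 1 else 0)"

primrec block_power :: "nat \<Rightarrow> 'k::finite blocks \<Rightarrow> nat \<Rightarrow> 'k blocks" where
  "block_power n M 0 = block_one"
| "block_power n M (Suc m) = block_mult n M (block_power n M m)"

definition block_exp :: "nat \<Rightarrow> 'k::finite blocks \<Rightarrow> 'k blocks" where
  "block_exp n M = (\<lambda>i j. \<Sum>m. (1 / fact m) *\<^sub>R block_power n M m i j)"

definition block_scale :: "real \<Rightarrow> 'k::finite blocks \<Rightarrow> 'k blocks" where
  "block_scale c M = (\<lambda>i j. c *\<^sub>R M i j)"

definition companion :: "nat \<Rightarrow> (nat \<Rightarrow> real^'k^'k) \<Rightarrow> 'k::finite blocks" where
  "companion n R = (\<lambda>i j. if Suc i = n then R j else if j = Suc i then mat 1 else 0)"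

definition last_block :: "nat \<Rightarrow> real^'k^'k \<Rightarrow> nat \<Rightarrow> real^'k::finite^'k" where
  "last_block n R = (\<lambda>i. if Suc i = n then R else 0)"

definition bigA :: "nat \<Rightarrow> (nat \<Rightarrow> real^'k^'k) \<Rightarrow> 'k::finite blocks" where
  "bigA p A = companion p (\<lambda>j. - A (p - j))"

definition bigB :: "nat \<Rightarrow> nat \<Rightarrow> real^'k::finite^'k" where
  "bigB p = last_block p (mat 1)"

definition bigC :: "nat \<Rightarrow> (nat \<Rightarrow> real^'k^'k) \<Rightarrow> nat \<Rightarrow> real^'k::finite^'k" where
  "bigC q C = (\<lambda>j. if j \<le> q then C j else 0)"

definition bigLambda :: "nat \<Rightarrow> (nat \<Rightarrow> real^'k^'k) \<Rightarrow> 'k::finite blocks" where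
  "bigLambda q C = companion q (\<lambda>j. - (matrix_inv (C q) ** C j))"

definition bigTheta :: "nat \<Rightarrow> (nat \<Rightarrow> real^'k^'k) \<Rightarrow> nat \<Rightarrow> real^'k::finite^'k" where
  "bigTheta q C = last_block q (matrix_inv (C q))"


definition Ppoly :: "nat \<Rightarrow> (nat \<Rightarrow> real^'k^'k) \<Rightarrow> complex \<Rightarrow> complex^'k::finite^'k" where
  "Ppoly p A z = mat (z ^ p) + (\<Sum>i=1..p. map_matrix (\<lambda>a. z ^ (p - i) * complex_of_real a) (A i))"

definition Qpoly :: "nat \<Rightarrow> (nat \<Rightarrow> real^'k^'k) \<Rightarrow> complex \<Rightarrow> complex^'k::finite^'k" where
  "Qpoly q C z = (\<Sum>j\<le>q. map_matrix (\<lambda>c. z ^ j * complex_of_real c) (C j))"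

definition stack :: "complex^'k^'k \<Rightarrow> complex^'k^'k \<Rightarrow> complex^'k::finite^('k + 'k)" where
  "stack U V = (\<chi> r. case r of Inl i \<Rightarrow> U $ i | Inr i \<Rightarrow> V $ i)"

definition ICCSS_coeffs ::
  "nat \<Rightarrow> nat \<Rightarrow> (nat \<Rightarrow> real^'k^'k) \<Rightarrow> (nat \<Rightarrow> real^'k::finite^'k) \<Rightarrow> bool" where
  "ICCSS_coeffs p q A C \<longleftrightarrow>
     (\<forall>z. rank (stack (Ppoly p A z) (Qpoly q C z)) = CARD('k)) \<and>
     rank (C q) = CARD('k) \<and>
     (\<forall>z. det (Ppoly p A z) = 0 \<longrightarrow> Re z < 0) \<and>
     (\<forall>z. det (Qpoly q C z) = 0 \<longrightarrow> Re z < 0)"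


definition two_sided_levy :: "'w measure \<Rightarrow> (real \<Rightarrow> 'w \<Rightarrow> real^'k::finite) \<Rightarrow> bool" where
  "two_sided_levy M L \<longleftrightarrow>
     (\<forall>t. L t \<in> borel_measurable M) \<and>
     (AE \<omega> in M. L 0 \<omega> = 0) \<and>
     (\<forall>(n::nat) s. (\<forall>i<n. s i \<le> s (Suc i)) \<longrightarrow>
        prob_space.indep_vars M (\<lambda>_. borel) (\<lambda>i \<omega>. L (s (Suc i)) \<omega> - L (s i) \<omega>) {..<n}) \<and>
     (\<forall>s t h. distr M borel (\<lambda>\<omega>. L (t + h) \<omega> - L (s + h) \<omega>) =
              distr M borel (\<lambda>\<omega>. L t \<omega> - L s \<omega>)) \<and>
     (\<forall>t. \<forall>\<epsilon>>0. ((\<lambda>s. measure M {\<omega> \<in> space M. norm (L s \<omega> - L t \<omega>) > \<epsilon>}) \<longlongrightarrow> 0) (at t)) \<and>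
     (AE \<omega> in M. \<forall>t. ((\<lambda>s. L s \<omega>) \<longlongrightarrow> L t \<omega>) (at_right t) \<and>
                     (\<exists>l. ((\<lambda>s. L s \<omega>) \<longlongrightarrow> l) (at_left t)))"

text \<open>
  A list of triples \<open>(a, b, F)\<close> encodes the matrix-valued step function that is the sum of the
  \<open>F\<close>-multiples of the indicators of \<open>(a, b]\<close>.
\<close>

definition step_fun :: "(real \<times> real \<times> (real^'k^'k)) list \<Rightarrow> real \<Rightarrow> real^'k::finite^'k" where
  "step_fun xs u = (\<Sum>(a, b, F)\<leftarrow>xs. indicator {a<..b} u *\<^sub>R F)"

definition step_integral ::
  "(real \<Rightarrow> 'w \<Rightarrow> real^'k) \<Rightarrow> (real \<times> real \<times> (real^'k^'k)) list \<Rightarrow> 'w \<Rightarrow> real^'k::finite" where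
  "step_integral L xs \<omega> = (\<Sum>(a, b, F)\<leftarrow>xs. F *v (L b \<omega> - L a \<omega>))"

text \<open>
  \<open>I\<close> is a version of the stochastic integral of the deterministic integrand \<open>f\<close> over \<open>S\<close> with
  respect to \<open>L\<close>: the \<open>L\<^sup>2(M)\<close>-limit of the integrals of step functions that converge to
  \<open>f\<close> (extended by \<open>0\<close> outside \<open>S\<close>) in \<open>L\<^sup>2\<close> of Lebesgue measure. This is meant for centred
  square integrable \<open>L\<close>, for which the isometry makes \<open>I\<close> unique almost surely.
\<close>

definition has_levy_integral ::
  "'w measure \<Rightarrow> (real \<Rightarrow> 'w \<Rightarrow> real^'k) \<Rightarrow> (real \<Rightarrow> real^'k^'k) \<Rightarrow> real set
     \<Rightarrow> ('w \<Rightarrow> real^'k::finite) \<Rightarrow> bool" where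
  "has_levy_integral M L f S I \<longleftrightarrow>
     (\<lambda>u. indicator S u *\<^sub>R f u) \<in> borel_measurable lborel \<and>
     I \<in> borel_measurable M \<and>
     (\<exists>xs :: nat \<Rightarrow> (real \<times> real \<times> (real^'k^'k)) list.
        (\<forall>n. \<forall>(a, b, F) \<in> set (xs n). a \<le> b) \<and>
        (\<lambda>n. \<integral>\<^sup>+u. ennreal ((norm (indicator S u *\<^sub>R f u - step_fun (xs n) u))\<^sup>2) \<partial>lborel) \<longlonglongrightarrow> 0 \<and>
        (\<lambda>n. \<integral>\<^sup>+\<omega>. ennreal ((norm (I \<omega> - step_integral L (xs n) \<omega>))\<^sup>2) \<partial>M) \<longlonglongrightarrow> 0)"

text \<open>
  \<open>X t \<omega> j\<close> is block \<open>j\<close> of \<open>X(t)\<close>. The stochastic integral determines each \<open>X(t)\<close> only up to a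
  null set; \<open>X\<close> is any jointly measurable version (for instance the cadlag one), so that
  its paths can be integrated.
\<close>

definition input_process ::
  "'w measure \<Rightarrow> (real \<Rightarrow> 'w \<Rightarrow> real^'k) \<Rightarrow> nat \<Rightarrow> (nat \<Rightarrow> real^'k^'k)
     \<Rightarrow> (real \<Rightarrow> 'w \<Rightarrow> nat \<Rightarrow> real^'k::finite) \<Rightarrow> bool" where
  "input_process M L p A X \<longleftrightarrow>
     (\<forall>i<p. (\<lambda>(t, \<omega>). X t \<omega> i) \<in> borel_measurable (borel \<Otimes>\<^sub>M M)) \<and>
     (\<forall>t. \<forall>i<p. has_levy_integral M L
        (\<lambda>u. \<Sum>j<p. block_exp p (block_scale (t - u) (bigA p A)) i j ** bigB p j)
        {..t} (\<lambda>\<omega>. X t \<omega> i))"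

definition ICCSS ::
  "'w measure \<Rightarrow> (real \<Rightarrow> 'w \<Rightarrow> real^'k) \<Rightarrow> nat \<Rightarrow> nat \<Rightarrow> (nat \<Rightarrow> real^'k^'k) \<Rightarrow> (nat \<Rightarrow> real^'k^'k)
     \<Rightarrow> (real \<Rightarrow> 'w \<Rightarrow> nat \<Rightarrow> real^'k) \<Rightarrow> (real \<Rightarrow> 'w \<Rightarrow> real^'k::finite) \<Rightarrow> bool" where
  "ICCSS M L p q A C X Y \<longleftrightarrow>
     two_sided_levy M L \<and>
     integrable M (\<lambda>\<omega>. (norm (L 1 \<omega>))\<^sup>2) \<and>
     (\<integral>\<omega>. L 1 \<omega> \<partial>M) = 0 \<and>
     ICCSS_coeffs p q A C \<and>
     input_process M L p A X \<and>
     (\<forall>t. \<forall>\<omega>\<in>space M. Y t \<omega> = (\<Sum>j<p. bigC q C j *v X t \<omega> j))"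


definition has_lower_integral :: "(real \<Rightarrow> real^'k::finite) \<Rightarrow> real \<Rightarrow> real^'k \<Rightarrow> bool" where
  "has_lower_integral f t I \<longleftrightarrow>
     (\<forall>s\<le>t. set_integrable lborel {s..t} f) \<and>
     ((\<lambda>s. LINT u:{s..t}|lborel. f u) \<longlongrightarrow> I) at_bot"

end

theory Submission
  imports Defs "HOL-Computational_Algebra.Fundamental_Theorem_Algebra"
begin

text \<open>
  Let \<open>G\<^sub>l\<close> be the \<open>l\<close>-th block of \<open>e\<^bsup>Ar\<^esup>B\<close>, so that \<open>X(t)\<close> has the kernels \<open>G\<^sub>l(t - \<cdot>)\<close>. The companion
  forms give \<open>G\<^sub>l' = G\<^bsub>l+1\<^esub>\<close> and \<open>G\<^sub>l(0) = 0\<close> for \<open>l < q < p\<close>, hence \<open>(G\<^sub>0, \<dots>, G\<^bsub>q-1\<^esub>)\<close> solves the linear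
  system with matrix \<open>\<Lambda>\<close>, input \<open>\<Theta> \<Sum>\<^sub>l C\<^sub>l G\<^sub>l\<close> and initial value \<open>0\<close>: convolving the kernel of \<open>Y\<close> with
  \<open>e\<^bsup>\<Lambda>r\<^esup>\<Theta>\<close> returns the kernel of \<open>X\<^sup>q\<close>. A stochastic Fubini argument lifts this to the processes. It uses
  only the isometry \<open>E[(\<integral>f dL)(\<integral>g dL)] = \<integral>\<langle>f, \<Sigma> g\<rangle>\<close>: by it the difference of \<open>X\<^sup>q(t)\<close> and the pathwise
  integral is orthogonal to all the variables from which it is built. Absolute convergence at \<open>-\<infinity>\<close> comes
  from the exponential decay of \<open>e\<^bsup>\<Lambda>r\<^esup>\<close>, whose entries solve \<open>Q(D) x = 0\<close>.
\<close>

section \<open>Pathwise integrals of square integrable processes\<close>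

text \<open>\<open>X\<close> is an arbitrary jointly measurable version, so its paths carry no
  regularity and cannot be treated by pathwise integration by parts; all identities are between
  second moments at fixed times. Moments are assumed for \<open>L 1\<close> only, so finite variance
  and zero mean of all increments have to be derived before an isometry makes sense. The isometry
  turns the hypotheses of the orthogonality argument into a Fubini identity for the deterministic
  kernel \<open>H (t - u) ** K (u - v)\<close> on \<open>v \<le> u \<le> t\<close>, whose integral
  over \<open>u\<close> is the convolution. Decay of \<open>H\<close> enters twice: it makes this
  kernel integrable against square integrable functions, and it gives an integrable bound for the
  root mean squares of the integrand. Square integrability of the kernel of \<open>Y\<close> is read
  off from the fact that each \<open>Y(s)\<close> is a Levy integral. Decay is obtained without a
  spectral decomposition of the matrix: a polynomial annihilating the sequence of derivatives is
  split into linear factors, and each factor costs at most one scalar equation of first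
  order.\<close>

lemma L2_mult:
  fixes f g :: "'a \<Rightarrow> real"
  assumes [measurable]: "f \<in> borel_measurable M" "g \<in> borel_measurable M"
    and f: "integrable M (\<lambda>x. (f x)\<^sup>2)" and g: "integrable M (\<lambda>x. (g x)\<^sup>2)"
  shows L2_mult_integrable: "integrable M (\<lambda>x. f x * g x)"
    and L2_mult_abs_le: "(\<integral>x. \<bar>f x * g x\<bar> \<partial>M) \<le> sqrt (\<integral>x. (f x)\<^sup>2 \<partial>M) * sqrt (\<integral>x. (g x)\<^sup>2 \<partial>M)"
proof -
  show i: "integrable M (\<lambda>x. f x * g x)"
  proof (rule Bochner_Integration.integrable_bound)
    show "integrable M (\<lambda>x. (f x)\<^sup>2 + (g x)\<^sup>2)" using f g by simp
    have "\<bar>a * b\<bar> \<le> a\<^sup>2 + b\<^sup>2" for a b :: real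
      using sum_squares_bound[of "\<bar>a\<bar>" "\<bar>b\<bar>"] mult_nonneg_nonneg[of "\<bar>a\<bar>" "\<bar>b\<bar>"]
      unfolding abs_mult power2_abs by linarith
    then show "AE x in M. norm (f x * g x) \<le> norm ((f x)\<^sup>2 + (g x)\<^sup>2)" by simp
  qed simp
  have "(\<integral>\<^sup>+x. ennreal \<bar>f x\<bar> * ennreal \<bar>g x\<bar> \<partial>M)\<^sup>2
      \<le> (\<integral>\<^sup>+x. (ennreal \<bar>f x\<bar>)\<^sup>2 \<partial>M) * (\<integral>\<^sup>+x. (ennreal \<bar>g x\<bar>)\<^sup>2 \<partial>M)"
    by (rule Cauchy_Schwarz_nn_integral) auto
  also have "(\<integral>\<^sup>+x. (ennreal \<bar>f x\<bar>)\<^sup>2 \<partial>M) = ennreal (\<integral>x. (f x)\<^sup>2 \<partial>M)"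
    using f by (subst nn_integral_eq_integral[symmetric]) (auto simp: ennreal_power)
  also have "(\<integral>\<^sup>+x. (ennreal \<bar>g x\<bar>)\<^sup>2 \<partial>M) = ennreal (\<integral>x. (g x)\<^sup>2 \<partial>M)"
    using g by (subst nn_integral_eq_integral[symmetric]) (auto simp: ennreal_power)
  also have "(\<integral>\<^sup>+x. ennreal \<bar>f x\<bar> * ennreal \<bar>g x\<bar> \<partial>M) = ennreal (\<integral>x. \<bar>f x * g x\<bar> \<partial>M)"
    using integrable_abs[OF i] by (subst nn_integral_eq_integral[symmetric]) (auto simp: ennreal_mult' abs_mult)
  finally have "(\<integral>x. \<bar>f x * g x\<bar> \<partial>M)\<^sup>2 \<le> (\<integral>x. (f x)\<^sup>2 \<partial>M) * (\<integral>x. (g x)\<^sup>2 \<partial>M)"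
    by (simp add: ennreal_power ennreal_mult'[symmetric] ennreal_le_iff)
  then show "(\<integral>x. \<bar>f x * g x\<bar> \<partial>M) \<le> sqrt (\<integral>x. (f x)\<^sup>2 \<partial>M) * sqrt (\<integral>x. (g x)\<^sup>2 \<partial>M)"
    by (simp add: real_le_rsqrt real_sqrt_mult[symmetric])
qed

lemma L2_mult_le:
  fixes f g :: "'a \<Rightarrow> real"
  assumes "f \<in> borel_measurable M" "g \<in> borel_measurable M"
    "integrable M (\<lambda>x. (f x)\<^sup>2)" "integrable M (\<lambda>x. (g x)\<^sup>2)"
  shows "\<bar>\<integral>x. f x * g x \<partial>M\<bar> \<le> sqrt (\<integral>x. (f x)\<^sup>2 \<partial>M) * sqrt (\<integral>x. (g x)\<^sup>2 \<partial>M)"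
  using L2_mult_abs_le[OF assms] integral_abs_bound[of M "\<lambda>x. f x * g x"] by linarith

lemma L2_diff:
  fixes f g :: "'a \<Rightarrow> real"
  assumes [measurable]: "f \<in> borel_measurable M" "g \<in> borel_measurable M"
    and f: "integrable M (\<lambda>x. (f x)\<^sup>2)" and g: "integrable M (\<lambda>x. (g x)\<^sup>2)"
  shows "integrable M (\<lambda>x. (f x - g x)\<^sup>2)"
proof -
  have "integrable M (\<lambda>x. (f x)\<^sup>2 + (g x)\<^sup>2 - 2 * (f x * g x))"
    using f g L2_mult_integrable[of f M g] by simp
  then show ?thesis by (simp add: power2_diff algebra_simps)
qed

lemma L2_add:
  fixes f g :: "'a \<Rightarrow> real"
  assumes [measurable]: "f \<in> borel_measurable M" "g \<in> borel_measurable M"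
    and f: "integrable M (\<lambda>x. (f x)\<^sup>2)" and g: "integrable M (\<lambda>x. (g x)\<^sup>2)"
  shows "integrable M (\<lambda>x. (f x + g x)\<^sup>2)"
  using L2_diff[of f M "\<lambda>x. - g x"] assms by simp

text \<open>Continuity of the L2 inner product when both factors are approximated at once; it
  carries both sides of the isometry from step functions to their limits.\<close>

lemma L2_inner_tendsto:
  fixes f g :: "'a \<Rightarrow> real" and F G :: "nat \<Rightarrow> 'a \<Rightarrow> real"
  assumes [measurable]: "f \<in> borel_measurable M" "g \<in> borel_measurable M"
      "\<And>n. F n \<in> borel_measurable M" "\<And>n. G n \<in> borel_measurable M"
    and f: "integrable M (\<lambda>x. (f x)\<^sup>2)" and g: "integrable M (\<lambda>x. (g x)\<^sup>2)"
    and F: "\<And>n. integrable M (\<lambda>x. (F n x)\<^sup>2)" and G: "\<And>n. integrable M (\<lambda>x. (G n x)\<^sup>2)"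
    and limF: "(\<lambda>n. \<integral>x. (f x - F n x)\<^sup>2 \<partial>M) \<longlonglongrightarrow> 0"
    and limG: "(\<lambda>n. \<integral>x. (g x - G n x)\<^sup>2 \<partial>M) \<longlonglongrightarrow> 0"
  shows "(\<lambda>n. \<integral>x. F n x * G n x \<partial>M) \<longlonglongrightarrow> (\<integral>x. f x * g x \<partial>M)"
proof -
  define a where "a n = sqrt (\<integral>x. (f x - F n x)\<^sup>2 \<partial>M)" for n
  define b where "b n = sqrt (\<integral>x. (g x - G n x)\<^sup>2 \<partial>M)" for n
  define c where "c = sqrt (\<integral>x. (f x)\<^sup>2 \<partial>M)"
  define d where "d = sqrt (\<integral>x. (g x)\<^sup>2 \<partial>M)"
  have dF: "integrable M (\<lambda>x. (f x - F n x)\<^sup>2)" and dG: "integrable M (\<lambda>x. (g x - G n x)\<^sup>2)" for n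
    by (intro L2_diff f g F G; simp)+
  have bound: "\<bar>(\<integral>x. F n x * G n x \<partial>M) - (\<integral>x. f x * g x \<partial>M)\<bar> \<le> a n * b n + a n * d + c * b n" for n
  proof -
    have i: "integrable M (\<lambda>x. (f x - F n x) * (g x - G n x))" "integrable M (\<lambda>x. (f x - F n x) * g x)"
      "integrable M (\<lambda>x. f x * (g x - G n x))" "integrable M (\<lambda>x. F n x * G n x)" "integrable M (\<lambda>x. f x * g x)"
      by (rule L2_mult_integrable; use f g F G dF dG in simp)+
    have "(\<integral>x. F n x * G n x \<partial>M) - (\<integral>x. f x * g x \<partial>M) = (\<integral>x. F n x * G n x - f x * g x \<partial>M)"
      using i by simp
    \<comment> \<open>Every term contains a difference as a factor, so Cauchy-Schwarz makes all
      three small.\<close>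
    also have "\<dots> = (\<integral>x. (f x - F n x) * (g x - G n x) - (f x - F n x) * g x - f x * (g x - G n x) \<partial>M)"
      by (rule Bochner_Integration.integral_cong) (auto simp: algebra_simps)
    also have "\<dots> = (\<integral>x. (f x - F n x) * (g x - G n x) \<partial>M) - (\<integral>x. (f x - F n x) * g x \<partial>M)
        - (\<integral>x. f x * (g x - G n x) \<partial>M)"
      using i by simp
    finally show ?thesis
      using L2_mult_le[of "\<lambda>x. f x - F n x" M "\<lambda>x. g x - G n x"] L2_mult_le[of "\<lambda>x. f x - F n x" M g]
        L2_mult_le[of f M "\<lambda>x. g x - G n x"] f g dF[of n] dG[of n]
      unfolding a_def b_def c_def d_def by simp
  qed
  have "a \<longlonglongrightarrow> 0" "b \<longlonglongrightarrow> 0"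
    using tendsto_real_sqrt[OF limF] tendsto_real_sqrt[OF limG] by (simp_all add: a_def[abs_def] b_def[abs_def])
  then have "(\<lambda>n. a n * b n + a n * d + c * b n) \<longlonglongrightarrow> 0 * 0 + 0 * d + c * 0"
    by (intro tendsto_intros)
  then have lim: "(\<lambda>n. a n * b n + a n * d + c * b n) \<longlonglongrightarrow> 0" by simp
  show ?thesis
    by (rule LIM_zero_cancel, rule Lim_null_comparison[OF _ lim]) (use bound in simp)
qed

text \<open>The difference \<open>D\<close> of \<open>\<zeta>\<close> and the pathwise integral is orthogonal to \<open>\<zeta>\<close> and to
  every \<open>\<xi> s\<close>, hence also to the pathwise integral, hence to itself.\<close>

lemma (in prob_space) AE_pathwise_integral_eqI:
  fixes \<xi> :: "real \<Rightarrow> 'a \<Rightarrow> real"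
  assumes meas: "(\<lambda>(u, \<omega>). \<xi> u \<omega>) \<in> borel_measurable (borel \<Otimes>\<^sub>M M)"
    and b_pos: "\<And>u. 0 < b u" and b_int: "integrable lborel b"
    and sq: "\<And>u. integrable M (\<lambda>\<omega>. (\<xi> u \<omega>)\<^sup>2)"
    and le: "\<And>u. expectation (\<lambda>\<omega>. (\<xi> u \<omega>)\<^sup>2) \<le> (b u)\<^sup>2"
    and \<zeta>[measurable]: "\<zeta> \<in> borel_measurable M" and \<zeta>2: "integrable M (\<lambda>\<omega>. (\<zeta> \<omega>)\<^sup>2)"
    and self: "expectation (\<lambda>\<omega>. \<zeta> \<omega> * \<zeta> \<omega>) = (\<integral>u. expectation (\<lambda>\<omega>. \<xi> u \<omega> * \<zeta> \<omega>) \<partial>lborel)"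
    and cross: "\<And>s. expectation (\<lambda>\<omega>. \<zeta> \<omega> * \<xi> s \<omega>) = (\<integral>u. expectation (\<lambda>\<omega>. \<xi> u \<omega> * \<xi> s \<omega>) \<partial>lborel)"
  shows "AE \<omega> in M. integrable lborel (\<lambda>u. \<xi> u \<omega>) \<and> (\<integral>u. \<xi> u \<omega> \<partial>lborel) = \<zeta> \<omega>"
proof -
  interpret P: pair_sigma_finite lborel M ..
  have m1[measurable]: "(\<lambda>x. \<xi> (fst x) (snd x)) \<in> borel_measurable (lborel \<Otimes>\<^sub>M M)"
    using meas by (simp add: case_prod_beta' cong: measurable_cong_sets)
  have m2[measurable]: "\<xi> u \<in> borel_measurable M" for u
    using measurable_compose[OF measurable_Pair1'[of u lborel M] m1] by simp
  have b[measurable]: "b \<in> borel_measurable lborel" using b_int by auto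
  \<comment> \<open>The test variable \<open>\<eta>\<close> ranges over L2: \<open>1\<close> gives
    integrability of almost every path, the other choices give Fubini against
    \<open>\<xi> s\<close>, \<open>\<zeta>\<close> and \<open>D\<close>. The bound rests on
    \<open>b u\<close> dominating the L2 norm of \<open>\<xi> u\<close>.\<close>
  have prod: "integrable (lborel \<Otimes>\<^sub>M M) (\<lambda>(u, \<omega>). \<xi> u \<omega> * \<eta> \<omega>)"
    if [measurable]: "\<eta> \<in> borel_measurable M" and \<eta>: "integrable M (\<lambda>\<omega>. (\<eta> \<omega>)\<^sup>2)" for \<eta>
  proof (rule P.Fubini_integrable)
    show "integrable lborel (\<lambda>u. \<integral>\<omega>. norm (case (u, \<omega>) of (u, \<omega>) \<Rightarrow> \<xi> u \<omega> * \<eta> \<omega>) \<partial>M)"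
    proof (rule Bochner_Integration.integrable_bound)
      show "integrable lborel (\<lambda>u. b u * sqrt (expectation (\<lambda>\<omega>. (\<eta> \<omega>)\<^sup>2)))" using b_int by simp
      have "expectation (\<lambda>\<omega>. \<bar>\<xi> u \<omega> * \<eta> \<omega>\<bar>) \<le> b u * sqrt (expectation (\<lambda>\<omega>. (\<eta> \<omega>)\<^sup>2))" for u
      proof -
        have "sqrt (expectation (\<lambda>\<omega>. (\<xi> u \<omega>)\<^sup>2)) \<le> b u"
          using le[of u] b_pos[of u] by (simp add: real_le_lsqrt)
        then show ?thesis
          by (intro order_trans[OF L2_mult_abs_le[of "\<xi> u" M \<eta>]] mult_right_mono) (use sq \<eta> in auto)
      qed
      then show "AE u in lborel. norm (\<integral>\<omega>. norm (case (u, \<omega>) of (u, \<omega>) \<Rightarrow> \<xi> u \<omega> * \<eta> \<omega>) \<partial>M)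
          \<le> norm (b u * sqrt (expectation (\<lambda>\<omega>. (\<eta> \<omega>)\<^sup>2)))"
        using b_pos by (auto intro!: AE_I2 simp: abs_mult abs_of_pos)
    qed measurable
    show "AE u in lborel. integrable M (\<lambda>\<omega>. case (u, \<omega>) of (u, \<omega>) \<Rightarrow> \<xi> u \<omega> * \<eta> \<omega>)"
      using L2_mult_integrable[OF m2 that(1) sq \<eta>] by simp
  qed measurable
  have int_AE: "AE \<omega> in M. integrable lborel (\<lambda>u. \<xi> u \<omega>)"
    using P.AE_integrable_snd[of "\<lambda>u \<omega>. \<xi> u \<omega> * 1"] prod[of "\<lambda>_. 1"] by simp
  define W where "W \<omega> = (\<integral>u. \<xi> u \<omega> \<partial>lborel)" for \<omega>
  have W[measurable]: "W \<in> borel_measurable M"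
    using P.integrable_snd[OF prod[of "\<lambda>_. 1"]] by (simp add: W_def[abs_def])
  have fub: "expectation (\<lambda>\<omega>. W \<omega> * \<eta> \<omega>) = (\<integral>u. expectation (\<lambda>\<omega>. \<xi> u \<omega> * \<eta> \<omega>) \<partial>lborel)"
    if "\<eta> \<in> borel_measurable M" "integrable M (\<lambda>\<omega>. (\<eta> \<omega>)\<^sup>2)" for \<eta>
    using P.Fubini_integral[OF prod[OF that]] by (simp add: W_def)
  \<comment> \<open>weighted Cauchy-Schwarz: \<open>W\<^sup>2 \<le> (\<integral>b) * \<integral>\<xi>\<^sup>2 / b\<close>\<close>
  have W2: "integrable M (\<lambda>\<omega>. (W \<omega>)\<^sup>2)"
  proof -
    have quot: "integrable (lborel \<Otimes>\<^sub>M M) (\<lambda>(u, \<omega>). (\<xi> u \<omega>)\<^sup>2 / b u)"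
    proof (rule P.Fubini_integrable)
      show "integrable lborel (\<lambda>u. \<integral>\<omega>. norm (case (u, \<omega>) of (u, \<omega>) \<Rightarrow> (\<xi> u \<omega>)\<^sup>2 / b u) \<partial>M)"
      proof (rule Bochner_Integration.integrable_bound[OF b_int])
        have "expectation (\<lambda>\<omega>. (\<xi> u \<omega>)\<^sup>2) / b u \<le> b u" for u
          using le[of u] b_pos[of u] by (simp add: divide_simps power2_eq_square)
        then show "AE u in lborel. norm (\<integral>\<omega>. norm (case (u, \<omega>) of (u, \<omega>) \<Rightarrow> (\<xi> u \<omega>)\<^sup>2 / b u) \<partial>M) \<le> norm (b u)"
          using b_pos by (auto intro!: AE_I2 order_trans[OF _ abs_ge_self] simp: abs_mult abs_of_pos)
      qed measurable
      show "AE u in lborel. integrable M (\<lambda>\<omega>. case (u, \<omega>) of (u, \<omega>) \<Rightarrow> (\<xi> u \<omega>)\<^sup>2 / b u)"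
        using sq by simp
    qed measurable
    show ?thesis
    proof (rule integrableI_nonneg)
      show "(\<integral>\<^sup>+\<omega>. ennreal ((W \<omega>)\<^sup>2) \<partial>M) < \<infinity>"
      proof -
        define Q where "Q \<omega> = (\<integral>u. (\<xi> u \<omega>)\<^sup>2 / b u \<partial>lborel)" for \<omega>
        have Qint: "integrable M Q"
          using P.integrable_snd[OF quot] by (simp add: Q_def[abs_def])
        have "AE \<omega> in M. (W \<omega>)\<^sup>2 \<le> (\<integral>u. b u \<partial>lborel) * Q \<omega>"
          using P.AE_integrable_snd[OF quot] int_AE
        proof eventually_elim
          case (elim \<omega>)
          have [measurable]: "(\<lambda>u. \<xi> u \<omega>) \<in> borel_measurable lborel" using elim by auto
          define f where "f u = sqrt (b u)" for u
          define g where "g u = \<xi> u \<omega> / sqrt (b u)" for u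
          have fg: "f u * g u = \<xi> u \<omega>" "(f u)\<^sup>2 = b u" "(g u)\<^sup>2 = (\<xi> u \<omega>)\<^sup>2 / b u" for u
            using b_pos[of u] by (auto simp: f_def g_def power_divide)
          have "\<bar>W \<omega>\<bar> \<le> sqrt (\<integral>u. b u \<partial>lborel) * sqrt (Q \<omega>)"
            using L2_mult_le[of f lborel g] elim b_int unfolding fg W_def Q_def
            by (simp add: f_def[abs_def] g_def[abs_def])
          then have "\<bar>W \<omega>\<bar>\<^sup>2 \<le> (sqrt (\<integral>u. b u \<partial>lborel) * sqrt (Q \<omega>))\<^sup>2"
            by (intro power_mono) auto
          moreover have "0 \<le> (\<integral>u. b u \<partial>lborel)" "0 \<le> Q \<omega>"
            using b_pos by (auto intro!: Bochner_Integration.integral_nonneg simp: Q_def less_imp_le)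
          ultimately show ?case by (simp add: power_mult_distrib)
        qed
        then have "(\<integral>\<^sup>+\<omega>. ennreal ((W \<omega>)\<^sup>2) \<partial>M) \<le> (\<integral>\<^sup>+\<omega>. ennreal ((\<integral>u. b u \<partial>lborel) * Q \<omega>) \<partial>M)"
          by (intro nn_integral_mono_AE) (auto intro: ennreal_leI)
        also have "\<dots> < \<infinity>"
        proof -
          have "0 \<le> (\<integral>u. b u \<partial>lborel) * Q \<omega>" for \<omega>
            using b_pos by (intro mult_nonneg_nonneg) (auto intro!: Bochner_Integration.integral_nonneg simp: Q_def less_imp_le)
          then have "(\<integral>\<^sup>+\<omega>. ennreal ((\<integral>u. b u \<partial>lborel) * Q \<omega>) \<partial>M) = ennreal (\<integral>\<omega>. (\<integral>u. b u \<partial>lborel) * Q \<omega> \<partial>M)"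
            using Qint by (intro nn_integral_eq_integral) auto
          then show ?thesis by simp
        qed
        finally show ?thesis .
      qed
    qed auto
  qed
  define D where "D \<omega> = \<zeta> \<omega> - W \<omega>" for \<omega>
  have D[measurable]: "D \<in> borel_measurable M" by (simp add: D_def[abs_def])
  have D2: "integrable M (\<lambda>\<omega>. (D \<omega>)\<^sup>2)"
    unfolding D_def by (intro L2_diff \<zeta>2 W2) auto
  have ints: "integrable M (\<lambda>\<omega>. \<eta> \<omega> * \<eta>' \<omega>)"
    if "\<eta> \<in> borel_measurable M" "integrable M (\<lambda>\<omega>. (\<eta> \<omega>)\<^sup>2)" "\<eta>' \<in> borel_measurable M" "integrable M (\<lambda>\<omega>. (\<eta>' \<omega>)\<^sup>2)"
    for \<eta> \<eta>' :: "'a \<Rightarrow> real" by (rule L2_mult_integrable[OF that(1,3,2,4)])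
  have "expectation (\<lambda>\<omega>. \<xi> s \<omega> * D \<omega>) = 0" for s
  proof -
    have "expectation (\<lambda>\<omega>. \<xi> s \<omega> * D \<omega>) = expectation (\<lambda>\<omega>. \<zeta> \<omega> * \<xi> s \<omega> - W \<omega> * \<xi> s \<omega>)"
      by (simp add: D_def algebra_simps)
    also have "\<dots> = 0"
      using fub[of "\<xi> s"] cross[of s] sq[of s] \<zeta>2 W2 ints by simp
    finally show ?thesis .
  qed
  \<comment> \<open>\<open>D\<close> is itself admissible as a test variable; this is where the
    square integrability of \<open>W\<close> enters.\<close>
  then have DW: "expectation (\<lambda>\<omega>. W \<omega> * D \<omega>) = 0"
    using fub[OF D D2] by simp
  have "expectation (\<lambda>\<omega>. \<zeta> \<omega> * D \<omega>) = expectation (\<lambda>\<omega>. \<zeta> \<omega> * \<zeta> \<omega> - W \<omega> * \<zeta> \<omega>)"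
    by (simp add: D_def algebra_simps)
  also have "\<dots> = 0"
    using fub[of \<zeta>] self \<zeta>2 W2 ints by simp
  finally have \<zeta>D: "expectation (\<lambda>\<omega>. \<zeta> \<omega> * D \<omega>) = 0" .
  have "expectation (\<lambda>\<omega>. (D \<omega>)\<^sup>2) = expectation (\<lambda>\<omega>. \<zeta> \<omega> * D \<omega> - W \<omega> * D \<omega>)"
    by (rule Bochner_Integration.integral_cong) (auto simp: D_def power2_eq_square algebra_simps)
  also have "\<dots> = 0"
    using DW \<zeta>D ints[OF \<zeta> \<zeta>2 D D2] ints[OF W W2 D D2] by simp
  finally have "expectation (\<lambda>\<omega>. (D \<omega>)\<^sup>2) = 0" .
  then have "AE \<omega> in M. (D \<omega>)\<^sup>2 = 0"
    using D2 by (subst (asm) integral_nonneg_eq_0_iff_AE) auto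
  with int_AE show ?thesis
    by eventually_elim (auto simp: D_def W_def)
qed

section \<open>Increments of a centred square integrable Levy process\<close>

text \<open>Nonnegativity makes an additive function monotone. Since \<open>N * h\<close> lies
  between consecutive integers \<open>m\<close> and \<open>Suc m\<close>, monotonicity confines
  \<open>v h\<close> to distance \<open>v 1 / N\<close> from \<open>h * v 1\<close>. Applied to
  second moments of increments, this spares a proof of their continuity in time.\<close>

lemma additive_nonneg_linear:
  fixes v :: "real \<Rightarrow> real"
  assumes add: "\<And>s t. 0 \<le> s \<Longrightarrow> 0 \<le> t \<Longrightarrow> v (s + t) = v s + v t"
    and nonneg: "\<And>s. 0 \<le> s \<Longrightarrow> 0 \<le> v s" and "0 \<le> h"
  shows "v h = h * v 1"
proof -
  have v0: "v 0 = 0" using add[of 0 0] by simp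
  have mult: "v (of_nat n * s) = of_nat n * v s" if "0 \<le> s" for n s
    using that v0 by (induction n) (auto simp: distrib_right add)
  have mono: "v s \<le> v t" if "0 \<le> s" "s \<le> t" for s t
    using add[of s "t - s"] nonneg[of "t - s"] that by simp
  have "\<bar>v h - h * v 1\<bar> \<le> v 1 / of_nat (Suc n)" for n
  proof -
    define N where "N = real (Suc n)"
    define m where "m = nat \<lfloor>N * h\<rfloor>"
    have N: "0 < N" and Nh: "0 \<le> N * h" using \<open>0 \<le> h\<close> by (auto simp: N_def)
    have m: "real m \<le> N * h" "N * h \<le> real (Suc m)"
      unfolding m_def using Nh by linarith+
    have "v (real m) = real m * v 1" "v (real (Suc m)) = real (Suc m) * v 1" "v (N * h) = N * v h"
      using mult[of 1 m] mult[of 1 "Suc m"] mult[of h "Suc n"] \<open>0 \<le> h\<close> by (simp_all add: N_def)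
    then have "real m * v 1 \<le> N * v h" "N * v h \<le> real (Suc m) * v 1"
      using mono[of "real m" "N * h"] mono[of "N * h" "real (Suc m)"] m Nh by auto
    moreover have "real m * v 1 \<le> (N * h) * v 1" "(N * h) * v 1 \<le> real (Suc m) * v 1"
      using m nonneg[of 1] by (intro mult_right_mono; simp)+
    ultimately have "\<bar>N * v h - (N * h) * v 1\<bar> \<le> v 1"
      by (simp add: distrib_right)
    moreover have "N * v h - (N * h) * v 1 = N * (v h - h * v 1)" by (simp add: algebra_simps)
    ultimately have "N * \<bar>v h - h * v 1\<bar> \<le> v 1"
      using N by (simp add: abs_mult)
    then show ?thesis using N by (simp add: N_def field_simps)
  qed
  moreover have "(\<lambda>n. v 1 / of_nat (Suc n)) \<longlonglongrightarrow> 0"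
    using LIMSEQ_Suc[OF lim_const_over_n] by simp
  ultimately have "\<bar>v h - h * v 1\<bar> \<le> 0"
    by (intro LIMSEQ_le_const) auto
  then show ?thesis by simp
qed

text \<open>An additive function with \<open>f 1 = 0\<close> vanishes on the rationals, hence is
  invariant under rational translations. The multiple \<open>(n + 1) * h\<close> can thus be moved
  into \<open>(0, d)\<close>, which gives \<open>(n + 1) * \<bar>f h\<bar> \<le> B\<close> for every
  \<open>n\<close>.\<close>

lemma additive_bounded_near_0_eq_0:
  fixes f :: "real \<Rightarrow> real"
  assumes add: "\<And>s t. f (s + t) = f s + f t" and f1: "f 1 = 0"
    and d: "0 < d" and bdd: "\<And>h. 0 < h \<Longrightarrow> h < d \<Longrightarrow> \<bar>f h\<bar> \<le> B"
  shows "f h = 0"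
proof -
  have f0: "f 0 = 0" using add[of 0 0] by simp
  have fneg: "f (- s) = - f s" for s using add[of s "- s"] f0 by simp
  have natm: "f (of_nat n * s) = of_nat n * f s" for n s
    using f0 by (induction n) (auto simp: distrib_right add)
  have intm: "f (of_int n * s) = of_int n * f s" for n s
  proof (cases n)
    case (neg m)
    have "f (of_int n * s) = f (- (of_nat (Suc m) * s))"
      by (rule arg_cong[of _ _ f]) (simp add: neg algebra_simps)
    also have "\<dots> = of_int n * f s" by (simp only: fneg natm) (simp add: neg algebra_simps)
    finally show ?thesis .
  qed (simp add: natm)
  have rat: "f r = 0" if r_rat: "r \<in> \<rat>" for r
  proof -
    obtain m n where r: "r = of_int m / of_int n" "n > 0" by (rule Rats_cases'[OF r_rat]) blast
    have "of_int n * f r = f (of_int n * r)" by (simp add: intm)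
    also have "\<dots> = f (of_int m * 1)" using r by simp
    also have "\<dots> = 0" by (subst intm) (simp add: f1)
    finally show ?thesis using r by simp
  qed
  have "\<bar>f h\<bar> \<le> B / of_nat (Suc n)" for n
  proof -
    obtain r where r: "r \<in> \<rat>" "of_nat (Suc n) * h - d < r" "r < of_nat (Suc n) * h"
      using Rats_dense_in_real[of "of_nat (Suc n) * h - d" "of_nat (Suc n) * h"] d by auto
    have "of_nat (Suc n) * f h = f ((of_nat (Suc n) * h - r) + r)" by (simp add: natm del: of_nat_Suc)
    also have "\<dots> = f (of_nat (Suc n) * h - r)" using rat[OF r(1)] by (subst add) simp
    finally have "\<bar>of_nat (Suc n) * f h\<bar> \<le> B" using bdd[of "of_nat (Suc n) * h - r"] r by simp
    then show ?thesis by (simp add: abs_mult field_simps del: of_nat_Suc)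
  qed
  moreover have "(\<lambda>n. B / of_nat (Suc n)) \<longlonglongrightarrow> 0"
    using LIMSEQ_Suc[OF lim_const_over_n] by simp
  ultimately have "\<bar>f h\<bar> \<le> 0"
    by (intro LIMSEQ_le_const) auto
  then show ?thesis by simp
qed

text \<open>Tonelli for the product of the two laws: the expectation of
  \<open>(x + Y)\<^sup>2\<close> is finite for almost every value \<open>x\<close> of
  \<open>X\<close>, hence for at least one, and the constant \<open>x\<close> can be subtracted.
  This is the way down from whole to fractional times.\<close>

lemma (in prob_space) indep_var_sum_L2:
  fixes X Y :: "'a \<Rightarrow> real"
  assumes ind: "indep_var borel X borel Y" and sq: "integrable M (\<lambda>\<omega>. (X \<omega> + Y \<omega>)\<^sup>2)"
  shows "integrable M (\<lambda>\<omega>. (Y \<omega>)\<^sup>2)"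
proof -
  have [measurable]: "X \<in> borel_measurable M" "Y \<in> borel_measurable M"
    using ind by (auto simp: indep_var_distribution_eq)
  interpret X: prob_space "distr M borel X" by (rule prob_space_distr) simp
  interpret Y: prob_space "distr M borel Y" by (rule prob_space_distr) simp
  have D: "distr M borel X \<Otimes>\<^sub>M distr M borel Y = distr M (borel \<Otimes>\<^sub>M borel) (\<lambda>\<omega>. (X \<omega>, Y \<omega>))"
    using ind by (simp add: indep_var_distribution_eq)
  have "(\<integral>\<^sup>+x. \<integral>\<^sup>+y. ennreal ((x + y)\<^sup>2) \<partial>distr M borel Y \<partial>distr M borel X)
      = (\<integral>\<^sup>+z. ennreal ((fst z + snd z)\<^sup>2) \<partial>(distr M borel X \<Otimes>\<^sub>M distr M borel Y))"
    by (subst Y.nn_integral_fst[symmetric]) (auto cong: measurable_cong_sets)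
  also have "\<dots> = (\<integral>\<^sup>+\<omega>. ennreal ((X \<omega> + Y \<omega>)\<^sup>2) \<partial>M)"
    unfolding D by (subst nn_integral_distr) auto
  also have "\<dots> < \<infinity>" using sq by (simp add: nn_integral_eq_integral)
  finally have fin: "(\<integral>\<^sup>+x. \<integral>\<^sup>+y. ennreal ((x + y)\<^sup>2) \<partial>distr M borel Y \<partial>distr M borel X) \<noteq> \<infinity>" by simp
  have "AE x in distr M borel X. (\<integral>\<^sup>+y. ennreal ((x + y)\<^sup>2) \<partial>distr M borel Y) \<noteq> \<infinity>"
    by (rule nn_integral_PInf_AE[OF _ fin]) measurable
  then have "\<exists>x. (\<integral>\<^sup>+y. ennreal ((x + y)\<^sup>2) \<partial>distr M borel Y) \<noteq> \<infinity>"
    by (rule contrapos_pp) (simp add: X.AE_False)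
  then obtain x where x: "(\<integral>\<^sup>+y. ennreal ((x + y)\<^sup>2) \<partial>distr M borel Y) \<noteq> \<infinity>" ..
  have "(\<integral>\<^sup>+\<omega>. ennreal ((x + Y \<omega>)\<^sup>2) \<partial>M) < \<infinity>"
    using x by (subst (asm) nn_integral_distr) (auto simp: top.not_eq_extremum)
  then have "integrable M (\<lambda>\<omega>. (x + Y \<omega>)\<^sup>2)" by (intro integrableI_nonneg) auto
  from L2_diff[OF _ _ this, of "\<lambda>_. x"] show ?thesis by simp
qed

locale centred_L2_levy = prob_space M for M :: "'w measure" +
  fixes L :: "real \<Rightarrow> 'w \<Rightarrow> real^'k::finite"
  assumes levy: "two_sided_levy M L"
    and sq_norm_1: "integrable M (\<lambda>\<omega>. (norm (L 1 \<omega>))\<^sup>2)"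
    and mean_1: "expectation (L 1) = 0"
begin

lemma measurable_L[measurable]: "L t \<in> borel_measurable M"
  using levy by (simp add: two_sided_levy_def)

lemma indep_increments:
  assumes "s \<le> t" "t \<le> u"
  shows "indep_var borel (\<lambda>\<omega>. x \<bullet> (L t \<omega> - L s \<omega>)) borel (\<lambda>\<omega>. y \<bullet> (L u \<omega> - L t \<omega>))"
proof -
  define r where "r i = (if i = 0 then s else if i = 1 then t else u)" for i :: nat
  have "indep_vars (\<lambda>_. borel) (\<lambda>i \<omega>. L (r (Suc i)) \<omega> - L (r i) \<omega>) {..<2}"
  proof -
    have "\<forall>i<2. r i \<le> r (Suc i)" using assms by (auto simp: r_def)
    then show ?thesis using levy unfolding two_sided_levy_def by blast
  qed
  from indep_vars_compose2[OF this, of "\<lambda>i v. (if i = 0 then x else y) \<bullet> v" "\<lambda>_. borel"]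
  have "indep_vars (\<lambda>_. borel) (\<lambda>i \<omega>. (if i = 0 then x else y) \<bullet> (L (r (Suc i)) \<omega> - L (r i) \<omega>)) (insert 0 {1})"
    by (simp add: lessThan_Suc numeral_2_eq_2 insert_commute)
  \<comment> \<open>A sum over the singleton \<open>{1}\<close> turns independence of the family
    into independence of two variables.\<close>
  from indep_vars_sum[OF _ _ this] show ?thesis by (simp add: r_def)
qed

lemma stationary_increments:
  "distr M borel (\<lambda>\<omega>. L t \<omega> - L s \<omega>) = distr M borel (\<lambda>\<omega>. L (t - s) \<omega> - L 0 \<omega>)"
proof -
  have "distr M borel (\<lambda>\<omega>. L (t - s + s) \<omega> - L (0 + s) \<omega>) = distr M borel (\<lambda>\<omega>. L (t - s) \<omega> - L 0 \<omega>)"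
    using levy unfolding two_sided_levy_def by blast
  then show ?thesis by simp
qed

lemma integrable_increment_shift:
  fixes \<phi> :: "real^'k \<Rightarrow> real"
  assumes [measurable]: "\<phi> \<in> borel_measurable borel"
  shows "integrable M (\<lambda>\<omega>. \<phi> (L t \<omega> - L s \<omega>)) \<longleftrightarrow> integrable M (\<lambda>\<omega>. \<phi> (L (t - s) \<omega> - L 0 \<omega>))"
  using arg_cong[OF stationary_increments[of t s], of "\<lambda>N. integrable N \<phi>"]
  by (simp add: integrable_distr_eq)

lemma expectation_increment_shift:
  fixes \<phi> :: "real^'k \<Rightarrow> real"
  assumes [measurable]: "\<phi> \<in> borel_measurable borel"
  shows "expectation (\<lambda>\<omega>. \<phi> (L t \<omega> - L s \<omega>)) = expectation (\<lambda>\<omega>. \<phi> (L (t - s) \<omega> - L 0 \<omega>))"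
  using arg_cong[OF stationary_increments[of t s], of "\<lambda>N. integral\<^sup>L N \<phi>"]
  by (simp add: integral_distr)

lemma AE_L_0: "AE \<omega> in M. L 0 \<omega> = 0"
  using levy by (simp add: two_sided_levy_def)

lemma sq_integrable_1: "integrable M (\<lambda>\<omega>. (x \<bullet> L 1 \<omega>)\<^sup>2)"
proof (rule Bochner_Integration.integrable_bound)
  show "integrable M (\<lambda>\<omega>. (norm x)\<^sup>2 * (norm (L 1 \<omega>))\<^sup>2)" using sq_norm_1 by simp
  have "\<bar>x \<bullet> y\<bar>\<^sup>2 \<le> (norm x * norm y)\<^sup>2" for y
    by (intro power_mono Cauchy_Schwarz_ineq2) simp
  then show "AE \<omega> in M. norm ((x \<bullet> L 1 \<omega>)\<^sup>2) \<le> norm ((norm x)\<^sup>2 * (norm (L 1 \<omega>))\<^sup>2)"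
    by (simp add: power_mult_distrib)
qed simp

text \<open>The second moment is given at time 1 only. Adding unit increments reaches every natural
  \<open>n\<close>; cutting \<open>[0, n]\<close> at \<open>n - h\<close> shows an increment of
  length \<open>h\<close> as a summand independent of the rest, which inherits the second moment of
  the sum.\<close>

lemma sq_integrable_increment: "integrable M (\<lambda>\<omega>. (x \<bullet> (L t \<omega> - L s \<omega>))\<^sup>2)"
proof -
  have one: "integrable M (\<lambda>\<omega>. (x \<bullet> (L 1 \<omega> - L 0 \<omega>))\<^sup>2)"
    using sq_integrable_1[of x] by (rule integrable_cong_AE_imp) (use AE_L_0 in auto)
  have nat: "integrable M (\<lambda>\<omega>. (x \<bullet> (L (real n) \<omega> - L 0 \<omega>))\<^sup>2)" for n
  proof (induction n)
    case (Suc n)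
    have "integrable M (\<lambda>\<omega>. (x \<bullet> (L (real (Suc n)) \<omega> - L (real n) \<omega>))\<^sup>2)"
      using one by (subst integrable_increment_shift[where \<phi> = "\<lambda>v. (x \<bullet> v)\<^sup>2"]) auto
    from L2_add[OF _ _ this Suc] show ?case by (simp add: inner_diff_right)
  qed simp
  have pos: "integrable M (\<lambda>\<omega>. (x \<bullet> (L h \<omega> - L 0 \<omega>))\<^sup>2)" if "0 \<le> h" for h
  proof -
    obtain n where n: "h \<le> real n" using real_arch_simple by blast
    have "integrable M (\<lambda>\<omega>. (x \<bullet> (L (real n) \<omega> - L (real n - h) \<omega>))\<^sup>2)"
      by (rule indep_var_sum_L2[OF indep_increments[of 0 _ _ x x]])
        (use n that nat in \<open>auto simp: inner_diff_right\<close>)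
    then show ?thesis
      by (subst (asm) integrable_increment_shift[where \<phi> = "\<lambda>v. (x \<bullet> v)\<^sup>2"]) auto
  qed
  have "integrable M (\<lambda>\<omega>. (x \<bullet> (L t \<omega> - L s \<omega>))\<^sup>2)" if "s \<le> t" for s t
    using pos[of "t - s"] that by (subst integrable_increment_shift[where \<phi> = "\<lambda>v. (x \<bullet> v)\<^sup>2"]) auto
  from this[of s t] this[of t s] show ?thesis
    by (cases "s \<le> t") (auto simp: inner_diff_right power2_commute)
qed

lemma integrable_increment: "integrable M (\<lambda>\<omega>. x \<bullet> (L t \<omega> - L s \<omega>))"
  by (rule square_integrable_imp_integrable) (auto intro: sq_integrable_increment)

text \<open>Additivity only shows that the mean vanishes at rational times. Stochastic continuity and
  Chebyshev's inequality bound the mean near \<open>0\<close>, which settles the other times.\<close>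

lemma expectation_increment: "expectation (\<lambda>\<omega>. x \<bullet> (L t \<omega> - L s \<omega>)) = 0"
proof -
  define f where "f h = expectation (\<lambda>\<omega>. x \<bullet> (L h \<omega> - L 0 \<omega>))" for h
  \<comment> \<open>\<open>w h\<close> is the variance. Being nonnegative and additive on
    nonnegative times, it is at most \<open>w 1\<close> on \<open>[0, 1]\<close>, so Chebyshev's
    inequality is uniform over short times.\<close>
  define w where "w h = expectation (\<lambda>\<omega>. (x \<bullet> (L h \<omega> - L 0 \<omega>))\<^sup>2) - (f h)\<^sup>2" for h
  have shift: "expectation (\<lambda>\<omega>. x \<bullet> (L t \<omega> - L s \<omega>)) = f (t - s)" for s t
    unfolding f_def by (rule expectation_increment_shift) simp
  have split: "x \<bullet> (L (s + t) \<omega> - L 0 \<omega>) = x \<bullet> (L s \<omega> - L 0 \<omega>) + x \<bullet> (L (s + t) \<omega> - L s \<omega>)" for s t \<omega>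
    by (simp add: inner_diff_right)
  have f_add: "f (s + t) = f s + f t" for s t
    using shift[of "s + t" s] integrable_increment by (simp add: f_def[of "s + t"] split) (simp add: f_def)
  have f1: "f 1 = 0"
  proof -
    have "f 1 = expectation (\<lambda>\<omega>. x \<bullet> L 1 \<omega>)"
      unfolding f_def by (rule integral_cong_AE) (use AE_L_0 in auto)
    also have "\<dots> = x \<bullet> expectation (L 1)"
    proof (rule integral_inner_right)
      show "x \<noteq> 0 \<Longrightarrow> integrable M (L 1)"
        using square_integrable_imp_integrable[OF _ sq_norm_1] by (simp add: integrable_norm_iff)
    qed
    finally show ?thesis by (simp add: mean_1)
  qed
  have w_nonneg: "0 \<le> w h" for h
  proof -
    have "w h = expectation (\<lambda>\<omega>. (x \<bullet> (L h \<omega> - L 0 \<omega>) - f h)\<^sup>2)"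
      unfolding w_def f_def using variance_eq[OF integrable_increment[of x h 0] sq_integrable_increment[of x h 0]] by simp
    then show ?thesis by simp
  qed
  have w_add: "w (s + t) = w s + w t" if "0 \<le> s" "0 \<le> t" for s t
  proof -
    let ?X = "\<lambda>\<omega>. x \<bullet> (L s \<omega> - L 0 \<omega>)" and ?Y = "\<lambda>\<omega>. x \<bullet> (L (s + t) \<omega> - L s \<omega>)"
    have ind: "indep_var borel ?X borel ?Y" using that by (intro indep_increments) auto
    have Y2: "expectation (\<lambda>\<omega>. (?Y \<omega>)\<^sup>2) = expectation (\<lambda>\<omega>. (x \<bullet> (L t \<omega> - L 0 \<omega>))\<^sup>2)"
      using expectation_increment_shift[where \<phi> = "\<lambda>v. (x \<bullet> v)\<^sup>2", of "s + t" s] by simp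
    have "expectation (\<lambda>\<omega>. (x \<bullet> (L (s + t) \<omega> - L 0 \<omega>))\<^sup>2)
        = expectation (\<lambda>\<omega>. (?X \<omega>)\<^sup>2 + (?Y \<omega>)\<^sup>2 + 2 * (?X \<omega> * ?Y \<omega>))"
      unfolding split by (rule Bochner_Integration.integral_cong) (auto simp: power2_eq_square algebra_simps)
    also have "\<dots> = expectation (\<lambda>\<omega>. (?X \<omega>)\<^sup>2) + expectation (\<lambda>\<omega>. (?Y \<omega>)\<^sup>2) + 2 * (f s * f t)"
      using sq_integrable_increment indep_var_integrable[OF ind integrable_increment integrable_increment]
        indep_var_lebesgue_integral[OF ind integrable_increment integrable_increment] shift[of "s + t" s]
      by (simp add: f_def)
    finally show ?thesis
      unfolding w_def f_add Y2 by (simp add: power2_sum)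
  qed
  have w_le: "w h \<le> w 1" if "0 \<le> h" "h \<le> 1" for h
    using w_add[of h "1 - h"] w_nonneg[of "1 - h"] that by simp
  \<comment> \<open>Chosen so that \<open>w 1 / a\<^sup>2 < 1 / 2\<close>.\<close>
  define a where "a = sqrt (2 * w 1 + 1)"
  have a: "0 < a" "a\<^sup>2 = 2 * w 1 + 1" using w_nonneg[of 1] by (auto simp: a_def)
  \<comment> \<open>Vectors \<open>v\<close> of norm up to this threshold satisfy
    \<open>\<bar>x \<bullet> v\<bar> \<le> 1\<close>; the summand 1 covers
    \<open>x = 0\<close>.\<close>
  have "((\<lambda>s. prob {\<omega> \<in> space M. norm (L s \<omega> - L 0 \<omega>) > 1 / (norm x + 1)}) \<longlongrightarrow> 0) (at 0)"
    using levy unfolding two_sided_levy_def by (simp add: add_nonneg_pos)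
  then have "\<forall>\<^sub>F s in at 0. prob {\<omega> \<in> space M. norm (L s \<omega> - L 0 \<omega>) > 1 / (norm x + 1)} < 1 / 2"
    by (rule order_tendstoD) simp
  then obtain d where d: "0 < d" and small:
    "\<And>s. s \<noteq> 0 \<Longrightarrow> \<bar>s\<bar> < d \<Longrightarrow> prob {\<omega> \<in> space M. norm (L s \<omega> - L 0 \<omega>) > 1 / (norm x + 1)} < 1 / 2"
    unfolding eventually_at by (auto simp: dist_real_def)
  have "f h = 0" for h
  proof (rule additive_bounded_near_0_eq_0[where f = f and d = "min d 1" and B = "a + 1"])
    fix h :: real assume h: "0 < h" "h < min d 1"
    let ?E = "{\<omega> \<in> space M. norm (L h \<omega> - L 0 \<omega>) > 1 / (norm x + 1)}"
    let ?F = "{\<omega> \<in> space M. a \<le> \<bar>x \<bullet> (L h \<omega> - L 0 \<omega>) - f h\<bar>}"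
    have "prob ?F \<le> w h / a\<^sup>2"
      using Chebyshev_inequality[of "\<lambda>\<omega>. x \<bullet> (L h \<omega> - L 0 \<omega>)" a] a sq_integrable_increment
        variance_eq[OF integrable_increment[of x h 0] sq_integrable_increment[of x h 0]]
      by (simp add: w_def f_def)
    also have "\<dots> < 1 / 2"
      using w_le[of h] h w_nonneg[of 1] unfolding a by (simp add: field_simps)
    finally have "prob ?E + prob ?F < 1" using small[of h] h by simp
    moreover have "prob (?E \<union> ?F) \<le> prob ?E + prob ?F"
      by (rule measure_Un_le) measurable
    \<comment> \<open>Both events have probability below 1/2, so some outcome avoids both. There the
      projected increment is at most 1 in size and within \<open>a\<close> of its mean
      \<open>f h\<close>.\<close>
    ultimately have "?E \<union> ?F \<noteq> space M" using prob_space by auto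
    then obtain \<omega> where \<omega>: "\<omega> \<in> space M" "norm (L h \<omega> - L 0 \<omega>) \<le> 1 / (norm x + 1)"
        "\<bar>x \<bullet> (L h \<omega> - L 0 \<omega>) - f h\<bar> < a" by force
    have "\<bar>x \<bullet> (L h \<omega> - L 0 \<omega>)\<bar> \<le> norm x * (1 / (norm x + 1))"
      using \<omega>(2) by (intro order_trans[OF Cauchy_Schwarz_ineq2] mult_left_mono) auto
    also have "\<dots> \<le> 1" by (simp add: divide_simps add_nonneg_pos)
    finally have "\<bar>x \<bullet> (L h \<omega> - L 0 \<omega>)\<bar> \<le> 1" .
    then show "\<bar>f h\<bar> \<le> a + 1" using \<omega>(3) by linarith
  qed (use f_add f1 d in auto)
  then show ?thesis by (simp add: shift)
qed

section \<open>Second moments of pairs of increments\<close>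

definition cov :: "real^'k \<Rightarrow> real^'k \<Rightarrow> real" where
  "cov x y = expectation (\<lambda>\<omega>. (x \<bullet> L 1 \<omega>) * (y \<bullet> L 1 \<omega>))"

lemma integrable_cov: "integrable M (\<lambda>\<omega>. (x \<bullet> L 1 \<omega>) * (y \<bullet> L 1 \<omega>))"
  by (intro L2_mult_integrable sq_integrable_1) auto

lemma integrable_increment_mult:
  "integrable M (\<lambda>\<omega>. (x \<bullet> (L t \<omega> - L s \<omega>)) * (y \<bullet> (L v \<omega> - L u \<omega>)))"
  by (intro L2_mult_integrable sq_integrable_increment) auto

lemma expectation_increment_mult_0:
  assumes "s \<le> t" "t \<le> u"
  shows "expectation (\<lambda>\<omega>. (x \<bullet> (L t \<omega> - L s \<omega>)) * (y \<bullet> (L u \<omega> - L t \<omega>))) = 0"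
  using indep_var_lebesgue_integral[OF indep_increments[OF assms, of x y] integrable_increment integrable_increment]
  by (simp add: expectation_increment)

text \<open>For \<open>x = y\<close> the second moment is additive in the length, because adjacent
  increments are orthogonal, and nonnegative, hence linear. Polarization extends this to two
  vectors.\<close>

lemma expectation_increment_mult_same:
  assumes "s \<le> t"
  shows "expectation (\<lambda>\<omega>. (x \<bullet> (L t \<omega> - L s \<omega>)) * (y \<bullet> (L t \<omega> - L s \<omega>))) = (t - s) * cov x y"
proof -
  have sq: "expectation (\<lambda>\<omega>. (x \<bullet> (L t \<omega> - L s \<omega>))\<^sup>2) = (t - s) * cov x x" for x
  proof -
    define v where "v h = expectation (\<lambda>\<omega>. (x \<bullet> (L h \<omega> - L 0 \<omega>))\<^sup>2)" for h
    have "v (s + t) = v s + v t" if "0 \<le> s" "0 \<le> t" for s t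
    proof -
      let ?X = "\<lambda>\<omega>. x \<bullet> (L s \<omega> - L 0 \<omega>)" and ?Y = "\<lambda>\<omega>. x \<bullet> (L (s + t) \<omega> - L s \<omega>)"
      have Y2: "expectation (\<lambda>\<omega>. (?Y \<omega>)\<^sup>2) = v t"
        using expectation_increment_shift[where \<phi> = "\<lambda>v. (x \<bullet> v)\<^sup>2", of "s + t" s] by (simp add: v_def)
      have "v (s + t) = expectation (\<lambda>\<omega>. (?X \<omega>)\<^sup>2 + (?Y \<omega>)\<^sup>2 + 2 * (?X \<omega> * ?Y \<omega>))"
        unfolding v_def
        by (rule Bochner_Integration.integral_cong) (auto simp: inner_diff_right power2_eq_square algebra_simps)
      also have "\<dots> = expectation (\<lambda>\<omega>. (?X \<omega>)\<^sup>2) + expectation (\<lambda>\<omega>. (?Y \<omega>)\<^sup>2)"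
        using sq_integrable_increment integrable_increment_mult expectation_increment_mult_0[of 0 s "s + t"] that
        by simp
      finally show ?thesis unfolding Y2 by (simp add: v_def)
    qed
    then have "v (t - s) = (t - s) * v 1"
      by (rule additive_nonneg_linear) (use assms in \<open>auto simp: v_def\<close>)
    moreover have "v 1 = cov x x"
      unfolding v_def cov_def by (rule integral_cong_AE) (use AE_L_0 in \<open>auto simp: power2_eq_square\<close>)
    ultimately show ?thesis
      using expectation_increment_shift[where \<phi> = "\<lambda>v. (x \<bullet> v)\<^sup>2", of t s] by (simp add: v_def)
  qed
  have cov_sum: "cov (x + y) (x + y) = cov x x + cov y y + 2 * cov x y"
  proof -
    have "cov (x + y) (x + y) = expectation (\<lambda>\<omega>. (x \<bullet> L 1 \<omega>) * (x \<bullet> L 1 \<omega>) + (y \<bullet> L 1 \<omega>) * (y \<bullet> L 1 \<omega>)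
        + 2 * ((x \<bullet> L 1 \<omega>) * (y \<bullet> L 1 \<omega>)))"
      unfolding cov_def by (rule Bochner_Integration.integral_cong) (auto simp: inner_add_left algebra_simps)
    then show ?thesis using integrable_cov by (simp add: cov_def)
  qed
  let ?D = "\<lambda>\<omega>. L t \<omega> - L s \<omega>"
  have "expectation (\<lambda>\<omega>. ((x + y) \<bullet> ?D \<omega>)\<^sup>2)
      = expectation (\<lambda>\<omega>. (x \<bullet> ?D \<omega>)\<^sup>2 + (y \<bullet> ?D \<omega>)\<^sup>2 + 2 * ((x \<bullet> ?D \<omega>) * (y \<bullet> ?D \<omega>)))"
    by (rule Bochner_Integration.integral_cong) (auto simp: inner_add_left power2_eq_square algebra_simps)
  also have "\<dots> = expectation (\<lambda>\<omega>. (x \<bullet> ?D \<omega>)\<^sup>2) + expectation (\<lambda>\<omega>. (y \<bullet> ?D \<omega>)\<^sup>2)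
      + 2 * expectation (\<lambda>\<omega>. (x \<bullet> ?D \<omega>) * (y \<bullet> ?D \<omega>))"
    using sq_integrable_increment integrable_increment_mult by simp
  finally show ?thesis unfolding sq cov_sum by (simp add: algebra_simps)
qed

text \<open>The longer increment is cut at the earlier of the two end points; the piece beyond it is
  orthogonal to the shorter increment.\<close>

lemma expectation_increment_mult_min:
  assumes "m \<le> s" "m \<le> t"
  shows "expectation (\<lambda>\<omega>. (x \<bullet> (L s \<omega> - L m \<omega>)) * (y \<bullet> (L t \<omega> - L m \<omega>))) = (min s t - m) * cov x y"
proof -
  have le: "expectation (\<lambda>\<omega>. (x \<bullet> (L s \<omega> - L m \<omega>)) * (y \<bullet> (L t \<omega> - L m \<omega>))) = (s - m) * cov x y"
    if "m \<le> s" "s \<le> t" for x y s t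
  proof -
    have "expectation (\<lambda>\<omega>. (x \<bullet> (L s \<omega> - L m \<omega>)) * (y \<bullet> (L t \<omega> - L m \<omega>)))
        = expectation (\<lambda>\<omega>. (x \<bullet> (L s \<omega> - L m \<omega>)) * (y \<bullet> (L s \<omega> - L m \<omega>))
            + (x \<bullet> (L s \<omega> - L m \<omega>)) * (y \<bullet> (L t \<omega> - L s \<omega>)))"
      by (rule Bochner_Integration.integral_cong) (auto simp: inner_diff_right algebra_simps)
    also have "\<dots> = (s - m) * cov x y"
      using integrable_increment_mult that
      by (simp add: expectation_increment_mult_same expectation_increment_mult_0)
    finally show ?thesis .
  qed
  have "cov y x = cov x y" by (simp add: cov_def mult.commute)
  then show ?thesis
    using le[of s t x y] le[of t s y x] assms by (cases "s \<le> t") (auto simp: min_def mult.commute)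
qed

lemma expectation_increment_mult:
  assumes "a \<le> b" "c \<le> d"
  shows "expectation (\<lambda>\<omega>. (x \<bullet> (L b \<omega> - L a \<omega>)) * (y \<bullet> (L d \<omega> - L c \<omega>)))
    = (\<integral>u. indicator {a<..b} u * indicator {c<..d} u * cov x y \<partial>lborel)"
proof -
  \<comment> \<open>A base point to the left of all four end points reduces everything to increments
    that start at \<open>m\<close>.\<close>
  define m where "m = min a c"
  let ?D = "\<lambda>x s \<omega>. x \<bullet> (L s \<omega> - L m \<omega>)"
  have "expectation (\<lambda>\<omega>. (x \<bullet> (L b \<omega> - L a \<omega>)) * (y \<bullet> (L d \<omega> - L c \<omega>)))
      = expectation (\<lambda>\<omega>. ?D x b \<omega> * ?D y d \<omega> - ?D x b \<omega> * ?D y c \<omega> - ?D x a \<omega> * ?D y d \<omega> + ?D x a \<omega> * ?D y c \<omega>)"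
    by (rule Bochner_Integration.integral_cong) (auto simp: inner_diff_right algebra_simps)
  also have "\<dots> = (min b d - min b c - min a d + min a c) * cov x y"
  proof -
    have m: "m \<le> a" "m \<le> b" "m \<le> c" "m \<le> d" using assms by (auto simp: m_def)
    have i: "integrable M (\<lambda>\<omega>. ?D x s \<omega> * ?D y t \<omega>)" for s t by (rule integrable_increment_mult)
    have "expectation (\<lambda>\<omega>. ?D x b \<omega> * ?D y d \<omega> - ?D x b \<omega> * ?D y c \<omega> - ?D x a \<omega> * ?D y d \<omega> + ?D x a \<omega> * ?D y c \<omega>)
        = (min b d - m) * cov x y - (min b c - m) * cov x y - (min a d - m) * cov x y + (min a c - m) * cov x y"
      using i by (simp only: Bochner_Integration.integral_add Bochner_Integration.integral_diff
          Bochner_Integration.integrable_diff expectation_increment_mult_min m)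
    then show ?thesis by (simp only: algebra_simps)
  qed
  \<comment> \<open>This mixed second difference of \<open>min\<close> is the length of the overlap,
    which is 0 for disjoint intervals.\<close>
  also have "min b d - min b c - min a d + min a c = measure lborel ({a<..b} \<inter> {c<..d})"
  proof -
    have "{a<..b} \<inter> {c<..d} = {max a c<..min b d}" by auto
    then show ?thesis using assms
      by (cases "max a c \<le> min b d") (auto simp: min_def max_def split: if_splits)
  qed
  also have "measure lborel ({a<..b} \<inter> {c<..d}) * cov x y
      = (\<integral>u. indicator {a<..b} u * indicator {c<..d} u * cov x y \<partial>lborel)"
    by (simp flip: indicator_inter_arith)
  finally show ?thesis .
qed

end

section \<open>The isometry of the Levy integral\<close>

lemma measurable_vec_nth[measurable (raw)]:
  fixes f :: "'a \<Rightarrow> 'b::topological_space^'n"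
  assumes "f \<in> borel_measurable N"
  shows "(\<lambda>x. f x $ i) \<in> borel_measurable N"
  by (rule borel_measurable_continuous_on[OF _ assms]) (intro continuous_intros)

text \<open>A single \<open>F n\<close> at finite distance already puts \<open>f\<close> into L2.
  Then all distances are finite, and the limit can be stated for Bochner integrals, as the inner
  product arguments require.\<close>

lemma L2_limit:
  fixes f :: "'a \<Rightarrow> real"
  assumes [measurable]: "f \<in> borel_measurable N" "\<And>n. F n \<in> borel_measurable N"
    and F: "\<And>n. integrable N (\<lambda>x. (F n x)\<^sup>2)"
    and lim: "(\<lambda>n. \<integral>\<^sup>+x. ennreal ((f x - F n x)\<^sup>2) \<partial>N) \<longlonglongrightarrow> 0"
  shows "integrable N (\<lambda>x. (f x)\<^sup>2)"
    and "(\<lambda>n. \<integral>x. (f x - F n x)\<^sup>2 \<partial>N) \<longlonglongrightarrow> 0"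
proof -
  have "\<forall>\<^sub>F n in sequentially. (\<integral>\<^sup>+x. ennreal ((f x - F n x)\<^sup>2) \<partial>N) < 1"
    using lim by (rule order_tendstoD) simp
  then obtain n where "(\<integral>\<^sup>+x. ennreal ((f x - F n x)\<^sup>2) \<partial>N) < 1"
    by (auto simp: eventually_sequentially)
  then have "(\<integral>\<^sup>+x. ennreal ((f x - F n x)\<^sup>2) \<partial>N) < \<infinity>"
    by (rule less_trans) simp
  then have "integrable N (\<lambda>x. (f x - F n x)\<^sup>2)"
    by (intro integrableI_nonneg) auto
  from L2_add[OF _ _ this F[of n]] show f: "integrable N (\<lambda>x. (f x)\<^sup>2)" by simp
  have "integrable N (\<lambda>x. (f x - F n x)\<^sup>2)" for n by (intro L2_diff f F) auto
  then have "(\<integral>\<^sup>+x. ennreal ((f x - F n x)\<^sup>2) \<partial>N) = ennreal (\<integral>x. (f x - F n x)\<^sup>2 \<partial>N)" for n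
    by (intro nn_integral_eq_integral) auto
  then show "(\<lambda>n. \<integral>x. (f x - F n x)\<^sup>2 \<partial>N) \<longlonglongrightarrow> 0"
    using lim by (simp add: ennreal_tendsto_0_iff)
qed

lemma nn_integral_tendsto_0_mono:
  assumes "\<And>n x. f n x \<le> g n x" and "(\<lambda>n. \<integral>\<^sup>+x. g n x \<partial>N) \<longlonglongrightarrow> 0"
  shows "(\<lambda>n. \<integral>\<^sup>+x. f n x \<partial>N) \<longlonglongrightarrow> 0"
  by (rule tendsto_sandwich[OF _ _ tendsto_const assms(2)]) (auto intro!: always_eventually nn_integral_mono assms(1))

lemma nn_integral_tendsto_0_cmult:
  fixes c :: real
  assumes [measurable]: "\<And>n. g n \<in> borel_measurable N"
    and lim: "(\<lambda>n. \<integral>\<^sup>+x. ennreal (g n x) \<partial>N) \<longlonglongrightarrow> 0"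
    and le: "\<And>n x. f n x \<le> c * g n x" and "0 \<le> c"
  shows "(\<lambda>n. \<integral>\<^sup>+x. ennreal (f n x) \<partial>N) \<longlonglongrightarrow> 0"
proof (rule nn_integral_tendsto_0_mono)
  show "ennreal (f n x) \<le> ennreal c * ennreal (g n x)" for n x
    using le[of n x] \<open>0 \<le> c\<close> by (simp add: ennreal_mult'[symmetric] ennreal_leI)
  have "(\<lambda>n. ennreal c * (\<integral>\<^sup>+x. ennreal (g n x) \<partial>N)) \<longlonglongrightarrow> ennreal c * 0"
    by (intro ennreal_tendsto_cmult lim) simp
  then show "(\<lambda>n. \<integral>\<^sup>+x. ennreal c * ennreal (g n x) \<partial>N) \<longlonglongrightarrow> 0"
    by (subst nn_integral_cmult) auto
qed

lemma step_fun_nth: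
  "step_fun xs u $ a = (\<Sum>i<length xs. indicator {fst (xs ! i)<..fst (snd (xs ! i))} u *\<^sub>R snd (snd (xs ! i)) $ a)"
  unfolding step_fun_def by (simp add: sum_list_sum_nth atLeast0LessThan case_prod_beta)

text \<open>Component \<open>a\<close> of the integral sees only row \<open>a\<close> of the
  integrand. Isometries are therefore stated for pairs of rows, with the bilinear form
  \<open>cov\<close>.\<close>

lemma step_integral_nth:
  "step_integral L xs \<omega> $ a
    = (\<Sum>i<length xs. (snd (snd (xs ! i)) $ a) \<bullet> (L (fst (snd (xs ! i))) \<omega> - L (fst (xs ! i)) \<omega>))"
  unfolding step_integral_def
  by (simp add: sum_list_sum_nth atLeast0LessThan case_prod_beta matrix_vector_mul_component)

lemma measurable_step_fun[measurable]: "step_fun xs \<in> borel_measurable borel"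
proof -
  have "step_fun xs = (\<lambda>u. \<Sum>i<length xs. indicator {fst (xs ! i)<..fst (snd (xs ! i))} u *\<^sub>R snd (snd (xs ! i)))"
    by (simp add: fun_eq_iff step_fun_def sum_list_sum_nth atLeast0LessThan case_prod_beta)
  moreover have "\<dots> \<in> borel_measurable borel"
    by (intro borel_measurable_sum borel_measurable_scaleR borel_measurable_const borel_measurable_indicator) simp
  ultimately show ?thesis by (simp only:)
qed

lemma integrable_indicator_Ioc_mult:
  "integrable lborel (\<lambda>u. indicator {s<..t} u * indicator {s'<..t'} u * c)" for s t s' t' c :: real
proof -
  have "emeasure lborel ({s<..t} \<inter> {s'<..t'}) < \<infinity>"
    by (rule emeasure_bounded_finite, rule bounded_subset[OF bounded_closed_interval[of s t]]) auto
  then have "integrable lborel (\<lambda>u. indicator ({s<..t} \<inter> {s'<..t'}) u :: real)"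
    by (intro integrable_real_indicator) auto
  then show ?thesis
    unfolding indicator_inter_arith[symmetric] by (rule integrable_mult_left)
qed

lemma sq_integrable_step_fun: "integrable lborel (\<lambda>u. (step_fun xs u $ a $ i)\<^sup>2)"
proof -
  have 1: "step_fun xs u $ a $ i
      = (\<Sum>j<length xs. indicator {fst (xs ! j)<..fst (snd (xs ! j))} u * snd (snd (xs ! j)) $ a $ i)" for u
    by (simp add: step_fun_nth)
  have "integrable lborel (\<lambda>u. \<Sum>j<length xs. \<Sum>k<length xs.
      (indicator {fst (xs ! j)<..fst (snd (xs ! j))} u * indicator {fst (xs ! k)<..fst (snd (xs ! k))} u)
        * (snd (snd (xs ! j)) $ a $ i * snd (snd (xs ! k)) $ a $ i))"
    by (intro Bochner_Integration.integrable_sum integrable_indicator_Ioc_mult)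
  then show ?thesis
    unfolding 1 power2_eq_square sum_product by (simp add: mult_ac)
qed

lemma bounded_linear_matrix_mult_right: "bounded_linear (\<lambda>X :: real^'k^'k. N ** X)" for N :: "real^'k::finite^'k"
  by (auto intro!: linearI simp: linear_conv_bounded_linear[symmetric] matrix_add_ldistrib matrix_scaleR
      matrix_matrix_mult_def vec_eq_iff sum_distrib_left mult_ac sum.distrib distrib_left)

context centred_L2_levy
begin

definition cov_coeff :: "'k \<Rightarrow> 'k \<Rightarrow> real" where
  "cov_coeff i j = expectation (\<lambda>\<omega>. L 1 \<omega> $ i * L 1 \<omega> $ j)"

text \<open>Coordinates reduce limits and Fubini arguments under \<open>cov\<close> to products of
  scalar square integrable functions.\<close>

lemma cov_eq: "cov x y = (\<Sum>i\<in>UNIV. \<Sum>j\<in>UNIV. x $ i * y $ j * cov_coeff i j)"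
proof -
  have int: "integrable M (\<lambda>\<omega>. L 1 \<omega> $ i * L 1 \<omega> $ j)" for i j
    using integrable_cov[of "axis i 1" "axis j 1"] by (simp add: inner_axis')
  have "cov x y = expectation (\<lambda>\<omega>. \<Sum>i\<in>UNIV. \<Sum>j\<in>UNIV. x $ i * y $ j * (L 1 \<omega> $ i * L 1 \<omega> $ j))"
    unfolding cov_def inner_vec_def sum_product
    by (rule Bochner_Integration.integral_cong) (auto simp: mult_ac)
  then show ?thesis
    using int by (simp add: cov_coeff_def)
qed

lemma cov_sum_left: "cov (\<Sum>i\<in>I. f i) y = (\<Sum>i\<in>I. cov (f i) y)"
proof (cases "finite I")
  case True
  have "expectation (\<lambda>\<omega>. (\<Sum>i\<in>I. f i) \<bullet> L 1 \<omega> * (y \<bullet> L 1 \<omega>)) = expectation (\<lambda>\<omega>. \<Sum>i\<in>I. f i \<bullet> L 1 \<omega> * (y \<bullet> L 1 \<omega>))"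
    by (simp add: inner_sum_left sum_distrib_right)
  then show ?thesis using integrable_cov by (simp add: cov_def)
qed (simp add: cov_def)

lemma cov_commute: "cov x y = cov y x"
  by (simp add: cov_def mult.commute)

lemma cov_sum_right: "cov x (\<Sum>i\<in>I. f i) = (\<Sum>i\<in>I. cov x (f i))"
  using cov_sum_left[of f I x] by (simp add: cov_commute)

lemma cov_scaleR_left: "cov (c *\<^sub>R x) y = c * cov x y"
  by (simp add: cov_eq sum_distrib_left mult_ac)

lemma cov_scaleR_right: "cov x (c *\<^sub>R y) = c * cov x y"
  by (simp add: cov_eq sum_distrib_left mult_ac)

text \<open>The trace of the matrix \<open>cov_coeff\<close>, a crude bound for the form
  \<open>cov\<close>.\<close>

definition cov_norm :: real where
  "cov_norm = expectation (\<lambda>\<omega>. (norm (L 1 \<omega>))\<^sup>2)"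

lemma abs_cov_le: "\<bar>cov x y\<bar> \<le> cov_norm * norm x * norm y"
proof -
  have "\<bar>cov x y\<bar> \<le> expectation (\<lambda>\<omega>. \<bar>(x \<bullet> L 1 \<omega>) * (y \<bullet> L 1 \<omega>)\<bar>)"
    unfolding cov_def by (rule integral_abs_bound)
  also have "\<dots> \<le> expectation (\<lambda>\<omega>. (norm (L 1 \<omega>))\<^sup>2 * (norm x * norm y))"
  proof (intro integral_mono integrable_abs integrable_cov)
    show "\<bar>(x \<bullet> L 1 \<omega>) * (y \<bullet> L 1 \<omega>)\<bar> \<le> (norm (L 1 \<omega>))\<^sup>2 * (norm x * norm y)" for \<omega>
      using mult_mono[OF Cauchy_Schwarz_ineq2[of x "L 1 \<omega>"] Cauchy_Schwarz_ineq2[of y "L 1 \<omega>"]]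
      by (simp add: abs_mult power2_eq_square mult_ac)
  qed (use sq_norm_1 in simp)
  finally show ?thesis by (simp add: cov_norm_def mult_ac)
qed

lemma cov_norm_nonneg: "0 \<le> cov_norm"
  by (simp add: cov_norm_def)

lemma measurable_step_integral[measurable]: "step_integral L xs \<in> borel_measurable M"
proof -
  have "step_integral L xs = (\<lambda>\<omega>. \<Sum>i<length xs. snd (snd (xs ! i)) *v (L (fst (snd (xs ! i))) \<omega> - L (fst (xs ! i)) \<omega>))"
    by (simp add: fun_eq_iff step_integral_def sum_list_sum_nth atLeast0LessThan case_prod_beta)
  moreover have "(\<lambda>\<omega>. A *v f \<omega>) \<in> borel_measurable M" if [measurable]: "f \<in> borel_measurable M" for A :: "real^'k^'k" and f
    by (rule measurable_compose[OF that borel_measurable_continuous_onI])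
       (intro linear_continuous_on matrix_vector_mul_bounded_linear)
  ultimately show ?thesis by (auto intro!: borel_measurable_sum)
qed

lemma sq_integrable_step_integral: "integrable M (\<lambda>\<omega>. (step_integral L xs \<omega> $ a)\<^sup>2)"
proof -
  have "integrable M (\<lambda>\<omega>. \<Sum>i<length xs. \<Sum>j<length xs.
      (snd (snd (xs ! i)) $ a \<bullet> (L (fst (snd (xs ! i))) \<omega> - L (fst (xs ! i)) \<omega>)) *
      (snd (snd (xs ! j)) $ a \<bullet> (L (fst (snd (xs ! j))) \<omega> - L (fst (xs ! j)) \<omega>)))"
    by (intro Bochner_Integration.integrable_sum integrable_increment_mult)
  then show ?thesis unfolding step_integral_nth power2_eq_square sum_product .
qed

text \<open>Both sides are bilinear, and \<open>expectation_increment_mult\<close> settles two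
  single intervals, overlapping or not. The order of the end points matters: for
  \<open>t < s\<close> the indicator of \<open>{s<..t}\<close> vanishes while the increment need
  not.\<close>

lemma step_integral_isometry:
  assumes xs: "\<forall>(s, t, F) \<in> set xs. s \<le> t" and ys: "\<forall>(s, t, F) \<in> set ys. s \<le> t"
  shows "expectation (\<lambda>\<omega>. step_integral L xs \<omega> $ a * step_integral L ys \<omega> $ b)
    = (\<integral>u. cov (step_fun xs u $ a) (step_fun ys u $ b) \<partial>lborel)"
proof -
  define s t F where "s zs i = fst (zs ! i)" and "t zs i = fst (snd (zs ! i))" and "F zs i = snd (snd (zs ! i))"
    for zs :: "(real \<times> real \<times> (real^'k^'k)) list" and i
  have x: "s xs i \<le> t xs i" if "i < length xs" for i
    using xs nth_mem[OF that] by (auto simp: s_def t_def case_prod_beta)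
  have y: "s ys i \<le> t ys i" if "i < length ys" for i
    using ys nth_mem[OF that] by (auto simp: s_def t_def case_prod_beta)
  have "expectation (\<lambda>\<omega>. step_integral L xs \<omega> $ a * step_integral L ys \<omega> $ b)
      = (\<Sum>i<length xs. \<Sum>j<length ys. expectation (\<lambda>\<omega>.
        (F xs i $ a \<bullet> (L (t xs i) \<omega> - L (s xs i) \<omega>)) * (F ys j $ b \<bullet> (L (t ys j) \<omega> - L (s ys j) \<omega>))))"
    unfolding step_integral_nth sum_product s_def[symmetric] t_def[symmetric] F_def[symmetric]
    by (subst Bochner_Integration.integral_sum, intro Bochner_Integration.integrable_sum integrable_increment_mult,
        intro sum.cong refl Bochner_Integration.integral_sum integrable_increment_mult)
  also have "\<dots> = (\<Sum>i<length xs. \<Sum>j<length ys.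
      (\<integral>u. indicator {s xs i<..t xs i} u * indicator {s ys j<..t ys j} u * cov (F xs i $ a) (F ys j $ b) \<partial>lborel))"
    by (intro sum.cong refl expectation_increment_mult) (use x y in auto)
  also have "\<dots> = (\<integral>u. (\<Sum>i<length xs. \<Sum>j<length ys.
      indicator {s xs i<..t xs i} u * indicator {s ys j<..t ys j} u * cov (F xs i $ a) (F ys j $ b)) \<partial>lborel)"
    by (subst Bochner_Integration.integral_sum, intro Bochner_Integration.integrable_sum integrable_indicator_Ioc_mult,
        intro sum.cong refl Bochner_Integration.integral_sum[symmetric] integrable_indicator_Ioc_mult)
  also have "\<dots> = (\<integral>u. cov (step_fun xs u $ a) (step_fun ys u $ b) \<partial>lborel)"
    unfolding step_fun_nth cov_sum_left unfolding cov_sum_right cov_scaleR_left cov_scaleR_right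
    by (simp only: s_def t_def F_def mult_ac)
  finally show ?thesis .
qed

text \<open>One sequence \<open>xs\<close> serves integrand and integral at once, and components are
  bounded by norms. \<open>L2_limit\<close> brings the limits into Bochner form and adds square
  integrability of every component.\<close>

lemma levy_integral_component_limits:
  assumes "has_levy_integral M L f S I"
  obtains xs where "\<forall>n. \<forall>(s, t, F) \<in> set (xs n). s \<le> t"
    and "\<forall>a. integrable M (\<lambda>\<omega>. (I \<omega> $ a)\<^sup>2)"
    and "\<forall>a. (\<lambda>n. \<integral>\<omega>. (I \<omega> $ a - step_integral L (xs n) \<omega> $ a)\<^sup>2 \<partial>M) \<longlonglongrightarrow> 0"
    and "\<forall>a i. integrable lborel (\<lambda>u. ((indicator S u *\<^sub>R f u) $ a $ i)\<^sup>2)"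
    and "\<forall>a i. (\<lambda>n. \<integral>u. ((indicator S u *\<^sub>R f u) $ a $ i - step_fun (xs n) u $ a $ i)\<^sup>2 \<partial>lborel) \<longlonglongrightarrow> 0"
proof -
  obtain xs where xs: "\<forall>n. \<forall>(s, t, F) \<in> set (xs n). s \<le> t"
    and f: "(\<lambda>n. \<integral>\<^sup>+u. ennreal ((norm (indicator S u *\<^sub>R f u - step_fun (xs n) u))\<^sup>2) \<partial>lborel) \<longlonglongrightarrow> 0"
    and I: "(\<lambda>n. \<integral>\<^sup>+\<omega>. ennreal ((norm (I \<omega> - step_integral L (xs n) \<omega>))\<^sup>2) \<partial>M) \<longlonglongrightarrow> 0"
    and fm: "(\<lambda>u. indicator S u *\<^sub>R f u) \<in> borel_measurable lborel" and Im[measurable]: "I \<in> borel_measurable M"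
    using assms unfolding has_levy_integral_def by blast
  have fm'[measurable]: "(\<lambda>u. indicator S u *\<^sub>R f u) \<in> borel_measurable borel"
    using fm by (simp cong: measurable_cong_sets)
  have fai: "(\<lambda>u. (indicator S u *\<^sub>R f u) $ a $ i) \<in> borel_measurable lborel"
    and sai: "(\<lambda>u. step_fun zs u $ a $ i) \<in> borel_measurable lborel" for zs a i
    by (intro measurable_vec_nth fm) (intro measurable_vec_nth, simp)
  have 1: "(\<lambda>n. \<integral>\<^sup>+\<omega>. ennreal ((I \<omega> $ a - step_integral L (xs n) \<omega> $ a)\<^sup>2) \<partial>M) \<longlonglongrightarrow> 0" for a
  proof (rule nn_integral_tendsto_0_mono[OF _ I])
    show "ennreal ((I \<omega> $ a - step_integral L (xs n) \<omega> $ a)\<^sup>2) \<le> ennreal ((norm (I \<omega> - step_integral L (xs n) \<omega>))\<^sup>2)" for n \<omega>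
      using power_mono[OF component_le_norm_cart[of "I \<omega> - step_integral L (xs n) \<omega>" a], of 2] by (intro ennreal_leI) simp
  qed
  have 2: "(\<lambda>n. \<integral>\<^sup>+u. ennreal (((indicator S u *\<^sub>R f u) $ a $ i - step_fun (xs n) u $ a $ i)\<^sup>2) \<partial>lborel) \<longlonglongrightarrow> 0" for a i
  proof (rule nn_integral_tendsto_0_mono[OF _ f])
    fix n u
    have "\<bar>(indicator S u *\<^sub>R f u - step_fun (xs n) u) $ a $ i\<bar> \<le> norm (indicator S u *\<^sub>R f u - step_fun (xs n) u)"
      by (rule order_trans[OF component_le_norm_cart Finite_Cartesian_Product.norm_nth_le])
    from power_mono[OF this, of 2]
    show "ennreal (((indicator S u *\<^sub>R f u) $ a $ i - step_fun (xs n) u $ a $ i)\<^sup>2)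
        \<le> ennreal ((norm (indicator S u *\<^sub>R f u - step_fun (xs n) u))\<^sup>2)"
      by (intro ennreal_leI) simp
  qed
  have [measurable]: "(\<lambda>\<omega>. I \<omega> $ a) \<in> borel_measurable M" "(\<lambda>\<omega>. step_integral L (xs n) \<omega> $ a) \<in> borel_measurable M" for a n
    by (intro measurable_vec_nth Im measurable_step_integral)+
  have "\<forall>a. integrable M (\<lambda>\<omega>. (I \<omega> $ a)\<^sup>2)"
      "\<forall>a. (\<lambda>n. \<integral>\<omega>. (I \<omega> $ a - step_integral L (xs n) \<omega> $ a)\<^sup>2 \<partial>M) \<longlonglongrightarrow> 0"
    using L2_limit[OF _ _ sq_integrable_step_integral 1] by auto
  moreover have "\<forall>a i. integrable lborel (\<lambda>u. ((indicator S u *\<^sub>R f u) $ a $ i)\<^sup>2)"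
      "\<forall>a i. (\<lambda>n. \<integral>u. ((indicator S u *\<^sub>R f u) $ a $ i - step_fun (xs n) u $ a $ i)\<^sup>2 \<partial>lborel) \<longlonglongrightarrow> 0"
    using L2_limit[OF fai sai sq_integrable_step_fun 2] by blast+
  ultimately show thesis
    using xs by (intro that[of xs])
qed

lemma levy_integral_L2:
  assumes "has_levy_integral M L f S I"
  shows levy_integral_sq_integrable: "integrable M (\<lambda>\<omega>. (I \<omega> $ a)\<^sup>2)"
    and levy_integrand_sq_integrable: "integrable lborel (\<lambda>u. ((indicator S u *\<^sub>R f u) $ a $ i)\<^sup>2)"
  by (rule levy_integral_component_limits[OF assms]; blast)+

text \<open>The isometry holds along the approximating step functions, and continuity of the L2
  inner product takes both of its sides to the limit. Different domains \<open>S\<close> and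
  \<open>T\<close> are compatible because integrands are extended by 0.\<close>

lemma levy_integral_isometry:
  assumes f: "has_levy_integral M L f S I" and g: "has_levy_integral M L g T J"
  shows "expectation (\<lambda>\<omega>. I \<omega> $ a * J \<omega> $ b)
    = (\<integral>u. cov ((indicator S u *\<^sub>R f u) $ a) ((indicator T u *\<^sub>R g u) $ b) \<partial>lborel)"
proof -
  obtain xs where xs: "\<forall>n. \<forall>(s, t, F) \<in> set (xs n). s \<le> t"
    "\<forall>a. integrable M (\<lambda>\<omega>. (I \<omega> $ a)\<^sup>2)"
    "\<forall>a. (\<lambda>n. \<integral>\<omega>. (I \<omega> $ a - step_integral L (xs n) \<omega> $ a)\<^sup>2 \<partial>M) \<longlonglongrightarrow> 0"
    "\<forall>a i. integrable lborel (\<lambda>u. ((indicator S u *\<^sub>R f u) $ a $ i)\<^sup>2)"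
    "\<forall>a i. (\<lambda>n. \<integral>u. ((indicator S u *\<^sub>R f u) $ a $ i - step_fun (xs n) u $ a $ i)\<^sup>2 \<partial>lborel) \<longlonglongrightarrow> 0"
    by (rule levy_integral_component_limits[OF f]) (rule that)
  obtain ys where ys: "\<forall>n. \<forall>(s, t, F) \<in> set (ys n). s \<le> t"
    "\<forall>a. integrable M (\<lambda>\<omega>. (J \<omega> $ a)\<^sup>2)"
    "\<forall>a. (\<lambda>n. \<integral>\<omega>. (J \<omega> $ a - step_integral L (ys n) \<omega> $ a)\<^sup>2 \<partial>M) \<longlonglongrightarrow> 0"
    "\<forall>a i. integrable lborel (\<lambda>u. ((indicator T u *\<^sub>R g u) $ a $ i)\<^sup>2)"
    "\<forall>a i. (\<lambda>n. \<integral>u. ((indicator T u *\<^sub>R g u) $ a $ i - step_fun (ys n) u $ a $ i)\<^sup>2 \<partial>lborel) \<longlonglongrightarrow> 0"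
    by (rule levy_integral_component_limits[OF g]) (rule that)
  have fm: "(\<lambda>u. indicator S u *\<^sub>R f u) \<in> borel_measurable lborel" and gm: "(\<lambda>u. indicator T u *\<^sub>R g u) \<in> borel_measurable lborel"
    and Im: "I \<in> borel_measurable M" and Jm: "J \<in> borel_measurable M"
    using f g unfolding has_levy_integral_def by blast+
  have sm: "(\<lambda>u. step_fun zs u) \<in> borel_measurable lborel" for zs :: "(real \<times> real \<times> (real^'k^'k)) list"
    by simp
  have nth2: "(\<lambda>x. h x $ a $ i) \<in> borel_measurable N"
    if "h \<in> borel_measurable N" for h :: "'b \<Rightarrow> real^'k^'k" and a i N
    by (intro measurable_vec_nth that)
  define f' where "f' u = indicator S u *\<^sub>R f u" for u
  define g' where "g' u = indicator T u *\<^sub>R g u" for u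
  note xs' = xs(4,5)[folded f'_def] fm[folded f'_def] and ys' = ys(4,5)[folded g'_def] gm[folded g'_def]
  have cov_int: "(\<integral>u. cov (k u $ a) (l u $ b) \<partial>lborel) = (\<Sum>i\<in>UNIV. \<Sum>j\<in>UNIV. (\<integral>u. k u $ a $ i * l u $ b $ j \<partial>lborel) * cov_coeff i j)"
    if k: "\<And>i. integrable lborel (\<lambda>u. (k u $ a $ i)\<^sup>2)" "k \<in> borel_measurable lborel"
      and l: "\<And>i. integrable lborel (\<lambda>u. (l u $ b $ i)\<^sup>2)" "l \<in> borel_measurable lborel"
    for k l :: "real \<Rightarrow> real^'k^'k"
  proof -
    have "integrable lborel (\<lambda>u. k u $ a $ i * l u $ b $ j)" for i j
      by (intro L2_mult_integrable nth2 k l)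
    then show ?thesis unfolding cov_eq by simp
  qed
  have "(\<lambda>n. expectation (\<lambda>\<omega>. step_integral L (xs n) \<omega> $ a * step_integral L (ys n) \<omega> $ b))
      \<longlonglongrightarrow> expectation (\<lambda>\<omega>. I \<omega> $ a * J \<omega> $ b)"
    by (intro L2_inner_tendsto xs[THEN spec] ys[THEN spec] sq_integrable_step_integral measurable_vec_nth Im Jm measurable_step_integral)
  moreover have "(\<lambda>n. \<integral>u. cov (step_fun (xs n) u $ a) (step_fun (ys n) u $ b) \<partial>lborel)
      \<longlonglongrightarrow> (\<integral>u. cov (f' u $ a) (g' u $ b) \<partial>lborel)"
    unfolding cov_int[OF sq_integrable_step_fun sm sq_integrable_step_fun sm] cov_int[OF xs'(1)[rule_format] xs'(3) ys'(1)[rule_format] ys'(3)]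
    by (intro tendsto_sum tendsto_mult tendsto_const L2_inner_tendsto xs'(1,2)[rule_format] ys'(1,2)[rule_format] xs'(3) ys'(3) sq_integrable_step_fun nth2 sm)
  ultimately show ?thesis
    unfolding step_integral_isometry[OF xs(1)[THEN spec] ys(1)[THEN spec]] f'_def g'_def by (rule LIMSEQ_unique)
qed

section \<open>Linear operations on Levy integrals\<close>

lemma has_levy_integralE:
  assumes "has_levy_integral M L f S I"
  obtains xs where "\<forall>n. \<forall>(s, t, F) \<in> set (xs n). s \<le> t"
    "(\<lambda>n. \<integral>\<^sup>+u. ennreal ((norm (indicator S u *\<^sub>R f u - step_fun (xs n) u))\<^sup>2) \<partial>lborel) \<longlonglongrightarrow> 0"
    "(\<lambda>n. \<integral>\<^sup>+\<omega>. ennreal ((norm (I \<omega> - step_integral L (xs n) \<omega>))\<^sup>2) \<partial>M) \<longlonglongrightarrow> 0"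
    "(\<lambda>u. indicator S u *\<^sub>R f u) \<in> borel_measurable borel" "I \<in> borel_measurable M"
  using assms unfolding has_levy_integral_def by (auto cong: measurable_cong_sets)

text \<open>A constant matrix passes through step functions and step integrals alike, so the
  multiplied steps approximate. Together with sums this makes \<open>Y(s)\<close> and
  \<open>H (t - u) *v Y(u)\<close> Levy integrals, to which the isometry applies.\<close>

lemma has_levy_integral_matrix_mult:
  assumes "has_levy_integral M L f S I"
  shows "has_levy_integral M L (\<lambda>u. N ** f u) S (\<lambda>\<omega>. N *v I \<omega>)"
proof -
  obtain xs where xs: "\<forall>n. \<forall>(s, t, F) \<in> set (xs n). s \<le> t"
    and f: "(\<lambda>n. \<integral>\<^sup>+u. ennreal ((norm (indicator S u *\<^sub>R f u - step_fun (xs n) u))\<^sup>2) \<partial>lborel) \<longlonglongrightarrow> 0"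
    and I: "(\<lambda>n. \<integral>\<^sup>+\<omega>. ennreal ((norm (I \<omega> - step_integral L (xs n) \<omega>))\<^sup>2) \<partial>M) \<longlonglongrightarrow> 0"
    and fm[measurable]: "(\<lambda>u. indicator S u *\<^sub>R f u) \<in> borel_measurable borel" and Im[measurable]: "I \<in> borel_measurable M"
    by (rule has_levy_integralE[OF assms]) (rule that)
  define ys where "ys n = map (\<lambda>(s, t, F). (s, t, N ** F)) (xs n)" for n
  interpret m: bounded_linear "\<lambda>X :: real^'k^'k. N ** X" by (rule bounded_linear_matrix_mult_right)
  interpret v: bounded_linear "\<lambda>x. N *v x" by (rule matrix_vector_mul_bounded_linear)
  obtain K where K: "\<And>X :: real^'k^'k. norm (N ** X) \<le> norm X * K" "0 \<le> K" using m.nonneg_bounded by blast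
  obtain K' where K': "\<And>x. norm (N *v x) \<le> norm x * K'" "0 \<le> K'" using v.nonneg_bounded by blast
  have sf: "step_fun (ys n) u = N ** step_fun (xs n) u" for n u
  proof -
    have "step_fun (map (\<lambda>(s, t, F). (s, t, N ** F)) zs) u = N ** step_fun zs u" for zs
      unfolding step_fun_def by (induction zs) (auto simp: m.add m.scaleR case_prod_beta)
    then show ?thesis by (simp add: ys_def)
  qed
  have si: "step_integral L (ys n) \<omega> = N *v step_integral L (xs n) \<omega>" for n \<omega>
  proof -
    have "step_integral L (map (\<lambda>(s, t, F). (s, t, N ** F)) zs) \<omega> = N *v step_integral L zs \<omega>" for zs
      unfolding step_integral_def by (induction zs) (auto simp: v.add case_prod_beta matrix_vector_mul_assoc)
    then show ?thesis by (simp add: ys_def)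
  qed
  show ?thesis
    unfolding has_levy_integral_def
  proof (intro conjI exI[of _ ys])
    show "(\<lambda>u. indicator S u *\<^sub>R (N ** f u)) \<in> borel_measurable lborel"
      unfolding m.scaleR[symmetric]
      by (rule borel_measurable_continuous_on[OF _ ]) (auto intro: m.continuous_on continuous_on_id)
    show "(\<lambda>\<omega>. N *v I \<omega>) \<in> borel_measurable M"
      by (rule borel_measurable_continuous_on[OF _ Im]) (auto intro: v.continuous_on continuous_on_id)
    show "\<forall>n. \<forall>(s, t, F) \<in> set (ys n). s \<le> t"
      using xs by (fastforce simp: ys_def)
    show "(\<lambda>n. \<integral>\<^sup>+u. ennreal ((norm (indicator S u *\<^sub>R (N ** f u) - step_fun (ys n) u))\<^sup>2) \<partial>lborel) \<longlonglongrightarrow> 0"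
      unfolding sf m.scaleR[symmetric] m.diff[symmetric]
    proof (rule nn_integral_tendsto_0_cmult[OF _ f])
      show "(norm (N ** X n u))\<^sup>2 \<le> K\<^sup>2 * (norm (X n u))\<^sup>2" for n :: nat and u :: real and X :: "nat \<Rightarrow> real \<Rightarrow> real^'k^'k"
        using power_mono[OF K(1), of "X n u" 2] by (simp add: power_mult_distrib mult.commute)
    qed auto
    show "(\<lambda>n. \<integral>\<^sup>+\<omega>. ennreal ((norm (N *v I \<omega> - step_integral L (ys n) \<omega>))\<^sup>2) \<partial>M) \<longlonglongrightarrow> 0"
      unfolding si v.diff[symmetric]
    proof (rule nn_integral_tendsto_0_cmult[OF _ I])
      show "(norm (N *v X n u))\<^sup>2 \<le> K'\<^sup>2 * (norm (X n u))\<^sup>2" for n :: nat and u :: 'w and X :: "nat \<Rightarrow> 'w \<Rightarrow> real^'k"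
        using power_mono[OF K'(1), of "X n u" 2] by (simp add: power_mult_distrib mult.commute)
    qed auto
  qed
qed

lemma has_levy_integral_add:
  assumes "has_levy_integral M L f S I" "has_levy_integral M L g S J"
  shows "has_levy_integral M L (\<lambda>u. f u + g u) S (\<lambda>\<omega>. I \<omega> + J \<omega>)"
proof -
  obtain xs where xs: "\<forall>n. \<forall>(s, t, F) \<in> set (xs n). s \<le> t"
    and f: "(\<lambda>n. \<integral>\<^sup>+u. ennreal ((norm (indicator S u *\<^sub>R f u - step_fun (xs n) u))\<^sup>2) \<partial>lborel) \<longlonglongrightarrow> 0"
    and I: "(\<lambda>n. \<integral>\<^sup>+\<omega>. ennreal ((norm (I \<omega> - step_integral L (xs n) \<omega>))\<^sup>2) \<partial>M) \<longlonglongrightarrow> 0"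
    and fm[measurable]: "(\<lambda>u. indicator S u *\<^sub>R f u) \<in> borel_measurable borel" and Im[measurable]: "I \<in> borel_measurable M"
    by (rule has_levy_integralE[OF assms(1)]) (rule that)
  obtain ys where ys: "\<forall>n. \<forall>(s, t, F) \<in> set (ys n). s \<le> t"
    and g: "(\<lambda>n. \<integral>\<^sup>+u. ennreal ((norm (indicator S u *\<^sub>R g u - step_fun (ys n) u))\<^sup>2) \<partial>lborel) \<longlonglongrightarrow> 0"
    and J: "(\<lambda>n. \<integral>\<^sup>+\<omega>. ennreal ((norm (J \<omega> - step_integral L (ys n) \<omega>))\<^sup>2) \<partial>M) \<longlonglongrightarrow> 0"
    and gm[measurable]: "(\<lambda>u. indicator S u *\<^sub>R g u) \<in> borel_measurable borel" and Jm[measurable]: "J \<in> borel_measurable M"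
    by (rule has_levy_integralE[OF assms(2)]) (rule that)
  have sf: "indicator S u *\<^sub>R (f u + g u) - step_fun (xs n @ ys n) u
      = (indicator S u *\<^sub>R f u - step_fun (xs n) u) + (indicator S u *\<^sub>R g u - step_fun (ys n) u)" for n u
    by (simp add: step_fun_def scaleR_add_right)
  have si: "I \<omega> + J \<omega> - step_integral L (xs n @ ys n) \<omega>
      = (I \<omega> - step_integral L (xs n) \<omega>) + (J \<omega> - step_integral L (ys n) \<omega>)" for n \<omega>
    by (simp add: step_integral_def)
  have le: "(norm (x + y))\<^sup>2 \<le> 2 * ((norm x)\<^sup>2 + (norm y)\<^sup>2)" for x y :: "'c::real_normed_vector"
  proof -
    have "(norm (x + y))\<^sup>2 \<le> (norm x + norm y)\<^sup>2" by (intro power_mono norm_triangle_ineq) simp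
    also have "\<dots> \<le> 2 * ((norm x)\<^sup>2 + (norm y)\<^sup>2)"
      using sum_squares_bound[of "norm x" "norm y"] by (simp add: power2_sum)
    finally show ?thesis .
  qed
  have sum0: "(\<lambda>n. \<integral>\<^sup>+x. ennreal ((norm (X n x))\<^sup>2 + (norm (Z n x))\<^sup>2) \<partial>N) \<longlonglongrightarrow> 0"
    if [measurable]: "\<And>n. X n \<in> borel_measurable N" "\<And>n. Z n \<in> borel_measurable N"
      and lim: "(\<lambda>n. \<integral>\<^sup>+x. ennreal ((norm (X n x))\<^sup>2) \<partial>N) \<longlonglongrightarrow> 0" "(\<lambda>n. \<integral>\<^sup>+x. ennreal ((norm (Z n x))\<^sup>2) \<partial>N) \<longlonglongrightarrow> 0"
    for N :: "'b measure" and X Z :: "nat \<Rightarrow> 'b \<Rightarrow> 'c::euclidean_space"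
    using tendsto_add[OF lim] by (simp add: nn_integral_add[symmetric])
  show ?thesis
    unfolding has_levy_integral_def
  \<comment> \<open>Concatenation of lists adds step functions and step integrals, so the intervals
    of the two lists can stay as they are.\<close>
  proof (intro conjI exI[of _ "\<lambda>n. xs n @ ys n"])
    show "(\<lambda>u. indicator S u *\<^sub>R (f u + g u)) \<in> borel_measurable lborel"
      unfolding scaleR_add_right by measurable
    show "\<forall>n. \<forall>(s, t, F) \<in> set (xs n @ ys n). s \<le> t" using xs ys by (simp add: ball_Un)
    show "(\<lambda>n. \<integral>\<^sup>+u. ennreal ((norm (indicator S u *\<^sub>R (f u + g u) - step_fun (xs n @ ys n) u))\<^sup>2) \<partial>lborel) \<longlonglongrightarrow> 0"
      unfolding sf by (rule nn_integral_tendsto_0_cmult[OF _ sum0[OF _ _ f g] le]) auto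
    show "(\<lambda>n. \<integral>\<^sup>+\<omega>. ennreal ((norm (I \<omega> + J \<omega> - step_integral L (xs n @ ys n) \<omega>))\<^sup>2) \<partial>M) \<longlonglongrightarrow> 0"
      unfolding si by (rule nn_integral_tendsto_0_cmult[OF _ sum0[OF _ _ I J] le]) auto
  qed simp
qed

lemma has_levy_integral_0: "has_levy_integral M L (\<lambda>_. 0) S (\<lambda>_. 0)"
  unfolding has_levy_integral_def
  by (intro conjI exI[of _ "\<lambda>_. []"]) (auto simp: step_fun_def step_integral_def)

lemma has_levy_integral_sum:
  assumes "finite A" "\<And>i. i \<in> A \<Longrightarrow> has_levy_integral M L (f i) S (I i)"
  shows "has_levy_integral M L (\<lambda>u. \<Sum>i\<in>A. f i u) S (\<lambda>\<omega>. \<Sum>i\<in>A. I i \<omega>)"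
  using assms by (induction A rule: finite_induct) (auto intro: has_levy_integral_0 has_levy_integral_add)

end

section \<open>Exponential decay of solutions of stable linear systems\<close>

definition geometric_growth :: "(nat \<Rightarrow> 'a::real_normed_vector) \<Rightarrow> bool" where
  "geometric_growth \<alpha> \<longleftrightarrow> (\<exists>c K. \<forall>n. norm (\<alpha> n) \<le> K * c ^ n)"

text \<open>The exponential generating function: under geometric growth it converges everywhere and
  \<open>\<alpha> n\<close> is its \<open>n\<close>-th derivative at 0. Differentiation is a shift
  of the sequence, and linear equations with constant coefficients become recurrences.\<close>

definition egf :: "(nat \<Rightarrow> 'a) \<Rightarrow> 'a \<Rightarrow> 'a::{banach,real_normed_field}" where
  "egf \<alpha> z = (\<Sum>n. \<alpha> n / fact n * z ^ n)"

lemma egf_summable: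
  fixes \<alpha> :: "nat \<Rightarrow> 'a::{banach,real_normed_field}"
  assumes "geometric_growth \<alpha>"
  shows "summable (\<lambda>n. \<alpha> n / fact n * z ^ n)"
proof -
  obtain c K where cK: "\<And>n. norm (\<alpha> n) \<le> K * c ^ n"
    using assms by (auto simp: geometric_growth_def)
  have "summable (\<lambda>n. K * (inverse (fact n) * (c * norm z) ^ n))"
    by (intro summable_mult summable_exp)
  then show ?thesis
  proof (rule summable_comparison_test')
    show "norm (\<alpha> n / fact n * z ^ n) \<le> K * (inverse (fact n) * (c * norm z) ^ n)" for n
      using mult_right_mono[OF cK[of n], of "inverse (fact n) * norm z ^ n"]
      by (simp add: norm_mult norm_inverse norm_power divide_inverse power_mult_distrib mult_ac)
  qed
qed

lemma DERIV_egf: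
  fixes \<alpha> :: "nat \<Rightarrow> 'a::{banach,real_normed_field}"
  assumes "geometric_growth \<alpha>"
  shows "(egf \<alpha> has_field_derivative egf (\<lambda>n. \<alpha> (Suc n)) z) (at z)"
proof -
  have "diffs (\<lambda>n. \<alpha> n / fact n) = (\<lambda>n. \<alpha> (Suc n) / fact n)"
  proof
    fix n
    have "(of_nat (Suc n) :: 'a) \<noteq> 0" by (simp del: of_nat_Suc)
    then show "diffs (\<lambda>n. \<alpha> n / fact n) n = \<alpha> (Suc n) / fact n"
      by (simp add: diffs_def divide_simps del: of_nat_Suc)
  qed
  then show ?thesis
    using termdiffs_strong_converges_everywhere[OF egf_summable[OF assms], of z]
    by (simp add: egf_def[abs_def])
qed

lemma egf_0: "egf \<alpha> 0 = \<alpha> 0"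
  unfolding egf_def by (subst powser_zero) simp

lemma geometric_growth_Suc:
  assumes "geometric_growth \<alpha>"
  shows "geometric_growth (\<lambda>n. \<alpha> (Suc n))"
proof -
  obtain c K where "\<And>n. norm (\<alpha> n) \<le> K * c ^ n"
    using assms by (auto simp: geometric_growth_def)
  then have "norm (\<alpha> (Suc n)) \<le> (K * c) * c ^ n" for n
    by (metis mult.assoc power_Suc)
  then show ?thesis unfolding geometric_growth_def by blast
qed

lemma geometric_growth_Suc_minus:
  fixes \<alpha> :: "nat \<Rightarrow> 'a::real_normed_field"
  assumes "geometric_growth \<alpha>"
  shows "geometric_growth (\<lambda>n. \<alpha> (Suc n) - z * \<alpha> n)"
proof -
  obtain c K where cK: "\<And>n. norm (\<alpha> n) \<le> K * c ^ n"
    using assms by (auto simp: geometric_growth_def)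
  have "norm (\<alpha> (Suc n) - z * \<alpha> n) \<le> (K * (c + norm z)) * c ^ n" for n
  proof -
    have "norm (\<alpha> (Suc n) - z * \<alpha> n) \<le> norm (\<alpha> (Suc n)) + norm z * norm (\<alpha> n)"
      by (metis norm_triangle_ineq4 norm_mult)
    also have "\<dots> \<le> K * c ^ Suc n + norm z * (K * c ^ n)"
      by (intro add_mono cK mult_left_mono) simp
    finally show ?thesis by (simp add: algebra_simps)
  qed
  then show ?thesis unfolding geometric_growth_def by blast
qed

section \<open>Exponential decay\<close>

definition exp_decay :: "(real \<Rightarrow> 'a::real_normed_vector) \<Rightarrow> bool" where
  "exp_decay f \<longleftrightarrow> (\<exists>K. \<exists>\<delta>>0. \<forall>r\<ge>0. norm (f r) \<le> K * exp (- \<delta> * r))"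

lemma exp_decayE:
  assumes "exp_decay f"
  obtains K \<delta> where "0 \<le> K" "0 < \<delta>" "\<forall>r\<ge>0. norm (f r) \<le> K * exp (- \<delta> * r)"
proof -
  obtain K \<delta> where K: "0 < \<delta>" "\<forall>r\<ge>0. norm (f r) \<le> K * exp (- \<delta> * r)"
    using assms unfolding exp_decay_def by blast
  have "0 \<le> K" using order_trans[OF norm_ge_zero K(2)[rule_format, of 0]] by simp
  with K show thesis by (intro that)
qed

lemma exp_decay_sum:
  assumes "\<And>i. i \<in> A \<Longrightarrow> exp_decay (f i)"
  shows "exp_decay (\<lambda>r. \<Sum>i\<in>A. f i r)"
proof (cases "finite A")
  case True
  then show ?thesis using assms
  proof (induction A rule: finite_induct)
    case empty
    show ?case unfolding exp_decay_def by (auto intro!: exI[of _ 0] exI[of _ 1])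
  next
    case (insert i A)
    obtain K \<delta> where f: "0 \<le> K" "0 < \<delta>" "\<forall>r\<ge>0. norm (f i r) \<le> K * exp (- \<delta> * r)"
      by (rule exp_decayE[OF insert.prems[OF insertI1]])
    have "exp_decay (\<lambda>r. \<Sum>i\<in>A. f i r)" using insert by simp
    then obtain K' \<delta>' where s: "0 \<le> K'" "0 < \<delta>'" "\<forall>r\<ge>0. norm (\<Sum>i\<in>A. f i r) \<le> K' * exp (- \<delta>' * r)"
      by (rule exp_decayE)
    have "norm (\<Sum>i\<in>insert i A. f i r) \<le> (K + K') * exp (- min \<delta> \<delta>' * r)" if "0 \<le> r" for r
    proof -
      have "norm (\<Sum>i\<in>insert i A. f i r) \<le> norm (f i r) + norm (\<Sum>i\<in>A. f i r)"
        using insert.hyps by (simp add: norm_triangle_ineq)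
      also have "\<dots> \<le> K * exp (- \<delta> * r) + K' * exp (- \<delta>' * r)"
        using f(3) s(3) that by (intro add_mono) auto
      also have "\<dots> \<le> K * exp (- min \<delta> \<delta>' * r) + K' * exp (- min \<delta> \<delta>' * r)"
        using that f s by (intro add_mono mult_left_mono) (auto intro: mult_right_mono)
      finally show ?thesis by (simp add: distrib_right)
    qed
    then show ?case
      unfolding exp_decay_def using f s by (intro exI[of _ "K + K'"] exI[of _ "min \<delta> \<delta>'"]) auto
  qed
qed (auto simp: exp_decay_def intro!: exI[of _ 0] exI[of _ 1])

lemma exp_decay_cmult:
  fixes f :: "real \<Rightarrow> real"
  assumes "exp_decay f"
  shows "exp_decay (\<lambda>r. f r * c)"
proof -
  obtain K \<delta> where f: "0 \<le> K" "0 < \<delta>" "\<forall>r\<ge>0. norm (f r) \<le> K * exp (- \<delta> * r)"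
    using assms by (rule exp_decayE)
  have "norm (f r * c) \<le> (K * \<bar>c\<bar>) * exp (- \<delta> * r)" if "0 \<le> r" for r
    using mult_right_mono[OF f(3)[rule_format, OF that], of "\<bar>c\<bar>"] by (simp add: abs_mult mult_ac)
  then show ?thesis unfolding exp_decay_def using f(2) by blast
qed

text \<open>Variation of constants for the scalar equation \<open>x' = z x + y\<close>.\<close>

lemma exp_decay_egf_step:
  fixes \<alpha> :: "nat \<Rightarrow> complex"
  assumes \<alpha>: "geometric_growth \<alpha>" and z: "Re z < 0"
    and dec: "exp_decay (\<lambda>r. egf (\<lambda>m. \<alpha> (Suc m) - z * \<alpha> m) (of_real r))"
  shows "exp_decay (\<lambda>r. egf \<alpha> (of_real r))"
proof -
  obtain K \<delta> where K: "0 \<le> K" "0 < \<delta>"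
    and y: "\<forall>r\<ge>0. norm (egf (\<lambda>m. \<alpha> (Suc m) - z * \<alpha> m) (of_real r)) \<le> K * exp (- \<delta> * r)"
    using dec by (rule exp_decayE)
  \<comment> \<open>Half of \<open>- Re z\<close> keeps \<open>\<kappa>\<close> strictly positive.
    The full rate cannot be kept in general: for \<open>\<delta> = - Re z\<close> the solution may
    carry a factor \<open>r\<close>.\<close>
  define \<mu> where "\<mu> = min \<delta> (- Re z / 2)"
  have \<mu>: "0 < \<mu>" "\<mu> \<le> \<delta>" "0 < - Re z - \<mu>" using K z by (auto simp: \<mu>_def min_def)
  define \<kappa> where "\<kappa> = - Re z - \<mu>"
  \<comment> \<open>The integrating factor turns \<open>x' = z x + y\<close> into
    \<open>u' = exp (- z w) y\<close>.\<close>
  define u where "u w = exp (- z * w) * egf \<alpha> w" for w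
  have eq: "egf (\<lambda>m. \<alpha> (Suc m) - z * \<alpha> m) w = egf (\<lambda>m. \<alpha> (Suc m)) w - z * egf \<alpha> w" for w
  proof -
    have "(\<lambda>n. \<alpha> (Suc n) / fact n * w ^ n - z * (\<alpha> n / fact n * w ^ n)) sums (egf (\<lambda>m. \<alpha> (Suc m)) w - z * egf \<alpha> w)"
      unfolding egf_def
      by (intro sums_diff sums_mult summable_sums egf_summable geometric_growth_Suc \<alpha>)
    then show ?thesis
      unfolding egf_def[of "\<lambda>m. \<alpha> (Suc m) - z * \<alpha> m"]
      by (intro sums_unique[symmetric]) (simp add: algebra_simps diff_divide_distrib)
  qed
  have der: "(u has_field_derivative exp (- z * w) * egf (\<lambda>m. \<alpha> (Suc m) - z * \<alpha> m) w) (at w)" for w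
    unfolding u_def[abs_def] eq
    by (rule derivative_eq_intros DERIV_egf[OF \<alpha>] refl)+ (simp add: algebra_simps)
  have vder: "((\<lambda>r. u (of_real r)) has_vector_derivative
      exp (- z * of_real r) * egf (\<lambda>m. \<alpha> (Suc m) - z * \<alpha> m) (of_real r)) (at r within S)" for r S
    by (rule has_vector_derivative_real_field) (rule der)
  have phi: "((\<lambda>r. K / \<kappa> * exp (\<kappa> * r)) has_vector_derivative K * exp (\<kappa> * r)) (at r within S)" for r S
    using \<mu> by (auto intro!: derivative_eq_intros simp: has_real_derivative_iff_has_vector_derivative[symmetric] \<kappa>_def)
  have bound: "norm (egf \<alpha> (of_real r)) \<le> (norm (\<alpha> 0) + K / \<kappa>) * exp (- \<mu> * r)" if r: "0 < r" for r
  proof -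
    \<comment> \<open>The mean value inequality, with a primitive of
      \<open>K * exp (\<kappa> * r)\<close> as majorant, replaces the integral of the complex
      derivative.\<close>
    have "norm (u (of_real r) - u (of_real 0)) \<le> K / \<kappa> * exp (\<kappa> * r) - K / \<kappa> * exp (\<kappa> * 0)"
    proof (rule differentiable_bound_general[where f = "\<lambda>r. u (of_real r)" and \<phi> = "\<lambda>r. K / \<kappa> * exp (\<kappa> * r)"
          and f' = "\<lambda>r. exp (- z * of_real r) * egf (\<lambda>m. \<alpha> (Suc m) - z * \<alpha> m) (of_real r)"
          and \<phi>' = "\<lambda>r. K * exp (\<kappa> * r)", OF r])
      show "continuous_on {0..r} (\<lambda>r. u (of_real r))"
        by (rule continuous_on_vector_derivative) (rule vder)
      show "continuous_on {0..r} (\<lambda>r. K / \<kappa> * exp (\<kappa> * r))" by (intro continuous_intros)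
      fix x assume x: "0 < x" "x < r"
      show "norm (exp (- z * of_real x) * egf (\<lambda>m. \<alpha> (Suc m) - z * \<alpha> m) (of_real x)) \<le> K * exp (\<kappa> * x)"
      proof -
        have "norm (exp (- z * of_real x) * egf (\<lambda>m. \<alpha> (Suc m) - z * \<alpha> m) (of_real x))
            \<le> exp (- Re z * x) * (K * exp (- \<delta> * x))"
          using y x by (simp add: norm_mult)
        also have "\<dots> \<le> exp (- Re z * x) * (K * exp (- \<mu> * x))"
          using x \<mu> K by (intro mult_left_mono) auto
        also have "\<dots> = K * exp (\<kappa> * x)"
          by (simp add: \<kappa>_def exp_add[symmetric] exp_diff algebra_simps exp_minus divide_inverse)
        finally show ?thesis .
      qed
    qed (use vder phi in auto)
    moreover have "norm (u (of_real r)) \<le> norm (u (of_real 0)) + norm (u (of_real r) - u (of_real 0))"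
      by (rule norm_triangle_sub)
    moreover have "0 \<le> K / \<kappa>" using K \<mu> by (simp add: \<kappa>_def)
    moreover have "norm (u (of_real 0)) = norm (\<alpha> 0)" by (simp add: u_def egf_0)
    ultimately have "norm (u (of_real r)) \<le> norm (\<alpha> 0) + K / \<kappa> * exp (\<kappa> * r)" by simp
    moreover have "norm (egf \<alpha> (of_real r)) = exp (Re z * r) * norm (u (of_real r))"
    proof -
      have "norm (u (of_real r)) = exp (- (Re z * r)) * norm (egf \<alpha> (of_real r))"
        by (simp add: u_def norm_mult)
      then show ?thesis by (simp add: exp_minus)
    qed
    ultimately have "norm (egf \<alpha> (of_real r)) \<le> exp (Re z * r) * (norm (\<alpha> 0) + K / \<kappa> * exp (\<kappa> * r))"
      by (simp add: mult_left_mono)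
    also have "\<dots> = exp (Re z * r) * norm (\<alpha> 0) + K / \<kappa> * exp (- \<mu> * r)"
    proof -
      have "exp (Re z * r) * exp (\<kappa> * r) = exp (- \<mu> * r)"
        by (simp add: exp_add[symmetric] \<kappa>_def algebra_simps)
      then show ?thesis by (simp add: distrib_left mult.left_commute)
    qed
    also have "\<dots> \<le> exp (- \<mu> * r) * norm (\<alpha> 0) + K / \<kappa> * exp (- \<mu> * r)"
    proof -
      have "Re z * r \<le> - \<mu> * r" using r \<mu> by (intro mult_right_mono) auto
      then show ?thesis by (intro add_mono mult_right_mono) auto
    qed
    finally show ?thesis by (simp add: algebra_simps)
  qed
  have "norm (egf \<alpha> (of_real 0)) \<le> (norm (\<alpha> 0) + K / \<kappa>) * exp (- \<mu> * 0)"
    using K \<mu> by (simp add: egf_0 \<kappa>_def)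
  with bound have "norm (egf \<alpha> (of_real r)) \<le> (norm (\<alpha> 0) + K / \<kappa>) * exp (- \<mu> * r)" if "0 \<le> r" for r
    using that by (cases "r = 0") auto
  then show ?thesis unfolding exp_decay_def using \<mu>(1) by blast
qed

text \<open>\<open>shift_poly p\<close> is \<open>p(S)\<close> for the shift operator \<open>S\<close> on sequences.\<close>

definition shift_poly :: "complex poly \<Rightarrow> (nat \<Rightarrow> complex) \<Rightarrow> nat \<Rightarrow> complex" where
  "shift_poly p \<alpha> m = (\<Sum>i\<le>degree p. coeff p i * \<alpha> (m + i))"

lemma shift_poly_altdef:
  assumes "degree p \<le> N"
  shows "shift_poly p \<alpha> m = (\<Sum>i\<le>N. coeff p i * \<alpha> (m + i))"
  unfolding shift_poly_def
  by (rule sum.mono_neutral_left) (use assms in \<open>auto simp: coeff_eq_0\<close>)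

lemma shift_poly_pCons: "shift_poly (pCons c p) \<alpha> m = c * \<alpha> m + shift_poly p \<alpha> (Suc m)"
proof -
  have "shift_poly (pCons c p) \<alpha> m = (\<Sum>i\<le>Suc (degree p). coeff (pCons c p) i * \<alpha> (m + i))"
    by (rule shift_poly_altdef) (rule degree_pCons_le)
  then show ?thesis by (simp add: sum.atMost_Suc_shift shift_poly_def del: sum.atMost_Suc)
qed

lemma shift_poly_diff: "shift_poly (p - r) \<alpha> m = shift_poly p \<alpha> m - shift_poly r \<alpha> m"
proof -
  define N where "N = max (degree p) (degree r)"
  have "degree (p - r) \<le> N" "degree p \<le> N" "degree r \<le> N"
    by (auto simp: N_def degree_diff_le_max)
  then show ?thesis by (simp add: shift_poly_altdef left_diff_distrib sum_subtractf)
qed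

lemma shift_poly_smult: "shift_poly (smult c p) \<alpha> m = c * shift_poly p \<alpha> m"
  using shift_poly_altdef[OF degree_smult_le[of c p], of \<alpha> m] by (simp add: shift_poly_def sum_distrib_left mult.assoc)

lemma shift_poly_linear_factor:
  "shift_poly ([:- z, 1:] * r) \<alpha> m = shift_poly r \<alpha> (Suc m) - z * shift_poly r \<alpha> m"
  by (simp add: shift_poly_pCons shift_poly_diff shift_poly_smult)

lemma shift_poly_Suc_minus:
  "shift_poly r (\<lambda>m. \<alpha> (Suc m) - z * \<alpha> m) m = shift_poly r \<alpha> (Suc m) - z * shift_poly r \<alpha> m"
  by (simp add: shift_poly_def sum_subtractf sum_distrib_left algebra_simps)

lemma shift_poly_monom_mult: "shift_poly (monom 1 n * p) \<alpha> m = shift_poly p \<alpha> (m + n)"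
  by (induction n arbitrary: m) (simp_all add: monom_Suc shift_poly_pCons flip: one_poly_def)

lemma shift_poly_monom: "shift_poly (monom c n) \<alpha> m = c * \<alpha> (m + n)"
proof (induction n arbitrary: m)
  case 0
  show ?case by (simp add: monom_0 shift_poly_def)
qed (simp add: monom_Suc shift_poly_pCons)

text \<open>The vectors \<open>f 0, f 1, ...\<close> are infinitely many in a space of finite
  dimension \<open>card J\<close>, hence linearly dependent; the coefficients of a relation form
  \<open>p\<close>. The induction is Gaussian elimination of the coordinate
  \<open>j0\<close>.\<close>

lemma exists_annihilating_poly:
  fixes f :: "nat \<Rightarrow> 'j \<Rightarrow> complex"
  assumes "finite J"
  shows "\<exists>p. p \<noteq> 0 \<and> (\<forall>j\<in>J. shift_poly p (\<lambda>i. f i j) 0 = 0)"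
  using assms
proof (induction J arbitrary: f rule: finite_induct)
  case empty
  show ?case by (rule exI[of _ 1]) simp
next
  case (insert j0 J)
  show ?case
  proof (cases "\<forall>i. f i j0 = 0")
    case True
    obtain p where "p \<noteq> 0" "\<forall>j\<in>J. shift_poly p (\<lambda>i. f i j) 0 = 0" using insert.IH by blast
    with True show ?thesis by (intro exI[of _ p]) (auto simp: shift_poly_def)
  next
    case False
    then obtain i0 where i0: "f i0 j0 \<noteq> 0" by blast
    \<comment> \<open>\<open>f i0\<close> is the pivot. Only vectors after \<open>i0\<close> are
      reduced, so that a relation for \<open>g\<close> keeps its leading coefficient at an index
      beyond \<open>i0\<close> when it is rewritten for \<open>f\<close>; the multiples of the pivot
      collect in \<open>s\<close>.\<close>
    define \<rho> where "\<rho> i = f (i + Suc i0) j0 / f i0 j0" for i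
    define g where "g i j = f (i + Suc i0) j - \<rho> i * f i0 j" for i j
    obtain p where p: "p \<noteq> 0" "\<forall>j\<in>J. shift_poly p (\<lambda>i. g i j) 0 = 0" using insert.IH by blast
    have g0: "g i j0 = 0" for i using i0 by (simp add: g_def \<rho>_def)
    define s where "s = shift_poly p \<rho> 0"
    define p' where "p' = monom 1 (Suc i0) * p - monom s i0"
    have eq: "shift_poly p' (\<lambda>i. f i j) 0 = shift_poly p (\<lambda>i. g i j) 0" for j
    proof -
      have "shift_poly p' (\<lambda>i. f i j) 0 = shift_poly p (\<lambda>i. f i j) (Suc i0) - s * f i0 j"
        by (simp only: p'_def shift_poly_diff shift_poly_monom_mult shift_poly_monom add_0)
      also have "\<dots> = shift_poly p (\<lambda>i. g i j) 0"
        by (simp add: shift_poly_def s_def g_def sum_subtractf sum_distrib_left algebra_simps)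
      finally show ?thesis .
    qed
    have "coeff p' (degree p + Suc i0) = lead_coeff p"
      by (simp add: p'_def coeff_monom_mult)
    then have "p' \<noteq> 0" using p(1) by (metis coeff_0 leading_coeff_0_iff)
    moreover have "\<forall>j\<in>insert j0 J. shift_poly p' (\<lambda>i. f i j) 0 = 0"
      using p(2) unfolding eq by (auto simp: g0 shift_poly_def)
    ultimately show ?thesis by blast
  qed
qed

abbreviation cmatrix :: "real^'n^'m \<Rightarrow> complex^'n::finite^'m::finite" where
  "cmatrix \<equiv> map_matrix complex_of_real"

text \<open>Let \<open>z\<close> be a root of the annihilating polynomial \<open>p = (X - z) r\<close>. If \<open>r\<close> does not already
  annihilate \<open>a\<close>, then \<open>r(S) a\<close> is an eigenvector of the shift \<open>S\<close>, that is, a geometric sequence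
  starting in the kernel of \<open>Q(z)\<close>, so \<open>Re z < 0\<close>. The sequence \<open>(S - z) a\<close> is annihilated by \<open>r\<close>.\<close>

lemma exp_decay_recurrence_aux:
  fixes C :: "nat \<Rightarrow> real^'k::finite^'k" and a :: "nat \<Rightarrow> complex^'k"
  assumes stable: "\<And>z. det (Qpoly q C z) = 0 \<Longrightarrow> Re z < 0"
  assumes "p \<noteq> 0" "\<And>m \<kappa>. shift_poly p (\<lambda>m. a m $ \<kappa>) m = 0"
    and "\<And>m. (\<Sum>l\<le>q. cmatrix (C l) *v a (m + l)) = 0"
    and "\<And>\<kappa>. geometric_growth (\<lambda>m. a m $ \<kappa>)"
  shows "exp_decay (\<lambda>r. egf (\<lambda>m. a m $ \<kappa>) (of_real r))"
  using assms(2-)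
proof (induction "degree p" arbitrary: p a \<kappa> rule: less_induct)
  case less
  show ?case
  proof (cases "degree p = 0")
    case True
    then obtain c where c: "p = [:c:]" by (rule degree_eq_zeroE)
    then have "a m $ \<kappa> = 0" for m
      using less.prems(1) less.prems(2)[of \<kappa> m] by (auto simp: shift_poly_def)
    then show ?thesis unfolding exp_decay_def egf_def by (auto intro!: exI[of _ 0] exI[of _ 1])
  next
    case False
    then obtain z where "poly p z = 0"
      using fundamental_theorem_of_algebra[of p] by (auto simp: constant_degree)
    then obtain r where r: "p = [:- z, 1:] * r" by (auto simp: poly_eq_0_iff_dvd dvd_def)
    have r0: "r \<noteq> 0" using r less.prems(1) by auto
    have deg: "degree r < degree p" unfolding r using r0 by (subst degree_mult_eq) auto
    define b where "b m = (\<chi> \<kappa>. shift_poly r (\<lambda>m. a m $ \<kappa>) m)" for m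
    show ?thesis
    proof (cases "\<forall>m. b m = 0")
      case True
      then have "shift_poly r (\<lambda>m. a m $ \<kappa>) m = 0" for m \<kappa>
        by (simp add: b_def vec_eq_iff)
      then show ?thesis
        using less.hyps[OF deg r0 _ less.prems(3,4)] by blast
    next
      case False
      \<comment> \<open>By the choice of \<open>r\<close>,
        \<open>(S - z) r(S) a = p(S) a = 0\<close>.\<close>
      have bS: "b (Suc m) = z *s b m" for m
        using less.prems(2)[of _ m] unfolding r shift_poly_linear_factor
        by (simp add: b_def vec_eq_iff)
      define v where "v = b 0"
      have bm: "b m = z ^ m *s v" for m
        by (induction m) (simp_all add: bS vec_eq_iff mult.assoc, simp add: v_def)
      have v0: "v \<noteq> 0" using False bm by (metis vector_smult_rzero)
      \<comment> \<open>\<open>r(S)\<close> has scalar coefficients, so it commutes with the matrix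
        recurrence; the calculation only exchanges sums.\<close>
      have rec_b: "(\<Sum>l\<le>q. cmatrix (C l) *v b (0 + l)) = 0"
      proof -
        have "(\<Sum>l\<le>q. cmatrix (C l) *v b (0 + l)) $ i = 0" for i
        proof -
          have "(\<Sum>l\<le>q. cmatrix (C l) *v b (0 + l)) $ i
              = (\<Sum>l\<le>q. \<Sum>\<kappa>\<in>UNIV. of_real (C l $ i $ \<kappa>) * (\<Sum>d\<le>degree r. coeff r d * a (l + d) $ \<kappa>))"
            by (simp add: matrix_vector_mult_def b_def shift_poly_def)
          also have "\<dots> = (\<Sum>l\<le>q. \<Sum>\<kappa>\<in>UNIV. \<Sum>d\<le>degree r. coeff r d * (of_real (C l $ i $ \<kappa>) * a (d + l) $ \<kappa>))"
            by (simp add: sum_distrib_left mult_ac add.commute)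
          also have "\<dots> = (\<Sum>l\<le>q. \<Sum>d\<le>degree r. \<Sum>\<kappa>\<in>UNIV. coeff r d * (of_real (C l $ i $ \<kappa>) * a (d + l) $ \<kappa>))"
            by (intro sum.cong refl sum.swap)
          also have "\<dots> = (\<Sum>d\<le>degree r. \<Sum>l\<le>q. \<Sum>\<kappa>\<in>UNIV. coeff r d * (of_real (C l $ i $ \<kappa>) * a (d + l) $ \<kappa>))"
            by (rule sum.swap)
          also have "\<dots> = (\<Sum>d\<le>degree r. coeff r d * (\<Sum>l\<le>q. cmatrix (C l) *v a (d + l)) $ i)"
            by (simp add: matrix_vector_mult_def sum_distrib_left)
          finally show ?thesis using less.prems(3) by simp
        qed
        then show ?thesis by (simp add: vec_eq_iff)
      qed
      have "Qpoly q C z *v v = (\<Sum>l\<le>q. cmatrix (C l) *v b (0 + l))"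
        unfolding Qpoly_def
        by (simp add: vec_eq_iff matrix_vector_mult_def bm sum_distrib_right sum_distrib_left sum.swap[of _ UNIV] mult_ac)
      then have "Qpoly q C z *v v = 0" using rec_b by simp
      then have "det (Qpoly q C z) = 0"
        using v0 by (metis invertible_det_nz invertible_left_inverse matrix_left_invertible_ker)
      then have z: "Re z < 0" by (rule stable)
      \<comment> \<open>\<open>c = (S - z) a\<close> satisfies the same recurrence and decays by
        induction. Its generating function is the input \<open>y\<close> of the equation
        \<open>x' = z x + y\<close> for that of \<open>a\<close>.\<close>
      define c where "c m = a (Suc m) - z *s a m" for m
      have c\<kappa>: "(\<lambda>m. c m $ \<kappa>) = (\<lambda>m. a (Suc m) $ \<kappa> - z * a m $ \<kappa>)" for \<kappa>
        by (simp add: c_def)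
      have "exp_decay (\<lambda>r. egf (\<lambda>m. c m $ \<kappa>) (of_real r))"
      proof (rule less.hyps[OF deg r0])
        show "shift_poly r (\<lambda>m. c m $ \<kappa>) m = 0" for m \<kappa>
          using bS[of m] unfolding c\<kappa> shift_poly_Suc_minus[where \<alpha> = "\<lambda>m. a m $ \<kappa>"] by (simp add: b_def vec_eq_iff)
        have "(\<Sum>l\<le>q. cmatrix (C l) *v c (m + l))
            = (\<Sum>l\<le>q. cmatrix (C l) *v a (Suc m + l)) - z *s (\<Sum>l\<le>q. cmatrix (C l) *v a (m + l))" for m
          unfolding vec_eq_iff c_def matrix_vector_mult_def
          by (simp add: sum_subtractf sum_distrib_left algebra_simps)
        then show "(\<Sum>l\<le>q. cmatrix (C l) *v c (m + l)) = 0" for m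
          using less.prems(3)[of m] less.prems(3)[of "Suc m"] by simp
        show "geometric_growth (\<lambda>m. c m $ \<kappa>)" for \<kappa>
          unfolding c\<kappa> by (rule geometric_growth_Suc_minus) (rule less.prems(4))
      qed
      then show ?thesis
        unfolding c\<kappa> by (rule exp_decay_egf_step[OF less.prems(4) z])
    qed
  qed
qed

text \<open>Windows of \<open>q\<close> consecutive terms live in finite dimension, so a polynomial
  relation between them makes \<open>p(S) a\<close> vanish at the first \<open>q\<close> indices. As
  \<open>p(S) a\<close> obeys the same recurrence, it vanishes everywhere. Multiplication by
  \<open>C q\<close> brings the recurrence into the form \<open>Q(S) a = 0\<close>.\<close>

lemma exp_decay_recurrence:
  fixes C R :: "nat \<Rightarrow> real^'k::finite^'k" and a :: "nat \<Rightarrow> complex^'k"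
  assumes stable: "\<And>z. det (Qpoly q C z) = 0 \<Longrightarrow> Re z < 0"
    and R: "\<And>l. l < q \<Longrightarrow> C q ** R l = - C l"
    and rec: "\<And>m. a (m + q) = (\<Sum>l<q. cmatrix (R l) *v a (m + l))"
    and growth: "\<And>\<kappa>. geometric_growth (\<lambda>m. a m $ \<kappa>)"
  shows "exp_decay (\<lambda>r. egf (\<lambda>m. a m $ \<kappa>) (of_real r))"
proof -
  obtain p where p: "p \<noteq> 0" "\<forall>j\<in>{..<q} \<times> UNIV. shift_poly p (\<lambda>i. a (i + fst j) $ snd j) 0 = 0"
    using exists_annihilating_poly[of "{..<q} \<times> UNIV" "\<lambda>i j. a (i + fst j) $ snd j"] by auto
  have small: "shift_poly p (\<lambda>m. a m $ \<kappa>) m = 0" if "m < q" for m \<kappa>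
    using p(2)[rule_format, of "(m, \<kappa>)"] that by (simp add: shift_poly_def add.commute)
  have ann: "shift_poly p (\<lambda>m. a m $ \<kappa>) m = 0" for m \<kappa>
  proof (induction m arbitrary: \<kappa> rule: less_induct)
    case (less m)
    show ?case
    proof (cases "m < q")
      case False
      then obtain n where n: "m = n + q" by (metis le_add_diff_inverse2 not_less)
      have "shift_poly p (\<lambda>m. a m $ \<kappa>) m = (\<Sum>d\<le>degree p. coeff p d * a ((n + d) + q) $ \<kappa>)"
        by (simp add: shift_poly_def n add_ac)
      also have "\<dots> = (\<Sum>d\<le>degree p. \<Sum>l<q. \<Sum>i\<in>UNIV. of_real (R l $ \<kappa> $ i) * (coeff p d * a (n + l + d) $ i))"
        unfolding rec by (simp add: matrix_vector_mult_def sum_distrib_left mult_ac add_ac)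
      also have "\<dots> = (\<Sum>l<q. \<Sum>d\<le>degree p. \<Sum>i\<in>UNIV. of_real (R l $ \<kappa> $ i) * (coeff p d * a (n + l + d) $ i))"
        by (rule sum.swap)
      also have "\<dots> = (\<Sum>l<q. \<Sum>i\<in>UNIV. \<Sum>d\<le>degree p. of_real (R l $ \<kappa> $ i) * (coeff p d * a (n + l + d) $ i))"
        by (intro sum.cong refl sum.swap)
      also have "\<dots> = (\<Sum>l<q. \<Sum>i\<in>UNIV. of_real (R l $ \<kappa> $ i) * shift_poly p (\<lambda>m. a m $ i) (n + l))"
        by (simp add: shift_poly_def sum_distrib_left)
      also have "\<dots> = 0"
        using less.IH by (simp add: n)
      finally show ?thesis .
    qed (rule small)
  qed
  have cmul: "cmatrix (A ** B) = cmatrix A ** cmatrix B" for A B :: "real^'k^'k"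
    by (simp add: vec_eq_iff matrix_matrix_mult_def)
  have "(\<Sum>l\<le>q. cmatrix (C l) *v a (m + l)) = 0" for m
  proof -
    have "(\<Sum>l\<le>q. cmatrix (C l) *v a (m + l))
        = (\<Sum>l<q. cmatrix (C l) *v a (m + l)) + cmatrix (C q) *v (\<Sum>l<q. cmatrix (R l) *v a (m + l))"
    proof -
      have "{..q} = insert q {..<q}" by auto
      then show ?thesis by (simp add: rec add.commute)
    qed
    also have "cmatrix (C q) *v (\<Sum>l<q. cmatrix (R l) *v a (m + l)) = (\<Sum>l<q. cmatrix (C q ** R l) *v a (m + l))"
      by (simp add: cmul matrix_vector_mul_assoc[symmetric] vec.linear_sum[OF matrix_vector_mul_linear_gen])
    also have "\<dots> = (\<Sum>l<q. - (cmatrix (C l) *v a (m + l)))"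
      by (intro sum.cong refl) (simp add: R vec_eq_iff matrix_vector_mult_def sum_negf)
    finally show ?thesis by (simp add: sum_negf)
  qed
  from exp_decay_recurrence_aux[OF stable p(1) ann this growth] show ?thesis by simp
qed

section \<open>Exponentials of block companion matrices\<close>

lemma block_power_growth:
  fixes M :: "'k::finite blocks"
  assumes "i < n"
  shows "geometric_growth (\<lambda>m. block_power n M m i j $ a $ b)"
proof -
  \<comment> \<open>The sum of all absolute entries bounds every row sum, hence serves as geometric
    rate for the entries of the powers.\<close>
  define B where "B = (\<Sum>i<n. \<Sum>a\<in>UNIV. \<Sum>l<n. \<Sum>x\<in>UNIV. \<bar>M i l $ a $ x\<bar>)"
  have B0: "0 \<le> B" unfolding B_def by (intro sum_nonneg) auto
  have row: "(\<Sum>l<n. \<Sum>x\<in>UNIV. \<bar>M i l $ a $ x\<bar>) \<le> B" if "i < n" for i a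
  proof -
    have "(\<Sum>l<n. \<Sum>x\<in>UNIV. \<bar>M i l $ a $ x\<bar>) \<le> (\<Sum>a\<in>UNIV. \<Sum>l<n. \<Sum>x\<in>UNIV. \<bar>M i l $ a $ x\<bar>)"
      by (rule member_le_sum) (auto intro: sum_nonneg)
    also have "\<dots> \<le> B"
      unfolding B_def by (rule member_le_sum[where f = "\<lambda>i. \<Sum>a\<in>UNIV. \<Sum>l<n. \<Sum>x\<in>UNIV. \<bar>M i l $ a $ x\<bar>"])
        (use that in \<open>auto intro!: sum_nonneg\<close>)
    finally show ?thesis .
  qed
  have "\<bar>block_power n M m i j $ a $ b\<bar> \<le> B ^ m" if "i < n" for m i a
    using that
  proof (induction m arbitrary: i a)
    case 0
    show ?case by (simp add: block_one_def mat_def)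
  next
    case (Suc m)
    have "block_power n M (Suc m) i j $ a $ b = (\<Sum>l<n. \<Sum>x\<in>UNIV. M i l $ a $ x * block_power n M m l j $ x $ b)"
      by (simp add: block_mult_def matrix_matrix_mult_def)
    also have "\<bar>\<dots>\<bar> \<le> (\<Sum>l<n. \<Sum>x\<in>UNIV. \<bar>M i l $ a $ x\<bar> * B ^ m)"
      by (intro order_trans[OF sum_abs] sum_mono)
        (auto simp: abs_mult intro!: mult_left_mono Suc.IH)
    also have "\<dots> = (\<Sum>l<n. \<Sum>x\<in>UNIV. \<bar>M i l $ a $ x\<bar>) * B ^ m"
      by (simp add: sum_distrib_right)
    also have "\<dots> \<le> B * B ^ m"
      using row[OF Suc.prems] B0 by (intro mult_right_mono) auto
    finally show ?case by simp
  qed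
  from this[OF assms] show ?thesis
    unfolding geometric_growth_def real_norm_def by (metis mult_1)
qed

lemma block_power_scale:
  fixes M :: "'k::finite blocks"
  shows "block_power n (block_scale t M) m i j = t ^ m *\<^sub>R block_power n M m i j"
proof (induction m arbitrary: i j)
  case (Suc m)
  have "(c *\<^sub>R U) ** (d *\<^sub>R V) = (c * d) *\<^sub>R (U ** V)" for c d and U V :: "real^'k^'k"
    by (simp add: vec_eq_iff matrix_matrix_mult_def sum_distrib_left mult_ac)
  then show ?case
    by (simp add: block_mult_def Suc) (simp add: block_scale_def scaleR_sum_right)
qed simp

lemma vec_vec_sumsI:
  fixes f :: "nat \<Rightarrow> real^'n^'m"
  assumes "\<And>a b. (\<lambda>m. f m $ a $ b) sums (s $ a $ b)"
  shows "f sums s"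
  using assms unfolding sums_def by (intro vec_tendstoI) simp

text \<open>Convergence of the matrix series has to be shown; entry by entry it is a generating
  function of powers, so derivatives and decay become statements about scalar sequences.\<close>

lemma block_exp_nth:
  fixes M :: "'k::finite blocks"
  assumes "i < n"
  shows "block_exp n (block_scale t M) i j $ a $ b = egf (\<lambda>m. block_power n M m i j $ a $ b) t"
proof -
  have "(\<lambda>m. (1 / fact m) *\<^sub>R block_power n (block_scale t M) m i j)
      sums (\<chi> a b. egf (\<lambda>m. block_power n M m i j $ a $ b) t)"
  proof (rule vec_vec_sumsI)
    show "(\<lambda>m. ((1 / fact m) *\<^sub>R block_power n (block_scale t M) m i j) $ a $ b)
      sums ((\<chi> a b. egf (\<lambda>m. block_power n M m i j $ a $ b) t) $ a $ b)" for a b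
      using summable_sums[OF egf_summable[OF block_power_growth[OF assms, of M j a b], of t]]
      by (simp add: egf_def block_power_scale mult_ac)
  qed
  from sums_unique[OF this, symmetric] show ?thesis by (simp add: block_exp_def)
qed

lemma block_exp_0: "i < n \<Longrightarrow> block_exp n (block_scale 0 M) i j = block_one i j"
  by (simp add: vec_eq_iff block_exp_nth egf_0)

lemma DERIV_block_exp:
  fixes M :: "'k::finite blocks"
  assumes "i < n"
  shows "((\<lambda>t. block_exp n (block_scale t M) i j $ a $ b) has_real_derivative
    egf (\<lambda>m. block_power n M (Suc m) i j $ a $ b) t) (at t)"
  unfolding block_exp_nth[OF assms] by (rule DERIV_egf) (rule block_power_growth[OF assms])

lemma continuous_on_vec_vecI:
  fixes f :: "'a::topological_space \<Rightarrow> real^'n^'m"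
  assumes "\<And>a b. continuous_on S (\<lambda>x. f x $ a $ b)"
  shows "continuous_on S f"
  using assms unfolding continuous_on_def by (intro ballI vec_tendstoI) simp

lemma continuous_on_block_exp:
  "i < n \<Longrightarrow> continuous_on S (\<lambda>t. block_exp n (block_scale t M) i j)"
  by (intro continuous_on_vec_vecI continuous_at_imp_continuous_on ballI DERIV_isCont[OF DERIV_block_exp])

lemma matrix_mult_sum_right: "U ** (\<Sum>l\<in>I. f l) = (\<Sum>l\<in>I. U ** f l)"
  for U :: "real^'k::finite^'k" and f :: "_ \<Rightarrow> real^'k^'k"
  by (induction I rule: infinite_finite_induct) (simp_all add: matrix_add_ldistrib)

lemma matrix_mult_add_left: "(U + V) ** W = U ** W + V ** W" for U V W :: "real^'k::finite^'k"
  by (simp add: vec_eq_iff matrix_matrix_mult_def distrib_right sum.distrib)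

lemma matrix_mult_sum_left: "(\<Sum>l\<in>I. f l) ** U = (\<Sum>l\<in>I. f l ** U)"
  for U :: "real^'k::finite^'k" and f :: "_ \<Rightarrow> real^'k^'k"
  by (induction I rule: infinite_finite_induct) (simp_all add: matrix_mult_add_left)

text \<open>Powers are defined by multiplication from the left. Multiplication from the right yields
  \<open>E' = E \<Lambda>\<close>, which closes on a single block row of the exponential.\<close>

lemma block_power_Suc_right:
  fixes M :: "'k::finite blocks"
  assumes "i < n" "j < n"
  shows "block_power n M (Suc m) i j = (\<Sum>l<n. block_power n M m i l ** M l j)"
  using assms(1)
proof (induction m arbitrary: i)
  case 0
  have "M i l ** block_one l j = (if l = j then M i j else 0)" for l by (simp add: block_one_def)
  moreover have "block_one i l ** M l j = (if l = i then M i j else 0)" for l by (simp add: block_one_def)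
  ultimately show ?case using 0 assms(2) by (simp add: block_mult_def)
next
  case (Suc m)
  have "block_power n M (Suc (Suc m)) i j = (\<Sum>l<n. M i l ** block_power n M (Suc m) l j)"
    by (simp only: block_power.simps block_mult_def)
  also have "\<dots> = (\<Sum>l<n. \<Sum>x<n. M i l ** block_power n M m l x ** M x j)"
    using Suc.IH by (simp add: matrix_mult_sum_right matrix_mul_assoc del: block_power.simps)
  also have "\<dots> = (\<Sum>x<n. \<Sum>l<n. M i l ** block_power n M m l x ** M x j)" by (rule sum.swap)
  also have "\<dots> = (\<Sum>x<n. block_power n M (Suc m) i x ** M x j)"
    by (simp add: matrix_mult_sum_left block_mult_def)
  finally show ?case .
qed

section \<open>Companion matrices\<close>

lemma companion_power_Suc:
  fixes R :: "nat \<Rightarrow> real^'k::finite^'k"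
  assumes "i < n"
  shows "block_power n (companion n R) (Suc m) i j
    = (if Suc i = n then \<Sum>l<n. R l ** block_power n (companion n R) m l j else block_power n (companion n R) m (Suc i) j)"
proof (cases "Suc i = n")
  case False
  have "companion n R i l ** block_power n (companion n R) m l j
      = (if l = Suc i then block_power n (companion n R) m (Suc i) j else 0)" for l
    using False by (simp add: companion_def)
  then show ?thesis using False assms by (simp add: block_mult_def)
qed (simp add: block_mult_def companion_def)

text \<open>Above the last block row, multiplication by a companion matrix only moves rows up by
  one. Hence the row 0 of all powers contains every other row.\<close>

lemma companion_power_shift:
  assumes "i < n"
  shows "block_power n (companion n R) m i j = block_power n (companion n R) (m + i) 0 j"
  using assms
proof (induction i arbitrary: m)
  case (Suc i)
  then show ?case
    using companion_power_Suc[of i n R m j] by (simp del: block_power.simps)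
qed simp

lemma DERIV_block_exp_companion_left:
  assumes "Suc i < n"
  shows "((\<lambda>t. block_exp n (block_scale t (companion n R)) i j $ a $ b) has_real_derivative
    block_exp n (block_scale t (companion n R)) (Suc i) j $ a $ b) (at t)"
  using DERIV_block_exp[of i n "companion n R" j a b t] assms
  by (simp add: companion_power_Suc block_exp_nth del: block_power.simps)

text \<open>The equation \<open>E' = E M\<close> in block column \<open>j\<close>, where
  \<open>M\<close> has the identity in row \<open>j - 1\<close> and \<open>R j\<close> in the last
  row \<open>n\<close>. Column 0 has no identity block; the case split also guards against truncated
  subtraction.\<close>

lemma DERIV_block_exp_companion_right:
  fixes R :: "nat \<Rightarrow> real^'k::finite^'k"
  assumes "i < Suc n" "j < Suc n"
  defines "E \<equiv> \<lambda>t. block_exp (Suc n) (block_scale t (companion (Suc n) R)) i"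
  shows "((\<lambda>t. E t j $ a $ b) has_real_derivative
    ((if j = 0 then 0 else E t (j - 1)) + E t n ** R j) $ a $ b) (at t)"
proof -
  let ?P = "block_power (Suc n) (companion (Suc n) R)"
  have g: "geometric_growth (\<lambda>m. ?P m i l $ a $ x)" for l a x
    by (rule block_power_growth) (rule assms)
  have "?P (Suc m) i j = (if j = 0 then 0 else ?P m i (j - 1)) + ?P m i n ** R j" for m
  proof -
    have "?P (Suc m) i j = (\<Sum>l<n. ?P m i l ** companion (Suc n) R l j) + ?P m i n ** R j"
      unfolding block_power_Suc_right[OF assms(1,2)] by (simp add: companion_def)
    also have "(\<Sum>l<n. ?P m i l ** companion (Suc n) R l j) = (\<Sum>l<n. if l = j - 1 \<and> j \<noteq> 0 then ?P m i (j - 1) else 0)"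
      by (rule sum.cong) (auto simp: companion_def)
    also have "\<dots> = (if j = 0 then 0 else ?P m i (j - 1))"
      using assms(2) by (cases j) auto
    finally show ?thesis .
  qed
  then have eq: "?P (Suc m) i j $ a $ b = (if j = 0 then 0 else ?P m i (j - 1) $ a $ b)
      + (\<Sum>x\<in>UNIV. ?P m i n $ a $ x * R j $ x $ b)" for m
    by (simp add: matrix_matrix_mult_def del: block_power.simps)
  have "(\<lambda>m. (if j = 0 then 0 else ?P m i (j - 1) $ a $ b / fact m * t ^ m)
        + (\<Sum>x\<in>UNIV. ?P m i n $ a $ x / fact m * t ^ m * R j $ x $ b))
      sums ((if j = 0 then 0 else E t (j - 1) $ a $ b) + (\<Sum>x\<in>UNIV. E t n $ a $ x * R j $ x $ b))"
  proof (rule sums_add)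
    show "(\<lambda>m. if j = 0 then 0 else ?P m i (j - 1) $ a $ b / fact m * t ^ m) sums (if j = 0 then 0 else E t (j - 1) $ a $ b)"
      unfolding E_def block_exp_nth[OF assms(1)] egf_def
      by (cases "j = 0") (simp, simp only: if_False, rule summable_sums[OF egf_summable[OF g]])
    show "(\<lambda>m. \<Sum>x\<in>UNIV. ?P m i n $ a $ x / fact m * t ^ m * R j $ x $ b) sums (\<Sum>x\<in>UNIV. E t n $ a $ x * R j $ x $ b)"
      unfolding E_def block_exp_nth[OF assms(1)] egf_def
      by (intro sums_sum sums_mult2 summable_sums egf_summable[OF g])
  qed
  moreover have "(\<lambda>m. (if j = 0 then 0 else ?P m i (j - 1) $ a $ b / fact m * t ^ m)
        + (\<Sum>x\<in>UNIV. ?P m i n $ a $ x / fact m * t ^ m * R j $ x $ b))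
      = (\<lambda>m. ?P (Suc m) i j $ a $ b / fact m * t ^ m)"
    unfolding eq
    by (rule ext, cases "j = 0")
      (simp_all add: add_divide_distrib sum_divide_distrib distrib_right distrib_left sum_distrib_right sum_distrib_left mult_ac)
  ultimately have "egf (\<lambda>m. ?P (Suc m) i j $ a $ b) t
      = (if j = 0 then 0 else E t (j - 1) $ a $ b) + (\<Sum>x\<in>UNIV. E t n $ a $ x * R j $ x $ b)"
    unfolding egf_def by (simp only: sums_unique[symmetric])
  then show ?thesis
    using DERIV_block_exp[OF assms(1), of "companion (Suc n) R" j a b t] unfolding E_def
    by (auto simp: matrix_matrix_mult_def simp del: block_power.simps)
qed

text \<open>Each column of a block of the powers is a vector sequence that obeys a recurrence of
  order \<open>q\<close> with coefficients \<open>R l\<close>, so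
  \<open>exp_decay_recurrence\<close> applies.\<close>

lemma exp_decay_block_exp_bigLambda:
  fixes C :: "nat \<Rightarrow> real^'k::finite^'k"
  assumes stable: "\<And>z. det (Qpoly q C z) = 0 \<Longrightarrow> Re z < 0"
    and inv: "C q ** matrix_inv (C q) = mat 1" and i: "i < q"
  shows "exp_decay (\<lambda>r. block_exp q (block_scale r (bigLambda q C)) i j $ a $ b)"
proof -
  define R where "R l = - (matrix_inv (C q) ** C l)" for l
  have L: "bigLambda q C = companion q R" by (simp add: bigLambda_def R_def[abs_def])
  let ?P = "block_power q (companion q R)"
  \<comment> \<open>Row 0 read from power \<open>i\<close> on is row \<open>i\<close>; this form
    exposes the recurrence in \<open>m\<close>.\<close>
  define x where "x m = (\<chi> \<kappa>. complex_of_real (?P (m + i) 0 j $ \<kappa> $ b))" for m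
  have q0: "0 < q" using i by simp
  have row: "?P (m + i) 0 j = ?P m i j" for m by (rule companion_power_shift[OF i, symmetric])
  have "exp_decay (\<lambda>r. egf (\<lambda>m. x m $ a) (of_real r))"
  proof (rule exp_decay_recurrence[OF stable])
    fix l
    have "C q ** (matrix_inv (C q) ** C l) = C l" by (simp add: matrix_mul_assoc inv)
    moreover have "C q ** (- U) = - (C q ** U)" for U :: "real^'k^'k"
      by (simp add: vec_eq_iff matrix_matrix_mult_def sum_negf)
    ultimately show "C q ** R l = - C l" by (simp add: R_def)
  next
    fix m
    have "?P (m + q + i) 0 j = ?P (Suc (m + i)) (q - 1) j"
      using companion_power_shift[of "q - 1" q R "Suc (m + i)" j] q0 by (simp add: add_ac del: block_power.simps)
    also have "\<dots> = (\<Sum>l<q. R l ** ?P (m + i) l j)"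
      using q0 by (subst companion_power_Suc) auto
    also have "\<dots> = (\<Sum>l<q. R l ** ?P (m + l + i) 0 j)"
      by (intro sum.cong refl) (subst companion_power_shift, auto simp: add_ac)
    finally show "x (m + q) = (\<Sum>l<q. cmatrix (R l) *v x (m + l))"
      by (simp add: x_def vec_eq_iff matrix_vector_mult_def matrix_matrix_mult_def del: block_power.simps)
  next
    show "geometric_growth (\<lambda>m. x m $ \<kappa>)" for \<kappa>
      using block_power_growth[OF i, of "companion q R" j \<kappa> b]
      by (simp add: x_def row geometric_growth_def)
  qed
  moreover have "egf (\<lambda>m. x m $ a) (of_real r) = of_real (block_exp q (block_scale r (bigLambda q C)) i j $ a $ b)" for r
  proof -
    have "(\<lambda>m. ?P m i j $ a $ b / fact m * r ^ m) sums (block_exp q (block_scale r (bigLambda q C)) i j $ a $ b)"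
      unfolding L block_exp_nth[OF i] egf_def by (intro summable_sums egf_summable block_power_growth i)
    from sums_of_real[OF this, where 'a = complex] show ?thesis
      unfolding egf_def x_def row by (intro sums_unique[symmetric]) simp
  qed
  ultimately show ?thesis unfolding exp_decay_def by simp
qed

text \<open>In place of uniqueness for linear systems: the integrand is the derivative in
  \<open>u\<close> of the sum \<open>\<phi>\<close> of the products
  \<open>E_j(t - u) G_j(u - v)\<close>, so the integral is a difference of boundary values.\<close>

lemma block_exp_convolution:
  fixes A C :: "nat \<Rightarrow> real^'k::finite^'k"
  assumes q: "0 < q" "q < p" and i: "i < q" and inv: "matrix_inv (C q) ** C q = mat 1" and vt: "v \<le> t"
  defines "E \<equiv> \<lambda>r. block_exp q (block_scale r (bigLambda q C)) i"
    and "G \<equiv> \<lambda>r l. block_exp p (block_scale r (bigA p A)) l (p - 1)"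
  shows "(\<integral>u. indicator {v..t} u *\<^sub>R ((E (t - u) (q - 1) ** matrix_inv (C q)) ** (\<Sum>l\<le>q. C l ** G (u - v) l)) $ a $ b \<partial>lborel)
    = G (t - v) i $ a $ b"
proof -
  define R where "R l = - (matrix_inv (C q) ** C l)" for l
  obtain n where n: "q = Suc n" using q by (cases q) auto
  have dE: "((\<lambda>t. E t j $ a $ b) has_real_derivative
      ((if j = 0 then 0 else E t (j - 1)) + E t n ** R j) $ a $ b) (at t)" if "j < Suc n" for j t a b
    using DERIV_block_exp_companion_right[of i n j R a b t] i that unfolding E_def bigLambda_def R_def[abs_def] n by simp
  have dG: "((\<lambda>t. G t j $ a $ b) has_real_derivative G t (Suc j) $ a $ b) (at t)" if "j < Suc n" for j t a b
    unfolding G_def bigA_def by (rule DERIV_block_exp_companion_left) (use that q n in auto)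
  define \<phi> where "\<phi> u = (\<Sum>j<Suc n. \<Sum>x\<in>UNIV. E (t - u) j $ a $ x * G (u - v) j $ x $ b)" for u
  define \<psi> where "\<psi> u = ((E (t - u) n ** matrix_inv (C q)) ** (\<Sum>l\<le>q. C l ** G (u - v) l)) $ a $ b" for u
  have d: "(\<phi> has_real_derivative \<psi> u) (at u)" for u
  proof -
    let ?E = "E (t - u)" and ?G = "G (u - v)"
    have "(\<phi> has_real_derivative (\<Sum>j<Suc n. \<Sum>x\<in>UNIV.
        - (((if j = 0 then 0 else ?E (j - 1)) + ?E n ** R j) $ a $ x) * ?G j $ x $ b + ?G (Suc j) $ x $ b * ?E j $ a $ x)) (at u)"
    proof -
      have e: "((\<lambda>u. E (t - u) j $ a $ x) has_real_derivative - (((if j = 0 then 0 else ?E (j - 1)) + ?E n ** R j) $ a $ x)) (at u)"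
        if "j < Suc n" for j x
      proof -
        have "((\<lambda>u. t - u) has_real_derivative - 1) (at u)" by (auto intro!: derivative_eq_intros)
        from DERIV_chain2[where f = "\<lambda>t. E t j $ a $ x" and g = "\<lambda>u. t - u", OF dE[OF that] this]
        show ?thesis by (simp only: mult_minus1_right)
      qed
      have g: "((\<lambda>u. G (u - v) j $ x $ b) has_real_derivative ?G (Suc j) $ x $ b) (at u)" if "j < Suc n" for j x
      proof -
        have "((\<lambda>u. u - v) has_real_derivative 1) (at u)" by (auto intro!: derivative_eq_intros)
        from DERIV_chain2[where f = "\<lambda>t. G t j $ x $ b" and g = "\<lambda>u. u - v", OF dG[OF that] this]
        show ?thesis by (simp only: mult_1_right)
      qed
      show ?thesis
        unfolding \<phi>_def[abs_def] by (intro DERIV_sum DERIV_mult e g) auto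
    qed
    also have "(\<Sum>j<Suc n. \<Sum>x\<in>UNIV.
        - (((if j = 0 then 0 else ?E (j - 1)) + ?E n ** R j) $ a $ x) * ?G j $ x $ b + ?G (Suc j) $ x $ b * ?E j $ a $ x)
      = ((\<Sum>j<Suc n. ?E j ** ?G (Suc j)) - (\<Sum>j<Suc n. ((if j = 0 then 0 else ?E (j - 1)) + ?E n ** R j) ** ?G j)) $ a $ b"
    proof -
      have "(\<Sum>x\<in>UNIV. - (X $ a $ x) * Y $ x $ b + Z $ x $ b * W $ a $ x) = (W ** Z - X ** Y) $ a $ b"
        for X Y Z W :: "real^'k^'k"
        by (simp add: matrix_matrix_mult_def sum.distrib sum_negf sum_subtractf mult.commute)
      then show ?thesis by (simp only: vector_minus_component sum_component sum_subtractf)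
    qed
    \<comment> \<open>The identity blocks of \<open>\<Lambda>\<close> reproduce the products of
      \<open>E_j\<close> with \<open>G_(j+1)\<close> after a shift of the index; they cancel all of
      the first sum except its last term, which contains \<open>G_q\<close>.\<close>
    also have "(\<Sum>j<Suc n. ((if j = 0 then 0 else ?E (j - 1)) + ?E n ** R j) ** ?G j)
        = (\<Sum>j<n. ?E j ** ?G (Suc j)) + (\<Sum>j<Suc n. ?E n ** R j ** ?G j)"
    proof -
      have "(\<Sum>j<Suc n. ((if j = 0 then 0 else ?E (j - 1)) + ?E n ** R j) ** ?G j)
          = (\<Sum>j<Suc n. (if j = 0 then 0 else ?E (j - 1)) ** ?G j) + (\<Sum>j<Suc n. ?E n ** R j ** ?G j)"
        by (simp only: matrix_mult_add_left sum.distrib)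
      also have "(\<Sum>j<Suc n. (if j = 0 then 0 else ?E (j - 1)) ** ?G j) = (\<Sum>j<n. ?E j ** ?G (Suc j))"
        by (subst sum.lessThan_Suc_shift) simp
      finally show ?thesis .
    qed
    also have "(\<Sum>j<Suc n. ?E j ** ?G (Suc j)) - ((\<Sum>j<n. ?E j ** ?G (Suc j)) + (\<Sum>j<Suc n. ?E n ** R j ** ?G j))
        = ?E n ** ?G q - (\<Sum>j<Suc n. ?E n ** R j ** ?G j)"
      by (simp add: n)
    also have "(\<Sum>j<Suc n. ?E n ** R j ** ?G j) = - (\<Sum>j<Suc n. (?E n ** matrix_inv (C q)) ** (C j ** ?G j))"
    proof -
      have "U ** (- V) ** W = - (U ** V ** W)" for U V W :: "real^'k^'k"
        by (simp add: vec_eq_iff matrix_matrix_mult_def sum_negf)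
      then show ?thesis by (simp add: R_def matrix_mul_assoc sum_negf del: sum.lessThan_Suc)
    qed
    also have "?E n ** ?G q = (?E n ** matrix_inv (C q)) ** (C q ** ?G q)"
      by (metis inv matrix_mul_assoc matrix_mul_rid)
    also have "((?E n ** matrix_inv (C q)) ** (C q ** ?G q) - - (\<Sum>j<Suc n. (?E n ** matrix_inv (C q)) ** (C j ** ?G j))) $ a $ b = \<psi> u"
      unfolding \<psi>_def matrix_mult_sum_right n lessThan_Suc_atMost[symmetric] by simp
    finally show ?thesis .
  qed
  have "continuous_on {v..t} \<psi>"
  proof -
    have cE: "continuous_on {v..t} (\<lambda>u. E (t - u) n $ a $ x)" for a x
      unfolding E_def by (rule continuous_on_compose2[OF continuous_on_component[OF continuous_on_component[OF continuous_on_block_exp[OF i, of UNIV]]]])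
        (auto intro!: continuous_intros)
    have cG: "continuous_on {v..t} (\<lambda>u. G (u - v) l $ a $ x)" if "l \<le> q" for l a x
      unfolding G_def by (rule continuous_on_compose2[OF continuous_on_component[OF continuous_on_component[OF continuous_on_block_exp[of l p UNIV]]]])
        (use that q in \<open>auto intro!: continuous_intros\<close>)
    show ?thesis
      unfolding \<psi>_def[abs_def] matrix_matrix_mult_def
      by (simp, intro continuous_intros cE cG) auto
  qed
  then have "(\<integral>u. indicator {v..t} u *\<^sub>R \<psi> u \<partial>lborel) = \<phi> t - \<phi> v"
    by (intro integral_FTC_atLeastAtMost vt has_field_derivative_at_within[OF d, THEN has_real_derivative_iff_has_vector_derivative[THEN iffD1]])
  \<comment> \<open>\<open>G\<close> is block column \<open>p - 1\<close>, and
    \<open>j < q < p\<close> gives \<open>j < p - 1\<close>, so the identity at time 0 has a zero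
    block there.\<close>
  moreover have "\<phi> v = 0"
  proof -
    have "G 0 j = 0" if "j < Suc n" for j
      unfolding G_def using that q n by (subst block_exp_0) (auto simp: block_one_def)
    then show ?thesis by (simp add: \<phi>_def)
  qed
  moreover have "\<phi> t = G (t - v) i $ a $ b"
  proof -
    have E0: "E 0 j = (if j = i then mat 1 else 0)" for j
      unfolding E_def using i by (subst block_exp_0) (auto simp: block_one_def)
    have "\<phi> t = (\<Sum>j<Suc n. (E 0 j ** G (t - v) j) $ a $ b)"
      by (simp add: \<phi>_def matrix_matrix_mult_def del: sum.lessThan_Suc)
    also have "\<dots> = (\<Sum>j<Suc n. if j = i then G (t - v) i $ a $ b else 0)"
      by (intro sum.cong refl) (auto simp: E0)
    also have "\<dots> = G (t - v) i $ a $ b" using i n by (simp del: sum.lessThan_Suc)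
    finally show ?thesis .
  qed
  ultimately show ?thesis by (simp add: \<psi>_def n)
qed

section \<open>Convolution with a decaying kernel\<close>

lemma integrable_exponential_density:
  assumes "0 < l"
  shows "integrable lborel (exponential_density l)"
proof (rule integrableI_nonneg)
  interpret prob_space "density lborel (exponential_density l)"
    by (rule prob_space_exponential_density[OF assms])
  have "(\<integral>\<^sup>+x. ennreal (exponential_density l x) \<partial>lborel) = 1"
    using emeasure_space_1 by (simp add: emeasure_density)
  then show "(\<integral>\<^sup>+x. ennreal (exponential_density l x) \<partial>lborel) < \<infinity>" by simp
qed (use assms in \<open>auto intro: exponential_density_nonneg\<close>)

text \<open>The orthogonality argument divides by its majorant, which must therefore be positive on
  the whole line, also beyond \<open>t\<close>: a two-sided exponential centred at
  \<open>t\<close>.\<close>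

lemma exp_decay_majorant:
  fixes h :: "real \<Rightarrow> real"
  assumes "exp_decay h" and "0 \<le> c"
  obtains b where "\<And>u. 0 < b u" "integrable lborel b" "\<And>u. u \<le> t \<Longrightarrow> \<bar>h (t - u)\<bar> * c \<le> b u"
proof -
  obtain K \<delta> where K: "0 \<le> K" "0 < \<delta>" "\<forall>r\<ge>0. norm (h r) \<le> K * exp (- \<delta> * r)"
    by (rule exp_decayE[OF assms(1)])
  \<comment> \<open>The density has height \<open>\<delta>\<close> at 0, so \<open>N\<close> is
    fixed by \<open>N * \<delta> = K * c + 1\<close>; the summand 1 keeps \<open>b\<close> positive
    when \<open>K * c = 0\<close>.\<close>
  define N where "N = (K * c + 1) / \<delta>"
  have N: "0 < N" "N * \<delta> = K * c + 1" using K assms(2) by (auto simp: N_def add_nonneg_pos)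
  define b where "b u = N * (exponential_density \<delta> (t + (- 1) * u) + exponential_density \<delta> (- t + 1 * u))" for u
  have pos: "0 < b u" for u
    using N(1) K(2) by (auto simp: b_def exponential_density_def)
  moreover have "integrable lborel b"
    unfolding b_def[abs_def]
    by (intro integrable_mult_right Bochner_Integration.integrable_add lborel_integrable_real_affine
        integrable_exponential_density K) auto
  moreover have "\<bar>h (t - u)\<bar> * c \<le> b u" if "u \<le> t" for u
  proof -
    have "\<bar>h (t - u)\<bar> * c \<le> (K * exp (- \<delta> * (t - u))) * c"
      using K(3)[rule_format, of "t - u"] that assms(2) by (intro mult_right_mono) auto
    also have "\<dots> \<le> (K * c + 1) * exp (- \<delta> * (t - u))"
      by (simp add: distrib_right)
    also have "\<dots> = N * exponential_density \<delta> (t + (- 1) * u)"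
      unfolding N(2)[symmetric] using that by (simp add: exponential_density_def algebra_simps)
    also have "\<dots> \<le> b u"
      unfolding b_def using N(1) K(2) exponential_density_nonneg[of \<delta> "- t + 1 * u"] by (simp add: distrib_left)
    finally show ?thesis .
  qed
  ultimately show thesis by (rule that)
qed

text \<open>Integrability of each component over the whole half-line implies the improper limit that
  the definition asks for.\<close>

lemma has_lower_integralI:
  fixes f :: "real \<Rightarrow> real^'k::finite"
  assumes int: "\<And>a. integrable lborel (\<lambda>u. indicator {..t} u * f u $ a)"
    and eq: "\<And>a. (\<integral>u. indicator {..t} u * f u $ a \<partial>lborel) = I $ a"
  shows "has_lower_integral f t I"
proof -
  have f: "indicator {..t} u *\<^sub>R f u = (\<Sum>a\<in>UNIV. (indicator {..t} u * f u $ a) *\<^sub>R axis a 1)" for u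
    by (simp add: vec_eq_iff axis_def if_distrib cong: if_cong)
  have fi: "set_integrable lborel {..t} f"
    unfolding set_integrable_def f by (intro Bochner_Integration.integrable_sum integrable_scaleR_left int)
  have "set_lebesgue_integral lborel {..t} f = (\<Sum>a\<in>UNIV. I $ a *\<^sub>R axis a 1)"
    unfolding set_lebesgue_integral_def f by (simp add: int eq)
  also have "\<dots> = I"
    by (simp add: vec_eq_iff axis_def if_distrib cong: if_cong)
  finally have I: "set_lebesgue_integral lborel {..t} f = I" .
  show ?thesis
    unfolding has_lower_integral_def
  proof (intro conjI allI impI)
    show "set_integrable lborel {s..t} f" for s
      by (rule set_integrable_subset[OF fi]) auto
    show "((\<lambda>s. LINT u:{s..t}|lborel. f u) \<longlongrightarrow> I) at_bot"
      using tendsto_set_lebesgue_integral_at_bot[OF _ fi] unfolding I by simp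
  qed
qed

context centred_L2_levy
begin

text \<open>\<open>AE_pathwise_integral_eqI\<close> for component \<open>a\<close>, with
  \<open>\<xi> u\<close> the variable \<open>H (t - u) *v Y u\<close> cut off at \<open>t\<close>.
  Through the isometry its moment identities become Fubini for deterministic kernels, and
  \<open>conv\<close> evaluates the inner integral.\<close>

lemma levy_convolution_AE:
  fixes H K :: "real \<Rightarrow> real^'k^'k" and Y :: "real \<Rightarrow> 'w \<Rightarrow> real^'k"
  assumes H: "continuous_on UNIV H" and K: "continuous_on UNIV K"
    and dec: "\<And>x. exp_decay (\<lambda>r. H r $ a $ x)"
    and meas: "(\<lambda>(s, \<omega>). Y s \<omega>) \<in> borel_measurable (borel \<Otimes>\<^sub>M M)"
    and Y: "\<And>s. has_levy_integral M L (\<lambda>u. K (s - u)) {..s} (Y s)"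
    and Z: "has_levy_integral M L G {..t} Z"
    and conv: "\<And>v i. v \<le> t \<Longrightarrow> (\<integral>u. indicator {v..t} u * (H (t - u) ** K (u - v)) $ a $ i \<partial>lborel) = G v $ a $ i"
  shows "AE \<omega> in M. integrable lborel (\<lambda>u. indicator {..t} u * (H (t - u) *v Y u \<omega>) $ a) \<and>
    (\<integral>u. indicator {..t} u * (H (t - u) *v Y u \<omega>) $ a \<partial>lborel) = Z \<omega> $ a"
proof -
  have Hm[measurable]: "(\<lambda>r. H r $ a $ x) \<in> borel_measurable borel" for a x
    by (intro measurable_vec_nth borel_measurable_continuous_onI H)
  have Km[measurable]: "(\<lambda>r. K r $ a $ x) \<in> borel_measurable borel" for a x
    by (intro measurable_vec_nth borel_measurable_continuous_onI K)
  \<comment> \<open>Row \<open>a\<close> of the kernel of \<open>\<xi> u\<close> at time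
    \<open>v\<close>; causality of \<open>Y\<close> confines it to
    \<open>v \<le> u \<le> t\<close>.\<close>
  define \<kappa> where "\<kappa> i u v = (if u \<le> t \<and> v \<le> u then \<Sum>x\<in>UNIV. H (t - u) $ a $ x * K (u - v) $ x $ i else 0)" for i u v
  have \<kappa>m[measurable]: "(\<lambda>z. \<kappa> i (fst z) (snd z)) \<in> borel_measurable (borel \<Otimes>\<^sub>M borel)" for i
    unfolding \<kappa>_def by measurable
  define h where "h r = (\<Sum>x\<in>UNIV. \<bar>H r $ a $ x\<bar>)" for r
  have h_dec: "exp_decay h"
    unfolding h_def[abs_def] by (rule exp_decay_sum) (use dec in \<open>simp add: exp_decay_def\<close>)
  have h0: "0 \<le> h r" for r unfolding h_def by (intro sum_nonneg) auto

  \<comment> \<open>Squared entries of the kernel of \<open>Y\<close> as functions of the time lag.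
    They are integrable because \<open>Y s\<close> is a Levy integral, and translation makes the
    integral independent of \<open>s\<close>.\<close>
  define k where "k x i r = (indicator {0..} r * K r $ x $ i)\<^sup>2" for x i r
  have shift: "((indicator {..s} v *\<^sub>R K (s - v)) $ x $ i)\<^sup>2 = k x i (s + (- 1) * v)" for s v x i
    by (simp add: k_def indicator_def)
  have k_int: "integrable lborel (\<lambda>v. k x i (s + (- 1) * v))" for s x i
    using levy_integrand_sq_integrable[OF Y[of s], of x i] by (simp only: shift)
  have k_shift: "(\<integral>v. k x i (s + (- 1) * v) \<partial>lborel) = (\<integral>v. k x i v \<partial>lborel)" for s x i
    using lborel_integral_real_affine[of "- 1" "k x i" s] by simp
  define ck where "ck = (\<Sum>i\<in>UNIV. \<Sum>x\<in>UNIV. \<integral>v. k x i v \<partial>lborel)"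
  have k0: "0 \<le> (\<Sum>x\<in>UNIV. \<integral>v. k x i v \<partial>lborel)" for i
    by (intro sum_nonneg Bochner_Integration.integral_nonneg) (simp add: k_def)
  have ck0: "0 \<le> ck" unfolding ck_def by (intro sum_nonneg k0)
  have ck_i: "(\<Sum>x\<in>UNIV. \<integral>v. k x i v \<partial>lborel) \<le> ck" for i
    unfolding ck_def by (rule member_le_sum[where f = "\<lambda>i. \<Sum>x\<in>UNIV. \<integral>v. k x i v \<partial>lborel"]) (auto intro: k0)

  define N where "N = real CARD('k)"
  have N: "1 \<le> N" by (simp add: N_def Suc_leI)
  \<comment> \<open>Cauchy-Schwarz in the summation index; bounding each squared entry of row
    \<open>a\<close> of \<open>H\<close> by the square of \<open>h\<close> costs the factor
    \<open>N\<close>.\<close>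
  have \<kappa>_le: "(\<kappa> i u v)\<^sup>2 \<le> N * (h (t - u))\<^sup>2 * (\<Sum>x\<in>UNIV. k x i (u + (- 1) * v))" for i u v
  proof (cases "u \<le> t \<and> v \<le> u")
    case True
    have "(\<kappa> i u v)\<^sup>2 \<le> (\<Sum>x\<in>UNIV. (H (t - u) $ a $ x)\<^sup>2) * (\<Sum>x\<in>UNIV. (K (u - v) $ x $ i)\<^sup>2)"
      using True by (simp add: \<kappa>_def Cauchy_Schwarz_ineq_sum)
    also have "(\<Sum>x\<in>UNIV. (K (u - v) $ x $ i)\<^sup>2) = (\<Sum>x\<in>UNIV. k x i (u + (- 1) * v))"
      using True by (simp add: k_def)
    also have "(\<Sum>x\<in>UNIV. (H (t - u) $ a $ x)\<^sup>2) \<le> (\<Sum>x\<in>(UNIV :: 'k set). (h (t - u))\<^sup>2)"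
    proof (rule sum_mono)
      fix x :: 'k
      have "\<bar>H (t - u) $ a $ x\<bar> \<le> h (t - u)"
        unfolding h_def by (rule member_le_sum) auto
      then show "(H (t - u) $ a $ x)\<^sup>2 \<le> (h (t - u))\<^sup>2"
        by (metis abs_ge_zero power2_abs power_mono)
    qed
    finally show ?thesis
      by (simp add: N_def mult_right_mono sum_nonneg k_def)
  next
    case False
    then show ?thesis using N by (auto simp: \<kappa>_def k_def intro!: mult_nonneg_nonneg sum_nonneg)
  qed
  have \<kappa>_sq: "integrable lborel (\<lambda>v. (\<kappa> i u v)\<^sup>2)" for i u
  proof (rule Bochner_Integration.integrable_bound)
    show "integrable lborel (\<lambda>v. N * (h (t - u))\<^sup>2 * (\<Sum>x\<in>UNIV. k x i (u + (- 1) * v)))"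
      by (intro integrable_mult_right Bochner_Integration.integrable_sum k_int)
    show "(\<lambda>v. (\<kappa> i u v)\<^sup>2) \<in> borel_measurable lborel"
      unfolding \<kappa>_def by measurable
    show "AE v in lborel. norm ((\<kappa> i u v)\<^sup>2) \<le> norm (N * (h (t - u))\<^sup>2 * (\<Sum>x\<in>UNIV. k x i (u + (- 1) * v)))"
      using \<kappa>_le by (intro AE_I2) (auto intro: order_trans[OF _ abs_ge_self])
  qed
  have \<kappa>_norm: "(\<integral>v. (\<kappa> i u v)\<^sup>2 \<partial>lborel) \<le> N * (h (t - u))\<^sup>2 * ck" for i u
  proof -
    have "(\<integral>v. (\<kappa> i u v)\<^sup>2 \<partial>lborel) \<le> (\<integral>v. N * (h (t - u))\<^sup>2 * (\<Sum>x\<in>UNIV. k x i (u + (- 1) * v)) \<partial>lborel)"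
      by (intro integral_mono \<kappa>_sq integrable_mult_right Bochner_Integration.integrable_sum k_int \<kappa>_le)
    also have "\<dots> = N * (h (t - u))\<^sup>2 * (\<Sum>x\<in>UNIV. \<integral>v. k x i v \<partial>lborel)"
      using k_int k_shift by simp
    also have "\<dots> \<le> N * (h (t - u))\<^sup>2 * ck"
      using N by (intro mult_left_mono ck_i) auto
    finally show ?thesis .
  qed

  define Zu where "Zu u \<omega> = H (t - u) *v Y u \<omega>" for u \<omega>
  have Zu: "has_levy_integral M L (\<lambda>v. H (t - u) ** K (u - v)) {..u} (Zu u)" for u
    unfolding Zu_def by (rule has_levy_integral_matrix_mult[OF Y])
  define \<xi> where "\<xi> u \<omega> = indicator {..t} u * Zu u \<omega> $ a" for u \<omega>
  have \<kappa>_row: "indicator {..t} u *\<^sub>R (indicator {..u} v *\<^sub>R (H (t - u) ** K (u - v))) $ a = (\<chi> i. \<kappa> i u v)" for u v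
    by (auto simp: vec_eq_iff \<kappa>_def matrix_matrix_mult_def indicator_def)
  have Zm: "Z \<in> borel_measurable M"
    using Z by (simp add: has_levy_integral_def)
  have pair: "expectation (\<lambda>\<omega>. \<xi> u \<omega> * J \<omega> $ b) = (\<integral>v. cov (\<chi> i. \<kappa> i u v) ((indicator T v *\<^sub>R g v) $ b) \<partial>lborel)"
    if J: "has_levy_integral M L g T J" for g T J b u
  proof -
    have "expectation (\<lambda>\<omega>. \<xi> u \<omega> * J \<omega> $ b) = indicator {..t} u * expectation (\<lambda>\<omega>. Zu u \<omega> $ a * J \<omega> $ b)"
      by (simp add: \<xi>_def mult.assoc)
    also have "\<dots> = (\<integral>v. indicator {..t} u * cov ((indicator {..u} v *\<^sub>R (H (t - u) ** K (u - v))) $ a) ((indicator T v *\<^sub>R g v) $ b) \<partial>lborel)"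
      unfolding levy_integral_isometry[OF Zu J] by simp
    finally show ?thesis by (simp only: cov_scaleR_left[symmetric] \<kappa>_row)
  qed
  \<comment> \<open>Stated for every Levy integral \<open>J\<close>: the choice \<open>J = Z\<close>
    gives the self term, \<open>J = Zu s\<close> the cross terms.\<close>
  have main: "expectation (\<lambda>\<omega>. Z \<omega> $ a * J \<omega> $ b) = (\<integral>u. expectation (\<lambda>\<omega>. \<xi> u \<omega> * J \<omega> $ b) \<partial>lborel)"
    if J: "has_levy_integral M L g T J" for g T J b
  proof -
    define e where "e v = (indicator T v *\<^sub>R g v) $ b" for v
    have "(\<lambda>v. indicator T v *\<^sub>R g v) \<in> borel_measurable lborel"
      using J by (simp add: has_levy_integral_def)
    then have e_vm: "(\<lambda>v. e v $ j) \<in> borel_measurable lborel" for j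
      unfolding e_def by (intro measurable_vec_nth)
    then have e_m[measurable]: "(\<lambda>v. e v $ j) \<in> borel_measurable borel" for j by simp
    have e_sq: "integrable lborel (\<lambda>v. (e v $ j)\<^sup>2)" for j
      unfolding e_def by (rule levy_integrand_sq_integrable[OF J])
    have \<kappa>u_m: "(\<lambda>v. \<kappa> i u v) \<in> borel_measurable lborel" for i u
      unfolding \<kappa>_def by measurable
    have int_v: "integrable lborel (\<lambda>v. \<kappa> i u v * e v $ j)" for i j u
      by (intro L2_mult_integrable \<kappa>u_m e_vm \<kappa>_sq e_sq)
    \<comment> \<open>Integrability on the plane: Cauchy-Schwarz in \<open>v\<close>, then the decay
      of \<open>h\<close> in \<open>u\<close>.\<close>
    have int: "integrable (lborel \<Otimes>\<^sub>M lborel) (\<lambda>(u, v). \<kappa> i u v * e v $ j)" for i j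
    proof (rule lborel_pair.Fubini_integrable)
      define c where "c = sqrt (N * ck) * sqrt (\<integral>v. (e v $ j)\<^sup>2 \<partial>lborel)"
      have c0: "0 \<le> c" using N ck0 by (auto simp: c_def intro!: mult_nonneg_nonneg)
      obtain d where d: "\<And>u. 0 < d u" "integrable lborel d" "\<And>u. u \<le> t \<Longrightarrow> \<bar>h (t - u)\<bar> * c \<le> d u"
        using exp_decay_majorant[OF h_dec c0, of t] by metis
      show "integrable lborel (\<lambda>u. \<integral>v. norm (case (u, v) of (u, v) \<Rightarrow> \<kappa> i u v * e v $ j) \<partial>lborel)"
      proof (rule Bochner_Integration.integrable_bound[OF d(2)])
        have "(\<integral>v. \<bar>\<kappa> i u v * e v $ j\<bar> \<partial>lborel) \<le> d u" for u
        proof (cases "u \<le> t")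
          case True
          have "(\<integral>v. \<bar>\<kappa> i u v * e v $ j\<bar> \<partial>lborel) \<le> sqrt (\<integral>v. (\<kappa> i u v)\<^sup>2 \<partial>lborel) * sqrt (\<integral>v. (e v $ j)\<^sup>2 \<partial>lborel)"
            by (intro L2_mult_abs_le \<kappa>u_m e_vm \<kappa>_sq e_sq)
          also have "\<dots> \<le> sqrt (N * (h (t - u))\<^sup>2 * ck) * sqrt (\<integral>v. (e v $ j)\<^sup>2 \<partial>lborel)"
            by (intro mult_right_mono real_sqrt_le_mono \<kappa>_norm) auto
          also have "\<dots> = \<bar>h (t - u)\<bar> * c"
            by (simp add: c_def real_sqrt_mult)
          finally show ?thesis using d(3)[OF True] by linarith
        next
          case False
          then show ?thesis using d(1)[of u] by (simp add: \<kappa>_def less_imp_le)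
        qed
        then show "AE u in lborel. norm (\<integral>v. norm (case (u, v) of (u, v) \<Rightarrow> \<kappa> i u v * e v $ j) \<partial>lborel) \<le> norm (d u)"
          using d(1) by (auto intro!: AE_I2 simp: abs_of_pos)
      qed measurable
      show "AE u in lborel. integrable lborel (\<lambda>v. case (u, v) of (u, v) \<Rightarrow> \<kappa> i u v * e v $ j)"
        using int_v by simp
    qed measurable
    \<comment> \<open>Here the convolution identity enters; for \<open>v > t\<close> both sides
      vanish.\<close>
    have \<kappa>_int: "(\<integral>u. \<kappa> i u v \<partial>lborel) = (indicator {..t} v *\<^sub>R G v) $ a $ i" for i v
    proof (cases "v \<le> t")
      case True
      have "\<kappa> i u v = indicator {v..t} u * (H (t - u) ** K (u - v)) $ a $ i" for u
        by (auto simp: \<kappa>_def matrix_matrix_mult_def indicator_def)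
      then show ?thesis using conv[OF True] True by simp
    next
      case False
      then have "\<kappa> i u v = 0" for u by (auto simp: \<kappa>_def)
      then show ?thesis using False by simp
    qed
    have "(\<integral>u. expectation (\<lambda>\<omega>. \<xi> u \<omega> * J \<omega> $ b) \<partial>lborel)
        = (\<integral>u. (\<Sum>i\<in>UNIV. \<Sum>j\<in>UNIV. (\<integral>v. \<kappa> i u v * e v $ j \<partial>lborel) * cov_coeff i j) \<partial>lborel)"
      unfolding pair[OF J] e_def[symmetric] cov_eq using int_v by simp
    also have "\<dots> = (\<Sum>i\<in>UNIV. \<Sum>j\<in>UNIV. (\<integral>u. (\<integral>v. \<kappa> i u v * e v $ j \<partial>lborel) \<partial>lborel) * cov_coeff i j)"
    proof -
      have "integrable lborel (\<lambda>u. \<integral>v. \<kappa> i u v * e v $ j \<partial>lborel)" for i j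
        using lborel_pair.integrable_fst[OF int] by simp
      then show ?thesis by simp
    qed
    also have "\<dots> = (\<Sum>i\<in>UNIV. \<Sum>j\<in>UNIV. (\<integral>v. (\<integral>u. \<kappa> i u v * e v $ j \<partial>lborel) \<partial>lborel) * cov_coeff i j)"
      using lborel_pair.Fubini_integral[OF int] by simp
    also have "\<dots> = (\<Sum>i\<in>UNIV. \<Sum>j\<in>UNIV. (\<integral>v. (indicator {..t} v *\<^sub>R G v) $ a $ i * e v $ j \<partial>lborel) * cov_coeff i j)"
      by (simp only: integral_mult_left_zero \<kappa>_int)
    also have "\<dots> = (\<integral>v. cov ((indicator {..t} v *\<^sub>R G v) $ a) (e v) \<partial>lborel)"
    proof -
      have "(\<lambda>v. indicator {..t} v *\<^sub>R G v) \<in> borel_measurable lborel"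
        using Z by (simp add: has_levy_integral_def)
      then have "integrable lborel (\<lambda>v. (indicator {..t} v *\<^sub>R G v) $ a $ i * e v $ j)" for i j
        by (intro L2_mult_integrable measurable_vec_nth e_vm e_sq levy_integrand_sq_integrable[OF Z])
      then show ?thesis unfolding cov_eq by (simp del: vector_scaleR_component scaleR_vec_def)
    qed
    also have "\<dots> = expectation (\<lambda>\<omega>. Z \<omega> $ a * J \<omega> $ b)"
      unfolding levy_integral_isometry[OF Z J] e_def ..
    finally show ?thesis ..
  qed

  \<comment> \<open>One factor \<open>N\<close> stems from \<open>\<kappa>_le\<close>, the other
    from the sum over the columns \<open>i\<close>.\<close>
  define c where "c = sqrt (cov_norm * (N * (N * ck)))"
  have c0: "0 \<le> c" unfolding c_def using cov_norm_nonneg N ck0 by simp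
  obtain b where b: "\<And>u. 0 < b u" "integrable lborel b" "\<And>u. u \<le> t \<Longrightarrow> \<bar>h (t - u)\<bar> * c \<le> b u"
    using exp_decay_majorant[OF h_dec c0, of t] by metis
  have Zu_sq: "integrable M (\<lambda>\<omega>. (Zu u \<omega> $ a)\<^sup>2)" for u
    by (rule levy_integral_sq_integrable[OF Zu])
  have \<xi>_sq: "integrable M (\<lambda>\<omega>. (\<xi> u \<omega>)\<^sup>2)" for u
    using Zu_sq by (simp add: \<xi>_def power_mult_distrib)
  have \<xi>_le: "expectation (\<lambda>\<omega>. (\<xi> u \<omega>)\<^sup>2) \<le> (b u)\<^sup>2" for u
  proof (cases "u \<le> t")
    case True
    have row: "(indicator {..u} v *\<^sub>R (H (t - u) ** K (u - v))) $ a = (\<chi> i. \<kappa> i u v)" for v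
      using \<kappa>_row[of u v] True by simp
    \<comment> \<open>For \<open>u \<le> t\<close> one factor can be written without the cut-off,
      which makes it a Levy integral covered by \<open>pair\<close>.\<close>
    have "expectation (\<lambda>\<omega>. (\<xi> u \<omega>)\<^sup>2) = expectation (\<lambda>\<omega>. \<xi> u \<omega> * Zu u \<omega> $ a)"
      using True by (simp add: \<xi>_def power2_eq_square)
    also have "\<dots> = (\<integral>v. cov (\<chi> i. \<kappa> i u v) (\<chi> i. \<kappa> i u v) \<partial>lborel)"
      unfolding pair[OF Zu] row ..
    also have "\<dots> \<le> (\<integral>v. cov_norm * (\<Sum>i\<in>UNIV. (\<kappa> i u v)\<^sup>2) \<partial>lborel)"
    proof (rule integral_mono')
      show "integrable lborel (\<lambda>v. cov_norm * (\<Sum>i\<in>UNIV. (\<kappa> i u v)\<^sup>2))"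
        by (intro integrable_mult_right Bochner_Integration.integrable_sum \<kappa>_sq)
      show "0 \<le> cov_norm * (\<Sum>i\<in>UNIV. (\<kappa> i u v)\<^sup>2)" for v
        using cov_norm_nonneg by (intro mult_nonneg_nonneg sum_nonneg) auto
      have "norm y * norm y = (\<Sum>i\<in>UNIV. (y $ i)\<^sup>2)" for y :: "real^'k"
        by (simp add: norm_vec_def L2_set_def sum_nonneg)
      from this[of "\<chi> i. \<kappa> i u _"]
      show "cov (\<chi> i. \<kappa> i u v) (\<chi> i. \<kappa> i u v) \<le> cov_norm * (\<Sum>i\<in>UNIV. (\<kappa> i u v)\<^sup>2)" for v
        using abs_cov_le[of "\<chi> i. \<kappa> i u v" "\<chi> i. \<kappa> i u v"] by (simp add: mult.assoc)
    qed
    also have "\<dots> = cov_norm * (\<Sum>i\<in>UNIV. \<integral>v. (\<kappa> i u v)\<^sup>2 \<partial>lborel)"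
      using \<kappa>_sq by simp
    also have "\<dots> \<le> cov_norm * (\<Sum>i\<in>(UNIV :: 'k set). N * (h (t - u))\<^sup>2 * ck)"
      by (intro mult_left_mono sum_mono \<kappa>_norm cov_norm_nonneg)
    also have "\<dots> = (\<bar>h (t - u)\<bar> * c)\<^sup>2"
      using cov_norm_nonneg N ck0 by (simp add: c_def power_mult_distrib N_def mult_ac)
    also have "\<dots> \<le> (b u)\<^sup>2"
      using b(3)[OF True] c0 by (intro power_mono) auto
    finally show ?thesis .
  qed (simp add: \<xi>_def)
  have \<xi>_meas: "(\<lambda>(u, \<omega>). \<xi> u \<omega>) \<in> borel_measurable (borel \<Otimes>\<^sub>M M)"
  proof -
    have [measurable]: "(\<lambda>z. Y (fst z) (snd z) $ x) \<in> borel_measurable (borel \<Otimes>\<^sub>M M)" for x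
      using measurable_vec_nth[OF meas, of x] by (simp add: case_prod_beta)
    show ?thesis
      unfolding \<xi>_def Zu_def case_prod_beta' matrix_vector_mult_def by simp
  qed
  have "AE \<omega> in M. integrable lborel (\<lambda>u. \<xi> u \<omega>) \<and> (\<integral>u. \<xi> u \<omega> \<partial>lborel) = Z \<omega> $ a"
  proof (rule AE_pathwise_integral_eqI[OF \<xi>_meas b(1,2) \<xi>_sq \<xi>_le])
    show "(\<lambda>\<omega>. Z \<omega> $ a) \<in> borel_measurable M" by (rule measurable_vec_nth[OF Zm])
    show "integrable M (\<lambda>\<omega>. (Z \<omega> $ a)\<^sup>2)" by (rule levy_integral_sq_integrable[OF Z])
    show "expectation (\<lambda>\<omega>. Z \<omega> $ a * Z \<omega> $ a) = (\<integral>u. expectation (\<lambda>\<omega>. \<xi> u \<omega> * Z \<omega> $ a) \<partial>lborel)"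
      by (rule main[OF Z])
    \<comment> \<open>\<open>\<xi> s\<close> is component \<open>a\<close> of \<open>Zu s\<close>
      for \<open>s \<le> t\<close> and 0 afterwards.\<close>
    show "expectation (\<lambda>\<omega>. Z \<omega> $ a * \<xi> s \<omega>) = (\<integral>u. expectation (\<lambda>\<omega>. \<xi> u \<omega> * \<xi> s \<omega>) \<partial>lborel)" for s
      using main[OF Zu, of s a] by (cases "s \<le> t") (simp_all add: \<xi>_def[of s])
  qed
  then show ?thesis by (simp only: \<xi>_def Zu_def)
qed

end

section \<open>The representation of the first \<open>q\<close> blocks of \<open>X\<close>\<close>

lemma matrix_inv_inverse:
  fixes A :: "real^'k::finite^'k"
  assumes "rank A = CARD('k)"
  shows "A ** matrix_inv A = mat 1" "matrix_inv A ** A = mat 1"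
proof -
  have "invertible A"
    using assms by (simp add: full_rank_injective matrix_left_invertible_injective[symmetric] invertible_left_inverse)
  then have "A ** matrix_inv A = mat 1 \<and> matrix_inv A ** A = mat 1"
    unfolding invertible_def matrix_inv_def by (rule someI_ex)
  then show "A ** matrix_inv A = mat 1" "matrix_inv A ** A = mat 1" by auto
qed

theorem proposition3p1:
  fixes M :: "'w measure"
    and L :: "real \<Rightarrow> 'w \<Rightarrow> real^'k::finite"
    and p q :: nat
    and A C :: "nat \<Rightarrow> real^'k^'k"
    and X :: "real \<Rightarrow> 'w \<Rightarrow> nat \<Rightarrow> real^'k"
    and Y :: "real \<Rightarrow> 'w \<Rightarrow> real^'k"
  assumes "prob_space M"
    and "0 < q" and "q < p"
    and "ICCSS M L p q A C X Y"
  shows "\<forall>t. AE \<omega> in M. \<forall>i<q.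
           has_lower_integral
             (\<lambda>u. \<Sum>j<q. block_exp q (block_scale (t - u) (bigLambda q C)) i j *v
                           (bigTheta q C j *v Y u \<omega>))
             t (X t \<omega> i)"
proof
  fix t
  note ic = assms(4)[unfolded ICCSS_def]
  interpret centred_L2_levy M L
    using assms(1) ic by (auto simp: centred_L2_levy_def centred_L2_levy_axioms_def)
  have inv: "C q ** matrix_inv (C q) = mat 1" "matrix_inv (C q) ** C q = mat 1"
    using ic by (auto simp: ICCSS_coeffs_def intro!: matrix_inv_inverse)
  have stable: "Re z < 0" if "det (Qpoly q C z) = 0" for z
    using ic that by (auto simp: ICCSS_coeffs_def)
  define G where "G r l = block_exp p (block_scale r (bigA p A)) l (p - 1)" for r l
  define K where "K r = (\<Sum>l\<le>q. C l ** G r l)" for r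
  \<comment> \<open>\<open>Y\<close> is prescribed on \<open>space M\<close> only, by a sum up to
    \<open>p\<close>. \<open>Y'\<close> agrees with it there, is given by a formula everywhere and
    omits the zero blocks beyond \<open>q\<close>.\<close>
  define Y' where "Y' s \<omega> = (\<Sum>l\<le>q. C l *v X s \<omega> l)" for s \<omega>
  \<comment> \<open>Only the last block of \<open>bigB\<close> is nonzero, so the kernel of
    \<open>X\<close> is the last block column of the exponential.\<close>
  have last: "(\<Sum>j<n. U j ** last_block n V j) = U (n - 1) ** V" if n_pos: "0 < n" for n V and U :: "nat \<Rightarrow> real^'k^'k"
  proof -
    obtain m where n: "n = Suc m" using n_pos by (cases n) auto
    show ?thesis unfolding n by (simp add: last_block_def)
  qed
  have X: "has_levy_integral M L (\<lambda>u. G (s - u) l) {..s} (\<lambda>\<omega>. X s \<omega> l)" if "l < p" for s l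
  proof -
    have "has_levy_integral M L
        (\<lambda>u. \<Sum>j<p. block_exp p (block_scale (s - u) (bigA p A)) l j ** bigB p j) {..s} (\<lambda>\<omega>. X s \<omega> l)"
      using ic that unfolding input_process_def by blast
    then show ?thesis
      using assms(3) by (simp add: G_def bigB_def last)
  qed
  have Y': "has_levy_integral M L (\<lambda>u. K (s - u)) {..s} (Y' s)" for s
    unfolding K_def Y'_def
    by (intro has_levy_integral_sum has_levy_integral_matrix_mult X) (use assms(3) in auto)
  have Y_eq: "Y s \<omega> = Y' s \<omega>" if "\<omega> \<in> space M" for s \<omega>
  proof -
    have "Y s \<omega> = (\<Sum>j<p. bigC q C j *v X s \<omega> j)" using ic that by blast
    also have "\<dots> = Y' s \<omega>"
      unfolding Y'_def by (rule sum.mono_neutral_cong_right) (use assms(3) in \<open>auto simp: bigC_def\<close>)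
    finally show ?thesis .
  qed
  have meas: "(\<lambda>(s, \<omega>). Y' s \<omega>) \<in> borel_measurable (borel \<Otimes>\<^sub>M M)"
  proof -
    have "(\<lambda>z. U *v X (fst z) (snd z) l) \<in> borel_measurable (borel \<Otimes>\<^sub>M M)" if "l \<le> q" for l U
    proof (rule borel_measurable_continuous_on[where f = "\<lambda>x. U *v x"])
      show "(\<lambda>z. X (fst z) (snd z) l) \<in> borel_measurable (borel \<Otimes>\<^sub>M M)"
        using ic that assms(3) unfolding input_process_def by (auto simp: case_prod_beta')
      show "continuous_on UNIV (\<lambda>x. U *v x)"
        by (intro linear_continuous_on matrix_vector_mul_bounded_linear)
    qed
    then show ?thesis unfolding Y'_def case_prod_beta' by (intro borel_measurable_sum) auto
  qed
  have contK: "continuous_on UNIV K"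
  proof (rule continuous_on_vec_vecI)
    have "continuous_on UNIV (\<lambda>r. G r l $ a $ b)" if "l \<le> q" for l a b
      unfolding G_def using that assms(3)
      by (intro continuous_on_component continuous_on_block_exp) auto
    then show "continuous_on UNIV (\<lambda>r. K r $ a $ b)" for a b
      unfolding K_def by (simp add: matrix_matrix_mult_def) (intro continuous_on_sum continuous_on_mult continuous_on_const; simp)
  qed
  have "AE \<omega> in M. has_lower_integral
             (\<lambda>u. \<Sum>j<q. block_exp q (block_scale (t - u) (bigLambda q C)) i j *v
                           (bigTheta q C j *v Y u \<omega>))
             t (X t \<omega> i)" if i: "i < q" for i
  proof -
    define E where "E r = block_exp q (block_scale r (bigLambda q C)) i" for r
    \<comment> \<open>\<open>H r\<close> is block \<open>i\<close> of the product of the exponential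
      of \<open>\<Lambda> r\<close> with \<open>\<Theta>\<close>.\<close>
    define H where "H r = E r (q - 1) ** matrix_inv (C q)" for r
    have contE: "continuous_on UNIV (\<lambda>r. E r j $ a $ b)" for j a b
      unfolding E_def using i by (intro continuous_on_component continuous_on_block_exp)
    have contH: "continuous_on UNIV H"
      by (rule continuous_on_vec_vecI)
        (simp add: H_def matrix_matrix_mult_def, intro continuous_intros contE)
    have dec: "exp_decay (\<lambda>r. H r $ a $ x)" for a x
      unfolding H_def matrix_matrix_mult_def vec_lambda_beta E_def
      by (intro exp_decay_sum exp_decay_cmult exp_decay_block_exp_bigLambda stable inv i)
    have conv: "(\<integral>u. indicator {v..t} u * (H (t - u) ** K (u - v)) $ a $ x \<partial>lborel) = G (t - v) i $ a $ x"
      if "v \<le> t" for v a x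
      using block_exp_convolution[where q = q and p = p and C = C and i = i and v = v and t = t and A = A and a = a and b = x,
          OF assms(2,3) i inv(2) that]
      unfolding H_def E_def K_def G_def by simp
    have "AE \<omega> in M. \<forall>a. integrable lborel (\<lambda>u. indicator {..t} u * (H (t - u) *v Y' u \<omega>) $ a) \<and>
        (\<integral>u. indicator {..t} u * (H (t - u) *v Y' u \<omega>) $ a \<partial>lborel) = X t \<omega> i $ a"
      unfolding AE_all_countable
      by (intro allI levy_convolution_AE[OF contH contK dec meas Y' X conv]) (use i assms(3) in auto)
    then show ?thesis
      using AE_space
    proof eventually_elim
      case (elim \<omega>)
      have "(\<lambda>u. \<Sum>j<q. block_exp q (block_scale (t - u) (bigLambda q C)) i j *v (bigTheta q C j *v Y u \<omega>))
          = (\<lambda>u. H (t - u) *v Y' u \<omega>)"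
      proof
        fix u
        obtain m where q: "q = Suc m" using assms(2) by (cases q) auto
        show "(\<Sum>j<q. block_exp q (block_scale (t - u) (bigLambda q C)) i j *v (bigTheta q C j *v Y u \<omega>))
            = H (t - u) *v Y' u \<omega>"
          unfolding Y_eq[OF elim(2)] H_def E_def bigTheta_def q
          by (simp add: last_block_def matrix_vector_mul_assoc)
      qed
      then show ?case using elim(1) by (simp add: has_lower_integralI)
    qed
  qed
  then have "AE \<omega> in M. \<forall>i\<in>{..<q}. has_lower_integral
             (\<lambda>u. \<Sum>j<q. block_exp q (block_scale (t - u) (bigLambda q C)) i j *v
                           (bigTheta q C j *v Y u \<omega>))
             t (X t \<omega> i)"
    by (intro AE_finite_allI) auto
  then show "AE \<omega> in M. \<forall>i<q. has_lower_integral
             (\<lambda>u. \<Sum>j<q. block_exp q (block_scale (t - u) (bigLambda q C)) i j *v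
                           (bigTheta q C j *v Y u \<omega>))
             t (X t \<omega> i)"
    by (simp only: Ball_def lessThan_iff)
qed

end
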